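(* Let $\Gamma$ be a meager digraph with at most finitely many infinite emitters. Let $F:\Gamma_{Ar}\to\mathbb R$ be a potential and $\beta\in\mathbb R$ such that for some $v_0\in\Gamma_V$, $0<\sum_{n=0}^\infty A(\beta)^n_{v_0,v}<\infty$ for all $v\in\Gamma_V$. Then there is an affine bijection between the $v_0$-normalized $e^{\beta F}$-conformal measures $m$ on $P(\Gamma)$ and the Borel probability measures $\nu$ on $\mathcal E_\beta(\Gamma)$, such that $$m(B)=\int_{\mathcal E_\beta(\Gamma)} m_E(B)\ \mathrm d\nu(E)$$ for all Borel sets $B\subseteq P(\Gamma)$.
   Context: **Digraphs and paths.** A countable directed graph (digraph) $\Gamma$ consists of countable sets $\Gamma_V$ (vertices) and $\Gamma_{Ar}$ (arrows) with source and range maps $s,r:\Gamma_{Ar}\to\Gamma_V$ (multiple arrows and loops allowed). $v$ is an infinite emitter if $\#s^{-1}(v)=\infty$. $P(\Gamma)$ is the set of infinite paths $p=(p_i)_{i\ge 1}\in(\Gamma_{Ar})^{\mathbb N}$, $r(p_i)=s(p_{i+1})$, with the topology inherited from the product of discrete spaces. $P_f(\Gamma)$ is the set of finite paths $\mu=a_1\cdots a_n$, $|\mu|=n$ (vertices are paths of length $0$), with $s(\mu)=s(a_1)$, $r(\mu)=r(a_n)$. $Z(v)=\{p\in P(\Gamma): s(p_1)=v\}$, $Z(a)=\{p\in P(\Gamma):p_1=a\}$ for an arrow $a$. The shift is $\sigma(p)_i=p_{i+1}$. **Conformal measures.** A potential $F:\Gamma_{Ar}\to\mathbb R$ is extended to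 finite paths by $F(a_1\cdots a_n)=\sum_i F(a_i)$, $F(v)=0$. $A(\beta)_{v,w}=\sum_{a\in s^{-1}(v)\cap r^{-1}(w)}e^{-\beta F(a)}$, a matrix over $\Gamma_V$ with entries in $[0,\infty]$; $A(\beta)^n$ are its powers, $A(\beta)^0$ the identity. A Borel measure $m$ on $P(\Gamma)$ is regular if $m(Z(v))<\infty$ for all $v$. A non-zero regular Borel measure $m$ is $e^{\beta F}$-conformal if $m(\sigma(B\cap Z(a)))=e^{\beta F(a)}m(B\cap Z(a))$ for all arrows $a$ and all Borel $B$. It is $v_0$-normalized if $m(Z(v_0))=1$. $m$ is concentrated on a Borel set $B$ if $m(P(\Gamma)\setminus B)=0$. **Ends.** $\mathrm{Wan}(\Gamma)$ is the set of $p\in P(\Gamma)$ such that for each finite $H\subseteq\Gamma_V$ there is $N$ with $s(p_i)\notin H$ for $i\ge N$. For $p,q\in\mathrm{Wan}(\Gamma)$ write $p\to q$ if for every finite $H\subseteq\Gamma_V$ and $N\in\mathbb N$ there are $n_1,n_2\ge N$ and a finite path $\mu$ from $s(p_{n_1})$ to $s(q_{n_2})$ none of whose vertices is in $H$. Write $p\sim q$ if $p\to q$ and $q\to p$; this is an equivalence relation, $\mathcal E(\Gamma)=\mathrm{Wan}(\Gamma)/\!\sim$ is the end space and $\mathcal E(p)$ is the class of $p$. For finite non-empty $H\subseteq \Gamma_V$ and $v\in H$, $w\notin H$, let $L_H(v,w)$ be the set of finite paths $a_1\cdots a_n$ from $v$ to $w$ with $r(a_i)\notin H$ for all $i$. For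 $p\in\mathrm{Wan}(\Gamma)$ let $[H]_p$ be the set of $v\in H$ such that for all $N$ there is $n\ge N$ with $L_H(v,s(p_n))\ne\emptyset$. The topology of $\mathcal E(\Gamma)$ has as base the sets $\{\mathcal E(p): p\in\mathrm{Wan}(\Gamma), [H]_p=I\}$, with $I\subseteq H$ finite subsets of $\Gamma_V$, $H\neq\emptyset$; Borel structure refers to this topology. **Reduced rays, meager digraphs.** A ray is an infinite path $p$ with $s(p_i)$, $i\geq 1$, distinct; $\mathrm{Ray}(\Gamma)$ is the set of rays. A ray $y$ is reduced if for every arrow $a$ with $s(a)=s(y_i)$, $r(a)=s(y_j)$ one has $j-i\le 1$; $\mathrm{Rray}(\Gamma)$ is the set of reduced rays. Paths $p,q$ are tail-equivalent if there are $n,m$ with $s(p_{n+i})=s(q_{m+i})$ for all $i\in\mathbb N$. Tail-equivalent wandering paths define the same end, so there is a map $\mathrm{Rray}(\Gamma)/\mathrm{Tail}\to\mathcal E(\Gamma)$; $\Gamma$ is meager if this map is a bijection. **Summability.** For a ray $y$ let $L_j(y)$ be the set of finite paths $a_1\cdots a_n$ ($n\geq 1$) from $s(y_j)$ to $s(y_{j+1})$ with $r(a_i)\notin\{s(y_1),\dots,s(y_j)\}$ for all $i$, and $\mathbb W(y[1,k[)=\prod_{j=1}^{k-1}\sum_{\nu\in L_j(y)}e^{-\beta F(\nu)}$ (equal to $1$ for $k=1$). The limit (of a non-decreasing sequence) $\mathbb V_\beta(v,y)=\lim_{k\to\infty}\mathbb W(y[1,k[)^{-1}\sum_{n=0}^\infty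 A(\beta)^n_{v,s(y_k)}$ exists in $[0,\infty]$. Let $B_k(y)=\{x\in P(\Gamma): s(x_1)=s(y_k),\ s(x_i)\notin\{s(y_1),\dots,s(y_k)\}\ \forall i\ge2\}$, $\mathbb B_k(y)=B_k(y)\cap\bigcap_{j\ge k+1}\bigcup_{i\ge0}\sigma^{-i}(B_j(y))$ and $\mathbb B(y)=\bigcup_{n,k\ge0}\sigma^{-n}(\sigma^k(\mathbb B_1(y)))$. Set $\mathrm{Rray}_\beta(\Gamma)=\{y\in\mathrm{Rray}(\Gamma):\mathbb V_\beta(v_0,y)<\infty\}$; for $y\in \mathrm{Rray}_\beta(\Gamma)$ there is a unique $v_0$-normalized $e^{\beta F}$-conformal measure $m_y$ concentrated on $\mathbb B(y)$. When $\Gamma$ is meager with at most finitely many infinite emitters there is a Borel map $\xi_R:\mathcal E(\Gamma)\to\mathrm{Rray}(\Gamma)$ with $\mathbb B(\xi_R(E))=E$ for all ends $E$; fix one. Set $\mathcal E_\beta(\Gamma)=\xi_R^{-1}(\mathrm{Rray}_\beta(\Gamma))$ and $m_E=m_{\xi_R(E)}$ for $E\in\mathcal E_\beta(\Gamma)$. *)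

theory Defs
  imports "HOL-Probability.Probability" "Graph_Theory.Arc_Walk"
begin

text \<open>
  Digraphs are the records of \<^locale>\<open>wf_digraph\<close> (loops, multiple arrows and infinitely many
  vertices or arrows allowed): \<^const>\<open>tail\<close> is the source map, \<^const>\<open>head\<close> the range map.
  A finite path from \<open>u\<close> to \<open>v\<close> is a list of arrows \<open>\<mu>\<close> with \<open>pre_digraph.awalk G u \<mu> v\<close>; the
  empty list represents the path of length 0.

  Infinite paths are sequences indexed from 0, so \<open>p i\<close> is the arrow usually written
  \<open>p\<^sub>i\<^sub>+\<^sub>1\<close>.  All quantities below that carry an index \<open>j\<close> or \<open>k\<close> along a path are shifted by one
  accordingly (index 0 here is index 1 in the usual convention).
\<close>

locale countable_digraph = wf_digraph +
  assumes countable_verts: "countable (verts G)"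
    and countable_arcs: "countable (arcs G)"

definition borel_of :: "'x topology \<Rightarrow> 'x measure" where
  "borel_of X = sigma (topspace X) {U. openin X U}"


subsection \<open>Infinite paths\<close>

definition inf_paths :: "('a, 'b) pre_digraph \<Rightarrow> (nat \<Rightarrow> 'b) set" where
  "inf_paths G = {p. (\<forall>i. p i \<in> arcs G) \<and> (\<forall>i. head G (p i) = tail G (p (Suc i)))}"

definition path_topology :: "('a, 'b) pre_digraph \<Rightarrow> (nat \<Rightarrow> 'b) topology" where
  "path_topology G =
     subtopology (product_topology (\<lambda>_. discrete_topology (arcs G)) UNIV) (inf_paths G)"

definition path_borel :: "('a, 'b) pre_digraph \<Rightarrow> (nat \<Rightarrow> 'b) measure" where
  "path_borel G = borel_of (path_topology G)"

definition cyl_vert :: "('a, 'b) pre_digraph \<Rightarrow> 'a \<Rightarrow> (nat \<Rightarrow> 'b) set" where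
  "cyl_vert G v = {p \<in> inf_paths G. tail G (p 0) = v}"

definition cyl_arc :: "('a, 'b) pre_digraph \<Rightarrow> 'b \<Rightarrow> (nat \<Rightarrow> 'b) set" where
  "cyl_arc G a = {p \<in> inf_paths G. p 0 = a}"

definition shift :: "(nat \<Rightarrow> 'b) \<Rightarrow> (nat \<Rightarrow> 'b)" where
  "shift p = (\<lambda>i. p (Suc i))"


subsection \<open>Potentials and conformal measures\<close>

definition path_weight :: "('b \<Rightarrow> real) \<Rightarrow> real \<Rightarrow> 'b list \<Rightarrow> ennreal" where
  "path_weight F \<beta> \<mu> = ennreal (exp (- \<beta> * sum_list (map F \<mu>)))"

text \<open>Possibly infinite sums of elements of \<open>[0,\<infinity>]\<close> are integrals against the counting measure.\<close>

definition A_mat :: "('a, 'b) pre_digraph \<Rightarrow> ('b \<Rightarrow> real) \<Rightarrow> real \<Rightarrow> 'a \<Rightarrow> 'a \<Rightarrow> ennreal" where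
  "A_mat G F \<beta> v w =
     (\<integral>\<^sup>+ a. ennreal (exp (- \<beta> * F a)) \<partial>count_space (out_arcs G v \<inter> in_arcs G w))"

primrec A_pow :: "('a, 'b) pre_digraph \<Rightarrow> ('b \<Rightarrow> real) \<Rightarrow> real \<Rightarrow> nat \<Rightarrow> 'a \<Rightarrow> 'a \<Rightarrow> ennreal" where
  "A_pow G F \<beta> 0 v w = (if v = w then 1 else 0)"
| "A_pow G F \<beta> (Suc n) v w =
     (\<integral>\<^sup>+ u. A_mat G F \<beta> v u * A_pow G F \<beta> n u w \<partial>count_space (verts G))"

definition A_green :: "('a, 'b) pre_digraph \<Rightarrow> ('b \<Rightarrow> real) \<Rightarrow> real \<Rightarrow> 'a \<Rightarrow> 'a \<Rightarrow> ennreal" where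
  "A_green G F \<beta> v w = (\<Sum>n. A_pow G F \<beta> n v w)"

definition regular_borel_measure ::
  "('a, 'b) pre_digraph \<Rightarrow> (nat \<Rightarrow> 'b) measure \<Rightarrow> bool" where
  "regular_borel_measure G m \<longleftrightarrow>
     sets m = sets (path_borel G) \<and> (\<forall>v\<in>verts G. emeasure m (cyl_vert G v) < \<infinity>)"

definition conformal_measure ::
  "('a, 'b) pre_digraph \<Rightarrow> ('b \<Rightarrow> real) \<Rightarrow> real \<Rightarrow> (nat \<Rightarrow> 'b) measure \<Rightarrow> bool" where
  "conformal_measure G F \<beta> m \<longleftrightarrow>
     regular_borel_measure G m \<and> emeasure m (space m) \<noteq> 0 \<and>
     (\<forall>a\<in>arcs G. \<forall>B\<in>sets (path_borel G).
        emeasure m (shift ` (B \<inter> cyl_arc G a)) =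
          ennreal (exp (\<beta> * F a)) * emeasure m (B \<inter> cyl_arc G a))"

definition normalized_conformal_measures ::
  "('a, 'b) pre_digraph \<Rightarrow> ('b \<Rightarrow> real) \<Rightarrow> real \<Rightarrow> 'a \<Rightarrow> (nat \<Rightarrow> 'b) measure set" where
  "normalized_conformal_measures G F \<beta> v0 =
     {m. conformal_measure G F \<beta> m \<and> emeasure m (cyl_vert G v0) = 1}"

definition concentrated_on :: "'x measure \<Rightarrow> 'x set \<Rightarrow> bool" where
  "concentrated_on m B \<longleftrightarrow> B \<in> sets m \<and> emeasure m (space m - B) = 0"


subsection \<open>The end space\<close>

definition wandering :: "('a, 'b) pre_digraph \<Rightarrow> (nat \<Rightarrow> 'b) set" where
  "wandering G = {p \<in> inf_paths G.
     \<forall>H. finite H \<and> H \<subseteq> verts G \<longrightarrow> (\<exists>N. \<forall>i\<ge>N. tail G (p i) \<notin> H)}"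

definition leads_to :: "('a, 'b) pre_digraph \<Rightarrow> (nat \<Rightarrow> 'b) \<Rightarrow> (nat \<Rightarrow> 'b) \<Rightarrow> bool" where
  "leads_to G p q \<longleftrightarrow>
     (\<forall>H N. finite H \<and> H \<subseteq> verts G \<longrightarrow>
        (\<exists>n1\<ge>N. \<exists>n2\<ge>N. \<exists>\<mu>. pre_digraph.awalk G (tail G (p n1)) \<mu> (tail G (q n2)) \<and>
           set (pre_digraph.awalk_verts G (tail G (p n1)) \<mu>) \<inter> H = {}))"

definition end_rel :: "('a, 'b) pre_digraph \<Rightarrow> (nat \<Rightarrow> 'b) rel" where
  "end_rel G = {(p, q). p \<in> wandering G \<and> q \<in> wandering G \<and> leads_to G p q \<and> leads_to G q p}"

definition ends :: "('a, 'b) pre_digraph \<Rightarrow> (nat \<Rightarrow> 'b) set set" where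
  "ends G = wandering G // end_rel G"

definition end_class :: "('a, 'b) pre_digraph \<Rightarrow> (nat \<Rightarrow> 'b) \<Rightarrow> (nat \<Rightarrow> 'b) set" where
  "end_class G p = end_rel G `` {p}"

definition exit_paths :: "('a, 'b) pre_digraph \<Rightarrow> 'a set \<Rightarrow> 'a \<Rightarrow> 'a \<Rightarrow> 'b list set" where
  "exit_paths G H v w =
     {\<mu>. v \<in> H \<and> w \<notin> H \<and> pre_digraph.awalk G v \<mu> w \<and> (\<forall>a\<in>set \<mu>. head G a \<notin> H)}"

text \<open>The set written \<open>[H]\<^sub>p\<close>.\<close>

definition exit_verts :: "('a, 'b) pre_digraph \<Rightarrow> 'a set \<Rightarrow> (nat \<Rightarrow> 'b) \<Rightarrow> 'a set" where
  "exit_verts G H p = {v \<in> H. \<forall>N. \<exists>n\<ge>N. exit_paths G H v (tail G (p n)) \<noteq> {}}"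

definition end_topology :: "('a, 'b) pre_digraph \<Rightarrow> (nat \<Rightarrow> 'b) set topology" where
  "end_topology G = topology_generated_by
     {end_class G ` {p \<in> wandering G. exit_verts G H p = I} | H I.
        finite H \<and> H \<subseteq> verts G \<and> H \<noteq> {} \<and> I \<subseteq> H}"


subsection \<open>Rays, reduced rays and meager digraphs\<close>

definition rays :: "('a, 'b) pre_digraph \<Rightarrow> (nat \<Rightarrow> 'b) set" where
  "rays G = {p \<in> inf_paths G. inj (\<lambda>i. tail G (p i))}"

definition reduced_rays :: "('a, 'b) pre_digraph \<Rightarrow> (nat \<Rightarrow> 'b) set" where
  "reduced_rays G = {y \<in> rays G. \<forall>i j. \<forall>a\<in>arcs G.
     tail G a = tail G (y i) \<and> head G a = tail G (y j) \<longrightarrow> j \<le> i + 1}"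

definition tail_equivalent :: "('a, 'b) pre_digraph \<Rightarrow> (nat \<Rightarrow> 'b) \<Rightarrow> (nat \<Rightarrow> 'b) \<Rightarrow> bool" where
  "tail_equivalent G p q \<longleftrightarrow> (\<exists>n m. \<forall>i. tail G (p (n + i)) = tail G (q (m + i)))"

definition reduced_ray_tail_rel :: "('a, 'b) pre_digraph \<Rightarrow> (nat \<Rightarrow> 'b) rel" where
  "reduced_ray_tail_rel G =
     {(p, q). p \<in> reduced_rays G \<and> q \<in> reduced_rays G \<and> tail_equivalent G p q}"

text \<open>
  \<open>end_class G ` C\<close> is a singleton for a tail-equivalence class \<open>C\<close> of reduced rays, so
  \<^const>\<open>the_elem\<close> yields the map induced on the quotient.
\<close>

definition meager :: "('a, 'b) pre_digraph \<Rightarrow> bool" where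
  "meager G \<longleftrightarrow>
     bij_betw (\<lambda>C. the_elem (end_class G ` C)) (reduced_rays G // reduced_ray_tail_rel G) (ends G)"


subsection \<open>Summable rays and the measures they carry\<close>

definition ray_link_paths ::
  "('a, 'b) pre_digraph \<Rightarrow> (nat \<Rightarrow> 'b) \<Rightarrow> nat \<Rightarrow> 'b list set" where
  "ray_link_paths G y j =
     {\<mu>. \<mu> \<noteq> [] \<and> pre_digraph.awalk G (tail G (y j)) \<mu> (tail G (y (Suc j))) \<and>
         (\<forall>a\<in>set \<mu>. head G a \<notin> (\<lambda>i. tail G (y i)) ` {..j})}"

text \<open>With 0-based indices, \<open>ray_weight G F \<beta> y k\<close> is \<open>\<W>(y[1,k+1[)\<close> in 1-based notation.\<close>

definition ray_weight ::
  "('a, 'b) pre_digraph \<Rightarrow> ('b \<Rightarrow> real) \<Rightarrow> real \<Rightarrow> (nat \<Rightarrow> 'b) \<Rightarrow> nat \<Rightarrow> ennreal" where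
  "ray_weight G F \<beta> y k =
     (\<Prod>j<k. \<integral>\<^sup>+ \<nu>. path_weight F \<beta> \<nu> \<partial>count_space (ray_link_paths G y j))"

definition ray_potential ::
  "('a, 'b) pre_digraph \<Rightarrow> ('b \<Rightarrow> real) \<Rightarrow> real \<Rightarrow> 'a \<Rightarrow> (nat \<Rightarrow> 'b) \<Rightarrow> ennreal" where
  "ray_potential G F \<beta> v y =
     lim (\<lambda>k. inverse (ray_weight G F \<beta> y k) * A_green G F \<beta> v (tail G (y k)))"

definition summable_rays ::
  "('a, 'b) pre_digraph \<Rightarrow> ('b \<Rightarrow> real) \<Rightarrow> real \<Rightarrow> 'a \<Rightarrow> (nat \<Rightarrow> 'b) set" where
  "summable_rays G F \<beta> v0 = {y \<in> rays G. ray_potential G F \<beta> v0 y < \<infinity>}"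

definition ray_exit_set ::
  "('a, 'b) pre_digraph \<Rightarrow> (nat \<Rightarrow> 'b) \<Rightarrow> nat \<Rightarrow> (nat \<Rightarrow> 'b) set" where
  "ray_exit_set G y k =
     {x \<in> inf_paths G. tail G (x 0) = tail G (y k) \<and>
        (\<forall>i\<ge>1. tail G (x i) \<notin> (\<lambda>j. tail G (y j)) ` {..k})}"

text \<open>The sets \<open>\<bbbB>\<^sub>k(y)\<close> and \<open>\<bbbB>(y)\<close>; \<open>\<sigma>\<^sup>-\<^sup>i\<close> is the preimage within the path space.\<close>

definition ray_follow_set ::
  "('a, 'b) pre_digraph \<Rightarrow> (nat \<Rightarrow> 'b) \<Rightarrow> nat \<Rightarrow> (nat \<Rightarrow> 'b) set" where
  "ray_follow_set G y k =
     ray_exit_set G y k \<inter>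
     (\<Inter>j\<in>{Suc k..}. \<Union>i. (shift ^^ i) -` ray_exit_set G y j \<inter> inf_paths G)"

definition ray_basin :: "('a, 'b) pre_digraph \<Rightarrow> (nat \<Rightarrow> 'b) \<Rightarrow> (nat \<Rightarrow> 'b) set" where
  "ray_basin G y =
     (\<Union>n k. (shift ^^ n) -` ((shift ^^ k) ` ray_follow_set G y 0) \<inter> inf_paths G)"

text \<open>For \<open>y \<in> summable_rays G F \<beta> v0\<close> the following measure exists and is unique.\<close>

definition ray_measure ::
  "('a, 'b) pre_digraph \<Rightarrow> ('b \<Rightarrow> real) \<Rightarrow> real \<Rightarrow> 'a \<Rightarrow> (nat \<Rightarrow> 'b) \<Rightarrow> (nat \<Rightarrow> 'b) measure" where
  "ray_measure G F \<beta> v0 y =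
     (THE m. m \<in> normalized_conformal_measures G F \<beta> v0 \<and> concentrated_on m (ray_basin G y))"

text \<open>
  The maps \<open>\<xi>\<^sub>R\<close>: Borel maps choosing for every end \<open>E\<close> a reduced ray \<open>y\<close> with \<open>\<bbbB>(y) = E\<close>.
\<close>

definition end_selector ::
  "('a, 'b) pre_digraph \<Rightarrow> ((nat \<Rightarrow> 'b) set \<Rightarrow> (nat \<Rightarrow> 'b)) \<Rightarrow> bool" where
  "end_selector G \<xi> \<longleftrightarrow>
     \<xi> \<in> borel_of (end_topology G) \<rightarrow>\<^sub>M borel_of (subtopology (path_topology G) (reduced_rays G)) \<and>
     (\<forall>E\<in>ends G. ray_basin G (\<xi> E) = E)"

definition summable_ends ::
  "('a, 'b) pre_digraph \<Rightarrow> ('b \<Rightarrow> real) \<Rightarrow> real \<Rightarrow> 'a \<Rightarrow>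
     ((nat \<Rightarrow> 'b) set \<Rightarrow> (nat \<Rightarrow> 'b)) \<Rightarrow> (nat \<Rightarrow> 'b) set set" where
  "summable_ends G F \<beta> v0 \<xi> = {E \<in> ends G. \<xi> E \<in> summable_rays G F \<beta> v0}"

definition end_measure ::
  "('a, 'b) pre_digraph \<Rightarrow> ('b \<Rightarrow> real) \<Rightarrow> real \<Rightarrow> 'a \<Rightarrow>
     ((nat \<Rightarrow> 'b) set \<Rightarrow> (nat \<Rightarrow> 'b)) \<Rightarrow> (nat \<Rightarrow> 'b) set \<Rightarrow> (nat \<Rightarrow> 'b) measure" where
  "end_measure G F \<beta> v0 \<xi> E = ray_measure G F \<beta> v0 (\<xi> E)"

definition summable_end_borel ::
  "('a, 'b) pre_digraph \<Rightarrow> ('b \<Rightarrow> real) \<Rightarrow> real \<Rightarrow> 'a \<Rightarrow>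
     ((nat \<Rightarrow> 'b) set \<Rightarrow> (nat \<Rightarrow> 'b)) \<Rightarrow> (nat \<Rightarrow> 'b) set measure" where
  "summable_end_borel G F \<beta> v0 \<xi> =
     borel_of (subtopology (end_topology G) (summable_ends G F \<beta> v0 \<xi>))"


subsection \<open>Borel probability measures and affine maps between sets of measures\<close>

definition prob_measures_on :: "'x measure \<Rightarrow> 'x measure set" where
  "prob_measures_on M = {\<nu>. sets \<nu> = sets M \<and> prob_space \<nu>}"

definition convex_comb_measure :: "real \<Rightarrow> 'x measure \<Rightarrow> 'x measure \<Rightarrow> 'x measure" where
  "convex_comb_measure t M N =
     measure_of (space M) (sets M)
       (\<lambda>B. ennreal t * emeasure M B + ennreal (1 - t) * emeasure N B)"

definition affine_map_on :: "'x measure set \<Rightarrow> ('x measure \<Rightarrow> 'y measure) \<Rightarrow> bool" where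
  "affine_map_on D \<Phi> \<longleftrightarrow>
     (\<forall>M\<in>D. \<forall>N\<in>D. \<forall>t\<in>{0..1}.
        \<Phi> (convex_comb_measure t M N) = convex_comb_measure t (\<Phi> M) (\<Phi> N))"

end

theory Submission
  imports Defs
begin

text \<open>
  Write \<open>g\<close> for Green's function \<open>A_green\<close>, \<open>W\<^sub>k\<close> for \<open>ray_weight\<close> and \<open>V(v, y)\<close> for \<open>ray_potential\<close>, and
  let \<open>y\<^sub>k\<close> be the \<open>k\<close>-th vertex of a ray \<open>y\<close>, counted from 0.  The sets \<open>Z(v)\<close> have finite measure and \<open>g\<close> is finite,
  so by Borel and Cantelli almost every path visits each vertex finitely often
  (\<open>AE_wandering\<close>), and a conformal measure lives on the disjoint union of the ends.  Say that a path
  passes the \<open>j\<close>-th exit of \<open>y\<close> when it leaves \<open>y\<^sub>j\<close> and never sees \<open>y\<^sub>0, \<dots>, y\<^sub>j\<close> again.  The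
  end carried by \<open>y\<close> consists of the paths that pass all but finitely many exits of \<open>y\<close>
  (\<open>ray_basin_iff\<close>).

  The heart of the matter is to cut a path at its \<open>k\<close>-th exit.  Conformality turns sums over the prefixes of
  a random path into sums over the finite paths that can be put in front of it
  (\<open>conformal_transport\<close>).  Hence, inside a fixed end, the mass of the paths from \<open>v\<close> that pass
  the exits \<open>k, k + 1, \<dots>\<close> is \<open>g(v, y\<^sub>k)\<close> times the mass of those starting right at the \<open>k\<close>-th exit
  (\<open>transport_green\<close>), and passing from exit \<open>k\<close> to exit \<open>k + 1\<close> costs the total weight of the links between
  \<open>y\<^sub>k\<close> and \<open>y\<^sub>k\<^sub>+\<^sub>1\<close> (\<open>transport_link\<close>).  Together, the mass is \<open>g(v, y\<^sub>k) / W\<^sub>k\<close> times the mass of the paths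
  that pass every exit starting at \<open>y\<^sub>0\<close>.  Both sides increase with \<open>k\<close>, and the limit is \<open>V(v, y)\<close> times
  that mass.  Since \<open>y\<close> depends on the end, all of this is done with a ray \<open>Y x\<close>
  that is a measurable and shift invariant function of the path \<open>x\<close>; step \<open>k\<close> only involves finitely many
  vertices of the ray, so there are countably many cases.  The result is \<open>ray_field_formula\<close>.

  For \<open>v = v0\<close> it shows that almost every path goes to an end with \<open>V(v0, \<xi> E) < \<infinity>\<close>
  (\<open>AE_summable\<close>).  Dividing the formula for \<open>v\<close> by the one for \<open>v0\<close> gives
  \<open>m(Z(v)) = \<integral> V(v, \<xi> E) / V(v0, \<xi> E) d\<nu>(E)\<close>, where \<open>\<nu>\<close> is the distribution under \<open>m\<close> of the end of a path from
  \<open>v0\<close> (\<open>cyl_vert_decomposition\<close>).  A conformal measure is determined by its values on the sets \<open>Z(v)\<close>, so a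
  normalized one that is concentrated on \<open>E\<close> must satisfy \<open>m(Z(v)) = V(v, \<xi> E) / V(v0, \<xi> E)\<close> and is unique, and
  the integral formula of the theorem follows for general \<open>m\<close>.

  It remains to see that the measure of a summable ray \<open>y\<close> exists.  The vector \<open>V(\<cdot>, y)\<close> is harmonic
  (\<open>potential_harmonic\<close>), and a finite harmonic vector is \<open>v \<mapsto> m(Z(v))\<close> for a path measure \<open>m\<close>, by the Ionescu-Tulcea
  theorem for the Markov chain obtained from it by Doob's transform (\<open>harmonic_path_measure\<close>).  To see that \<open>m\<close>
  charges only the end of \<open>y\<close>, compare the first return equation of \<open>m\<close> with that of \<open>g\<close>
  (\<open>cyl_vert_first_return\<close>, \<open>potential_first_return\<close>).  After normalization, the \<open>k\<close>-th exit set gets mass at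
  least \<open>1 / (W\<^sub>k V(v0, y))\<close>, hence the paths that pass every exit starting at \<open>y\<^sub>0\<close> get mass at least \<open>1 / V(v0, y)\<close>,
  and by \<open>ray_field_formula\<close> nothing is left outside the end.

  The inverse of \<open>m \<mapsto> \<nu>\<close> is \<open>\<nu> \<mapsto> \<integral> m\<^sub>E d\<nu>(E)\<close>: the measure \<open>m\<^sub>E\<close> gives mass 1 to the paths from \<open>v0\<close>, all of which go
  to \<open>E\<close>, so the mixture has end distribution \<open>\<nu>\<close>.
\<close>

section \<open>Infinite paths and their Borel structure\<close>

primrec starts_with :: "'b list \<Rightarrow> (nat \<Rightarrow> 'b) \<Rightarrow> bool" where
  "starts_with [] x = True"
| "starts_with (a # \<nu>) x = (x 0 = a \<and> starts_with \<nu> (shift x))"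

lemma shift_funpow: "(shift ^^ n) x = (\<lambda>i. x (n + i))"
  by (induction n) (auto simp: shift_def fun_eq_iff)

lemma shift_funpow_nth [simp]: "(shift ^^ n) x i = x (n + i)"
  by (simp add: shift_funpow)

lemma shift_nth [simp]: "shift x i = x (Suc i)"
  by (simp add: shift_def)

lemma shift_funpow_add: "(shift ^^ n) ((shift ^^ k) x) = (shift ^^ (n + k)) x"
  by (simp add: funpow_add)

lemma starts_with_iff: "starts_with \<nu> x \<longleftrightarrow> map x [0..<length \<nu>] = \<nu>"
proof (induction \<nu> arbitrary: x)
  case (Cons a \<nu>)
  have "map x [0..<length (a # \<nu>)] = x 0 # map (shift x) [0..<length \<nu>]"
    by (rule nth_equalityI) (simp_all add: nth_Cons' del: upt_Suc)
  then show ?case unfolding starts_with.simps Cons.IH by simp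
qed simp

lemma starts_with_nth: "starts_with \<nu> x \<Longrightarrow> i < length \<nu> \<Longrightarrow> \<nu> ! i = x i"
  by (metis starts_with_iff add_0 diff_zero length_upt nth_map nth_upt)

lemma starts_with_prefix: "starts_with (map x [0..<n]) x"
  by (simp add: starts_with_iff)

lemma starts_with_append:
  "starts_with (\<mu> @ \<nu>) x \<longleftrightarrow> starts_with \<mu> x \<and> starts_with \<nu> ((shift ^^ length \<mu>) x)"
  by (induction \<mu> arbitrary: x) (auto simp: funpow_swap1)

lemma starts_with_take:
  assumes "starts_with \<mu> x" "starts_with \<nu> x" "length \<mu> \<le> length \<nu>"
  shows "\<exists>\<rho>. \<nu> = \<mu> @ \<rho>"
proof -
  have "take (length \<mu>) \<nu> = \<mu>"
    using assms by (intro nth_equalityI) (auto simp: starts_with_nth)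
  then show ?thesis by (metis append_take_drop_id)
qed

context wf_digraph
begin

lemma inf_paths_arc: "x \<in> inf_paths G \<Longrightarrow> x i \<in> arcs G"
  and inf_paths_step: "x \<in> inf_paths G \<Longrightarrow> tail G (x (Suc i)) = head G (x i)"
  by (auto simp: inf_paths_def)

lemma inf_paths_tail: "x \<in> inf_paths G \<Longrightarrow> tail G (x i) \<in> verts G"
  by (auto simp: inf_paths_def)

lemma shift_inf_paths [intro]: "x \<in> inf_paths G \<Longrightarrow> shift x \<in> inf_paths G"
  by (auto simp: inf_paths_def shift_def)

lemma shift_funpow_inf_paths [intro]: "x \<in> inf_paths G \<Longrightarrow> (shift ^^ n) x \<in> inf_paths G"
  by (induction n) auto

lemma inf_path_walk:
  "x \<in> inf_paths G \<Longrightarrow> awalk (tail G (x i)) (map x [i..<i + n]) (tail G (x (i + n)))"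
proof (induction n arbitrary: i)
  case 0
  then show ?case by (simp add: awalk_Nil_iff inf_paths_tail)
next
  case (Suc n)
  have "[i..<i + Suc n] = i # [Suc i..<Suc i + n]"
    using upt_conv_Cons[of i "i + Suc n"] by (simp del: upt_Suc)
  with Suc.IH[of "Suc i"] Suc.prems show ?case
    by (simp add: awalk_Cons_iff inf_paths_arc inf_paths_step del: upt_Suc)
qed

lemma starts_with_walk:
  assumes "x \<in> inf_paths G" "starts_with \<nu> x"
  shows "awalk (tail G (x 0)) \<nu> (tail G (x (length \<nu>)))"
  using inf_path_walk[OF assms(1), of 0 "length \<nu>"] assms(2) by (simp add: starts_with_iff)

lemma starts_with_start:
  assumes "starts_with \<nu> x" "awalk u \<nu> v" "\<nu> \<noteq> []"
  shows "tail G (x 0) = u"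
  using assms by (cases \<nu>) (auto simp: awalk_Cons_iff)

lemma awalk_end_unique: "awalk u \<nu> v \<Longrightarrow> awalk u \<nu> v' \<Longrightarrow> v = v'"
  unfolding awalk_def by (metis awlast_if_cas)

lemma awalk_end_unique': "awalk u \<nu> v \<Longrightarrow> awalk u' \<nu> v' \<Longrightarrow> \<nu> \<noteq> [] \<Longrightarrow> u = u' \<and> v = v'"
  by (cases \<nu>) (simp_all add: awalk_Cons_iff, metis awalk_end_unique)

lemma awalk_last_head: "awalk u \<nu> v \<Longrightarrow> \<nu> \<noteq> [] \<Longrightarrow> head G (last \<nu>) = v"
  by (induction \<nu> arbitrary: u) (auto simp: awalk_simps)

definition cyl :: "'b list \<Rightarrow> (nat \<Rightarrow> 'b) set" where
  "cyl \<nu> = {x \<in> inf_paths G. starts_with \<nu> x}"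

text \<open>
  The cylinders form a tree, so together with the empty set they are an intersection-stable
  generator.
\<close>

lemma cyl_Int: "cyl \<mu> \<inter> cyl \<nu> \<in> {{}, cyl \<mu>, cyl \<nu>}"
proof (cases "cyl \<mu> \<inter> cyl \<nu> = {}")
  case False
  then obtain x where x: "starts_with \<mu> x" "starts_with \<nu> x" by (auto simp: cyl_def)
  then consider \<rho> where "\<nu> = \<mu> @ \<rho>" | \<rho> where "\<mu> = \<nu> @ \<rho>"
    by (metis starts_with_take nat_le_linear)
  then show ?thesis by cases (auto simp: cyl_def starts_with_append)
qed simp

lemma Int_stable_cyl: "Int_stable (insert {} (range cyl))"
proof (rule Int_stableI)
  fix a b assume "a \<in> insert {} (range cyl)" "b \<in> insert {} (range cyl)"
  then consider "a \<inter> b = {}" | \<mu> \<nu> where "a = cyl \<mu>" "b = cyl \<nu>" by auto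
  then show "a \<inter> b \<in> insert {} (range cyl)"
  proof cases
    case 2
    with cyl_Int[of \<mu> \<nu>] show ?thesis by auto
  qed simp
qed

lemma topspace_path_topology [simp]: "topspace (path_topology G) = inf_paths G"
  by (auto simp: path_topology_def inf_paths_def PiE_def)

lemma openin_cyl: "openin (path_topology G) (cyl \<nu>)"
proof -
  let ?U = "\<lambda>i. if i < length \<nu> then {\<nu> ! i} \<inter> arcs G else arcs G"
  have "{i. ?U i \<noteq> arcs G} \<subseteq> {..<length \<nu>}" by auto
  then have "finite {i. ?U i \<noteq> arcs G}" by (rule finite_subset) simp
  then have "openin (product_topology (\<lambda>_. discrete_topology (arcs G)) UNIV) (PiE UNIV ?U)"
    by (auto simp: openin_PiE_gen)
  moreover have "cyl \<nu> = PiE UNIV ?U \<inter> inf_paths G"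
  proof (intro set_eqI iffI)
    fix x assume "x \<in> PiE UNIV ?U \<inter> inf_paths G"
    then have x: "x \<in> inf_paths G" and "\<And>i. x i \<in> ?U i" by (auto simp: PiE_iff)
    then have "\<And>i. i < length \<nu> \<Longrightarrow> x i = \<nu> ! i" by (metis IntD1 singletonD)
    then have "map x [0..<length \<nu>] = \<nu>" by (intro nth_equalityI) auto
    with x show "x \<in> cyl \<nu>" by (simp add: cyl_def starts_with_iff)
  qed (auto simp: cyl_def starts_with_nth inf_paths_arc)
  ultimately show ?thesis by (auto simp: path_topology_def openin_subtopology)
qed

lemma open_contains_cyl:
  assumes U: "openin (path_topology G) U" and x: "x \<in> U"
  shows "\<exists>n. cyl (map x [0..<n]) \<subseteq> U"
proof -
  obtain T where T: "openin (product_topology (\<lambda>_. discrete_topology (arcs G)) UNIV) T"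
    and UT: "U = T \<inter> inf_paths G"
    using U by (auto simp: path_topology_def openin_subtopology)
  have "x \<in> T" using x UT by auto
  with T obtain W where W: "finite {i. W i \<noteq> arcs G}" "x \<in> PiE UNIV W" "PiE UNIV W \<subseteq> T"
    unfolding openin_product_topology_alt by (auto simp: topspace_discrete_topology)
  obtain n where n: "\<And>i. W i \<noteq> arcs G \<Longrightarrow> i < n"
    using finite_nat_bounded[OF W(1)] by auto
  have "y \<in> PiE UNIV W" if y: "y \<in> cyl (map x [0..<n])" for y
  proof -
    have "y i \<in> W i" for i
    proof (cases "i < n")
      case True
      then have "y i = x i" using y starts_with_nth[of "map x [0..<n]" y i] by (simp add: cyl_def)
      with W(2) show ?thesis by (simp add: PiE_def Pi_def)
    next
      case False
      then have "W i = arcs G" using n by blast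
      with y show ?thesis by (auto simp: cyl_def inf_paths_arc)
    qed
    then show ?thesis by (simp add: PiE_def)
  qed
  then have "cyl (map x [0..<n]) \<subseteq> T" using W(3) by blast
  then have "cyl (map x [0..<n]) \<subseteq> U" using UT by (auto simp: cyl_def)
  then show ?thesis ..
qed

end

lemma space_borel_of [simp]: "space (borel_of X) = topspace X"
  by (simp add: borel_of_def space_measure_of_conv)

lemma sets_borel_of: "sets (borel_of X) = sigma_sets (topspace X) {U. openin X U}"
proof -
  have "{U. openin X U} \<subseteq> Pow (topspace X)" by (auto dest: openin_subset)
  then show ?thesis by (simp add: borel_of_def)
qed

lemma openin_sets_borel_of: "openin X U \<Longrightarrow> U \<in> sets (borel_of X)"
  by (simp add: sets_borel_of)

context countable_digraph
begin

lemma countable_lists_arcs: "countable (lists (arcs G))"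
  using countable_arcs by (rule countable_lists)

lemma space_path_borel [simp]: "space (path_borel G) = inf_paths G"
  by (simp add: path_borel_def)

lemma cyl_sets [measurable]: "cyl \<nu> \<in> sets (path_borel G)"
  by (simp add: path_borel_def openin_sets_borel_of openin_cyl)

text \<open>There are only countably many cylinders, and every open set is a union of cylinders.\<close>

lemma sets_path_borel: "sets (path_borel G) = sigma_sets (inf_paths G) (insert {} (range cyl))"
proof -
  have "U \<in> sigma_sets (inf_paths G) (insert {} (range cyl))"
    if U: "openin (path_topology G) U" for U
  proof -
    let ?L = "{\<nu> \<in> lists (arcs G). cyl \<nu> \<subseteq> U}"
    have "x \<in> (\<Union>\<nu>\<in>?L. cyl \<nu>)" if x: "x \<in> U" for x
    proof -
      have "x \<in> inf_paths G" using openin_subset[OF U] x by auto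
      moreover obtain n where "cyl (map x [0..<n]) \<subseteq> U" using open_contains_cyl[OF U x] by auto
      moreover have "x \<in> cyl (map x [0..<n])" using calculation(1)
        by (simp add: cyl_def starts_with_prefix)
      ultimately show ?thesis
        by (intro UN_I[of "map x [0..<n]"]) (auto simp: inf_paths_arc)
    qed
    then have "U = (\<Union>\<nu>\<in>?L. cyl \<nu>)" by auto
    moreover have "countable ?L" by (rule countable_subset[OF _ countable_lists_arcs]) auto
    then have "(\<Union>\<nu>\<in>?L. cyl \<nu>) \<in> sigma_sets (inf_paths G) (insert {} (range cyl))"
      by (intro sigma_sets_UNION) auto
    ultimately show ?thesis by simp
  qed
  then have "sigma_sets (inf_paths G) {U. openin (path_topology G) U}
      \<subseteq> sigma_sets (inf_paths G) (insert {} (range cyl))"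
    by (intro sigma_sets_mono) auto
  moreover have "sigma_sets (inf_paths G) (insert {} (range cyl))
      \<subseteq> sigma_sets (inf_paths G) {U. openin (path_topology G) U}"
    by (intro sigma_sets_mono) (auto simp: openin_cyl)
  ultimately show ?thesis by (auto simp: path_borel_def sets_borel_of)
qed

text \<open>
  Cylinders of single arrows, which exhaust the path space, supply the finiteness needed for
  uniqueness.
\<close>

lemma path_measure_eqI:
  assumes sets: "sets M = sets (path_borel G)" "sets N = sets (path_borel G)"
    and fin: "\<And>a. a \<in> arcs G \<Longrightarrow> emeasure M (cyl [a]) \<noteq> \<infinity>"
    and eq: "\<And>u \<nu> v. awalk u \<nu> v \<Longrightarrow> \<nu> \<noteq> [] \<Longrightarrow> emeasure M (cyl \<nu>) = emeasure N (cyl \<nu>)"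
  shows "M = N"
proof (rule measure_eqI_generator_eq_countable)
  let ?E = "insert {} (cyl ` {\<nu>. \<nu> \<noteq> []})"
  let ?A = "(\<lambda>a. cyl [a]) ` arcs G"
  show "Int_stable ?E"
  proof (rule Int_stableI)
    fix a b assume "a \<in> ?E" "b \<in> ?E"
    then consider "a \<inter> b = {}" | \<mu> \<nu> where "a = cyl \<mu>" "b = cyl \<nu>" "\<mu> \<noteq> []" "\<nu> \<noteq> []"
      by auto
    then show "a \<inter> b \<in> ?E"
    proof cases
      case 2
      with cyl_Int[of \<mu> \<nu>] show ?thesis by auto
    qed simp
  qed
  show "?E \<subseteq> Pow (inf_paths G)" by (auto simp: cyl_def)
  show "emeasure M X = emeasure N X" if X: "X \<in> ?E" for X
  proof (cases "X = {}")
    case False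
    then obtain \<nu> x where "X = cyl \<nu>" "\<nu> \<noteq> []" "x \<in> cyl \<nu>" using X by auto
    then show ?thesis using eq starts_with_walk[of x \<nu>] by (auto simp: cyl_def)
  qed simp
  have un: "\<Union>?A = inf_paths G" by (auto simp: cyl_def inf_paths_arc)
  show "\<Union>?A = inf_paths G" by (rule un)
  have "cyl [] \<in> sigma_sets (inf_paths G) ?E"
  proof -
    have "cyl [] = \<Union>?A" unfolding un by (auto simp: cyl_def)
    also have "\<dots> \<in> sigma_sets (inf_paths G) ?E"
      by (intro sigma_sets_UNION countable_image countable_arcs) auto
    finally show ?thesis .
  qed
  moreover have "cyl \<nu> \<in> sigma_sets (inf_paths G) ?E" if "\<nu> \<noteq> []" for \<nu>
    using that by (intro sigma_sets.Basic) auto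
  ultimately have "range cyl \<subseteq> sigma_sets (inf_paths G) ?E" by blast
  then have "sigma_sets (inf_paths G) (insert {} (range cyl)) \<subseteq> sigma_sets (inf_paths G) ?E"
    by (intro sigma_sets_mono) (auto intro: sigma_sets.Empty)
  moreover have "sigma_sets (inf_paths G) ?E \<subseteq> sigma_sets (inf_paths G) (insert {} (range cyl))"
    by (intro sigma_sets_mono') auto
  ultimately have "sets (path_borel G) = sigma_sets (inf_paths G) ?E"
    by (auto simp: sets_path_borel)
  then show "sets M = sigma_sets (inf_paths G) ?E" "sets N = sigma_sets (inf_paths G) ?E"
    using sets by auto
  show "?A \<subseteq> ?E" by auto
  show "countable ?A" using countable_arcs by simp
  show "emeasure M a \<noteq> \<infinity>" if "a \<in> ?A" for a using that fin by auto
qed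

lemma measurable_arc [measurable]: "(\<lambda>x. x i) \<in> path_borel G \<rightarrow>\<^sub>M count_space UNIV"
proof (rule measurableI)
  fix A :: "'b set"
  let ?L = "{\<nu> \<in> lists (arcs G). length \<nu> = Suc i \<and> \<nu> ! i \<in> A}"
  have "(\<lambda>x. x i) -` A \<inter> space (path_borel G) = (\<Union>\<nu>\<in>?L. cyl \<nu>)"
  proof (intro set_eqI iffI)
    fix x assume x: "x \<in> (\<lambda>x. x i) -` A \<inter> space (path_borel G)"
    then show "x \<in> (\<Union>\<nu>\<in>?L. cyl \<nu>)"
      by (intro UN_I[of "map x [0..<Suc i]"])
         (auto simp: inf_paths_arc cyl_def starts_with_prefix nth_append simp del: upt_Suc)
  qed (auto simp: cyl_def starts_with_nth)
  moreover have "countable ?L" by (rule countable_subset[OF _ countable_lists_arcs]) auto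
  ultimately show "(\<lambda>x. x i) -` A \<inter> space (path_borel G) \<in> sets (path_borel G)"
    by auto
qed simp

lemma measurable_path_borelI:
  assumes f: "f \<in> space M \<rightarrow> inf_paths G"
    and pre: "\<And>\<nu>. f -` cyl \<nu> \<inter> space M \<in> sets M"
  shows "f \<in> M \<rightarrow>\<^sub>M path_borel G"
proof -
  have "f \<in> M \<rightarrow>\<^sub>M sigma (inf_paths G) (insert {} (range cyl))"
  proof (rule measurable_measure_of)
    show "f -` y \<inter> space M \<in> sets M" if "y \<in> insert {} (range cyl)" for y
      using that pre by auto
  qed (use f in \<open>auto simp: cyl_def\<close>)
  then show ?thesis
    by (subst measurable_cong_sets[OF refl, of _ "sigma (inf_paths G) (insert {} (range cyl))"])
       (auto simp: sets_path_borel cyl_def sets_measure_of_conv)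
qed

lemma measurable_shift [measurable]: "shift \<in> path_borel G \<rightarrow>\<^sub>M path_borel G"
proof (rule measurable_path_borelI)
  fix \<nu>
  have "shift -` cyl \<nu> \<inter> space (path_borel G) = (\<Union>a\<in>arcs G. cyl (a # \<nu>))"
    by (auto simp: cyl_def inf_paths_arc)
  then show "shift -` cyl \<nu> \<inter> space (path_borel G) \<in> sets (path_borel G)"
    using countable_arcs by auto
qed auto

lemma measurable_shift_funpow [measurable]: "(shift ^^ n) \<in> path_borel G \<rightarrow>\<^sub>M path_borel G"
proof (induction n)
  case (Suc n)
  then show ?case unfolding funpow.simps by (rule measurable_comp) (rule measurable_shift)
qed (simp add: id_def)

lemma pred_starts_with [measurable]: "Measurable.pred (path_borel G) (starts_with \<nu>)"
proof -
  have "{x \<in> space (path_borel G). starts_with \<nu> x} = cyl \<nu>" by (auto simp: cyl_def)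
  then show ?thesis by (simp add: pred_def)
qed

lemma measurable_tail [measurable]:
  "(\<lambda>x. tail G (x i)) \<in> path_borel G \<rightarrow>\<^sub>M count_space UNIV"
  by (rule measurable_compose[OF measurable_arc]) simp

lemma cyl_vert_sets [measurable]: "cyl_vert G v \<in> sets (path_borel G)"
proof -
  have "cyl_vert G v = {x \<in> space (path_borel G). tail G (x 0) = v}" by (auto simp: cyl_vert_def)
  also have "\<dots> \<in> sets (path_borel G)" by measurable
  finally show ?thesis .
qed

lemma cyl_arc_sets [measurable]: "cyl_arc G a \<in> sets (path_borel G)"
proof -
  have "cyl_arc G a = cyl [a]" by (auto simp: cyl_arc_def cyl_def)
  then show ?thesis by simp
qed

text \<open>
  Prepending an arrow is a section of the shift, so images of Borel sets under the shift can be
  written as preimages.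
\<close>

lemma shift_image_arc:
  assumes "a \<in> arcs G"
  shows "shift ` (B \<inter> cyl_arc G a) =
    {z \<in> inf_paths G. tail G (z 0) = head G a \<and> case_nat a z \<in> B \<inter> cyl_arc G a}"
proof (intro set_eqI iffI)
  fix z assume "z \<in> shift ` (B \<inter> cyl_arc G a)"
  then obtain x where x: "x \<in> B" "x \<in> inf_paths G" "x 0 = a" "z = shift x"
    by (auto simp: cyl_arc_def)
  moreover have "case_nat a (shift x) = x" using x(3) by (auto simp: fun_eq_iff split: nat.split)
  ultimately show "z \<in> {z \<in> inf_paths G. tail G (z 0) = head G a \<and> case_nat a z \<in> B \<inter> cyl_arc G a}"
    by (auto simp: cyl_arc_def inf_paths_step)
next
  fix z assume "z \<in> {z \<in> inf_paths G. tail G (z 0) = head G a \<and> case_nat a z \<in> B \<inter> cyl_arc G a}"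
  then show "z \<in> shift ` (B \<inter> cyl_arc G a)"
    by (intro image_eqI[of _ _ "case_nat a z"]) (auto simp: fun_eq_iff)
qed

lemma case_nat_inf_paths:
  "a \<in> arcs G \<Longrightarrow> z \<in> inf_paths G \<Longrightarrow> tail G (z 0) = head G a \<Longrightarrow> case_nat a z \<in> inf_paths G"
  by (auto simp: inf_paths_def split: nat.split)

lemma measurable_case_nat [measurable]:
  assumes a: "a \<in> arcs G"
  shows "case_nat a \<in> restrict_space (path_borel G) (cyl_vert G (head G a)) \<rightarrow>\<^sub>M path_borel G"
proof -
  let ?M = "restrict_space (path_borel G) (cyl_vert G (head G a))"
  have sp: "space ?M = cyl_vert G (head G a)" by (auto simp: space_restrict_space cyl_vert_def)
  show ?thesis
  proof (rule measurable_path_borelI)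
    show "case_nat a \<in> space ?M \<rightarrow> inf_paths G"
      using a unfolding sp by (auto simp: cyl_vert_def intro: case_nat_inf_paths)
    fix \<nu>
    show "case_nat a -` cyl \<nu> \<inter> space ?M \<in> sets ?M"
    proof (cases \<nu>)
      case Nil
      then have "case_nat a -` cyl \<nu> \<inter> space ?M = space ?M"
        using a unfolding sp by (auto simp: cyl_vert_def cyl_def intro: case_nat_inf_paths)
      then show ?thesis by (metis sets.top)
    next
      case (Cons b \<nu>')
      have s: "shift (case_nat a z) = z" for z :: "nat \<Rightarrow> 'b" by (simp add: fun_eq_iff)
      have "case_nat a -` cyl \<nu> \<inter> space ?M = (if a = b then cyl \<nu>' \<inter> cyl_vert G (head G a) else {})"
        using a unfolding Cons sp by (auto simp: cyl_vert_def cyl_def s intro: case_nat_inf_paths)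
      then show ?thesis by (auto simp: sets_restrict_space)
    qed
  qed
qed

lemma shift_image_sets:
  assumes "a \<in> arcs G" "B \<in> sets (path_borel G)"
  shows "shift ` (B \<inter> cyl_arc G a) \<in> sets (path_borel G)"
proof -
  let ?M = "restrict_space (path_borel G) (cyl_vert G (head G a))"
  have "case_nat a -` (B \<inter> cyl_arc G a) \<inter> space ?M \<in> sets ?M"
    using assms by (intro measurable_sets[OF measurable_case_nat]) auto
  moreover have "case_nat a -` (B \<inter> cyl_arc G a) \<inter> space ?M = shift ` (B \<inter> cyl_arc G a)"
    unfolding shift_image_arc[OF assms(1)] by (auto simp: space_restrict_space cyl_vert_def)
  ultimately show ?thesis by (auto simp: sets_restrict_space)
qed

end
(* As rewrite rules these unfold the shift inside its own iterates. *)
declare shift_nth [simp del] shift_funpow_nth [simp del]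

section \<open>Sums over finite paths\<close>

text \<open>A form of Tonelli's theorem for counting measures in which the index sets may be uncountable.\<close>

lemma nn_integral_count_space_Sigma:
  fixes f :: "'a \<times> 'b \<Rightarrow> ennreal"
  shows "(\<integral>\<^sup>+x. (\<integral>\<^sup>+y. f (x, y) \<partial>count_space (B x)) \<partial>count_space A) = (\<integral>\<^sup>+p. f p \<partial>count_space (Sigma A B))"
proof -
  have "(\<integral>\<^sup>+x. (\<integral>\<^sup>+y. f (x, y) \<partial>count_space (B x)) \<partial>count_space A)
      = (\<integral>\<^sup>+x. (\<integral>\<^sup>+y. f (x, y) * indicator (B x) y \<partial>count_space UNIV) * indicator A x \<partial>count_space UNIV)"
    by (simp add: nn_integral_count_space_indicator[of A] nn_integral_count_space_indicator[of "B _"])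
  also have "\<dots> = (\<integral>\<^sup>+x. (\<integral>\<^sup>+y. f (x, y) * indicator (Sigma A B) (x, y) \<partial>count_space UNIV) \<partial>count_space UNIV)"
    by (intro nn_integral_cong) (auto split: split_indicator intro!: nn_integral_cong)
  also have "\<dots> = (\<integral>\<^sup>+p. f p * indicator (Sigma A B) p \<partial>count_space UNIV)"
    by (subst nn_integral_fst_count_space) simp
  also have "\<dots> = (\<integral>\<^sup>+p. f p \<partial>count_space (Sigma A B))"
    by (simp add: nn_integral_count_space_indicator[of "Sigma A B"])
  finally show ?thesis .
qed

lemma nn_integral_count_space_Sigma_image:
  fixes f :: "'c \<Rightarrow> ennreal"
  assumes "inj_on g (Sigma A B)" and "g ` Sigma A B = C"
  shows "(\<integral>\<^sup>+x. (\<integral>\<^sup>+y. f (g (x, y)) \<partial>count_space (B x)) \<partial>count_space A) = (\<integral>\<^sup>+z. f z \<partial>count_space C)"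
proof -
  have "bij_betw g (Sigma A B) C" using assms by (simp add: bij_betw_def)
  from nn_integral_bij_count_space[OF this, of f] show ?thesis
    using nn_integral_count_space_Sigma[where f="\<lambda>p. f (g p)" and A=A and B=B] by simp
qed

lemma nn_integral_count_space_of_bool:
  fixes f :: "'a \<Rightarrow> ennreal"
  assumes "A \<subseteq> B"
  shows "(\<integral>\<^sup>+x. of_bool (x \<in> A) * f x \<partial>count_space B) = (\<integral>\<^sup>+x. f x \<partial>count_space A)"
proof -
  have "(\<integral>\<^sup>+x. of_bool (x \<in> A) * f x \<partial>count_space B) = (\<integral>\<^sup>+x. of_bool (x \<in> A) * f x \<partial>count_space A)"
    using assms by (intro nn_integral_count_space_eq) auto
  also have "\<dots> = (\<integral>\<^sup>+x. f x \<partial>count_space A)"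
    by (intro nn_integral_cong) simp
  finally show ?thesis .
qed

lemma nn_integral_count_space_mono_set:
  fixes f :: "'a \<Rightarrow> ennreal"
  assumes "A \<subseteq> B"
  shows "(\<integral>\<^sup>+x. f x \<partial>count_space A) \<le> (\<integral>\<^sup>+x. f x \<partial>count_space B)"
  unfolding nn_integral_count_space_of_bool[OF assms, symmetric]
  by (intro nn_integral_mono) auto

lemma measurable_of_bool_ennreal [measurable]:
  assumes [measurable]: "Measurable.pred M P"
  shows "(\<lambda>x. of_bool (P x) :: ennreal) \<in> borel_measurable M"
  unfolding of_bool_def by measurable

lemma path_weight_Nil [simp]: "path_weight F \<beta> [] = 1"
  by (simp add: path_weight_def)

lemma path_weight_append: "path_weight F \<beta> (\<mu> @ \<nu>) = path_weight F \<beta> \<mu> * path_weight F \<beta> \<nu>"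
  by (simp add: path_weight_def ennreal_mult[symmetric] exp_add[symmetric] algebra_simps)

lemma path_weight_Cons: "path_weight F \<beta> (a # \<nu>) = ennreal (exp (- \<beta> * F a)) * path_weight F \<beta> \<nu>"
  by (simp add: path_weight_def ennreal_mult[symmetric] exp_add[symmetric] algebra_simps)

lemma path_weight_pos [simp]: "path_weight F \<beta> \<nu> \<noteq> 0" "0 < path_weight F \<beta> \<nu>"
  and path_weight_finite [simp]: "path_weight F \<beta> \<nu> \<noteq> \<top>" "path_weight F \<beta> \<nu> < \<top>"
  by (auto simp: path_weight_def)

locale weighted_digraph = countable_digraph G for G :: "('a, 'b) pre_digraph" (structure) +
  fixes F :: "'b \<Rightarrow> real" and \<beta> :: real
begin

abbreviation weight :: "'b list \<Rightarrow> ennreal" where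
  "weight \<equiv> path_weight F \<beta>"

abbreviation green :: "'a \<Rightarrow> 'a \<Rightarrow> ennreal" where
  "green \<equiv> A_green G F \<beta>"

definition walks :: "'a \<Rightarrow> 'a \<Rightarrow> 'b list set" where
  "walks v w = {\<mu>. awalk v \<mu> w}"

definition weight_sum :: "'b list set \<Rightarrow> ennreal" where
  "weight_sum A = (\<integral>\<^sup>+\<mu>. weight \<mu> \<partial>count_space A)"

lemma walks_subset: "walks v w \<subseteq> lists (arcs G)"
  by (auto simp: walks_def awalk_def)

lemma weight_sum_mono: "A \<subseteq> B \<Longrightarrow> weight_sum A \<le> weight_sum B"
  unfolding weight_sum_def by (rule nn_integral_count_space_mono_set)

lemma weight_le_sum: "\<mu> \<in> A \<Longrightarrow> weight \<mu> \<le> weight_sum A"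
  unfolding weight_sum_def by (rule nn_integral_ge_point)

lemma weight_sum_pos: "\<mu> \<in> A \<Longrightarrow> 0 < weight_sum A"
  using weight_le_sum[of \<mu> A] path_weight_pos(2)[of F \<beta> \<mu>] by (rule less_le_trans[rotated])

lemma cons_walks:
  "(\<integral>\<^sup>+a. ennreal (exp (- \<beta> * F a)) * weight_sum (P (head G a)) \<partial>count_space (out_arcs G v))
    = weight_sum {a # \<mu> | a \<mu>. a \<in> out_arcs G v \<and> \<mu> \<in> P (head G a)}"
proof -
  have "(\<integral>\<^sup>+a. ennreal (exp (- \<beta> * F a)) * weight_sum (P (head G a)) \<partial>count_space (out_arcs G v))
    = (\<integral>\<^sup>+a. (\<integral>\<^sup>+\<mu>. weight (case (a, \<mu>) of (a, \<mu>) \<Rightarrow> a # \<mu>) \<partial>count_space (P (head G a))) \<partial>count_space (out_arcs G v))"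
    unfolding weight_sum_def by (simp add: path_weight_Cons nn_integral_cmult)
  also have "\<dots> = weight_sum {a # \<mu> | a \<mu>. a \<in> out_arcs G v \<and> \<mu> \<in> P (head G a)}"
    unfolding weight_sum_def
    by (rule nn_integral_count_space_Sigma_image) (auto simp: inj_on_def image_def)
  finally show ?thesis .
qed

lemma A_mat_sum:
  "(\<integral>\<^sup>+u. A_mat G F \<beta> v u * f u \<partial>count_space (verts G))
    = (\<integral>\<^sup>+a. ennreal (exp (- \<beta> * F a)) * f (head G a) \<partial>count_space (out_arcs G v))"
proof -
  let ?g = "\<lambda>a. ennreal (exp (- \<beta> * F a)) * f (head G a)"
  have "(\<integral>\<^sup>+u. A_mat G F \<beta> v u * f u \<partial>count_space (verts G))
    = (\<integral>\<^sup>+u. (\<integral>\<^sup>+a. ?g (snd (u, a)) \<partial>count_space (out_arcs G v \<inter> in_arcs G u)) \<partial>count_space (verts G))"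
    unfolding A_mat_def by (subst nn_integral_multc[symmetric]) (auto intro!: nn_integral_cong)
  also have "\<dots> = (\<integral>\<^sup>+a. ?g a \<partial>count_space (out_arcs G v))"
    by (rule nn_integral_count_space_Sigma_image) (auto simp: inj_on_def image_def)
  finally show ?thesis .
qed

text \<open>
  Expanding the matrix product: an entry of the \<open>n\<close>-th power sums the weights of the
  paths of length \<open>n\<close>.
\<close>

lemma A_pow_weight_sum:
  "v \<in> verts G \<Longrightarrow> A_pow G F \<beta> n v w = weight_sum {\<mu>. awalk v \<mu> w \<and> length \<mu> = n}"
proof (induction n arbitrary: v)
  case 0
  then have "{\<mu>. awalk v \<mu> w \<and> length \<mu> = 0} = (if v = w then {[]} else {})"
    by (auto simp: awalk_Nil_iff)
  then show ?case by (simp add: weight_sum_def nn_integral_count_space_finite)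
next
  case (Suc n)
  have "A_pow G F \<beta> (Suc n) v w
      = (\<integral>\<^sup>+a. ennreal (exp (- \<beta> * F a)) * A_pow G F \<beta> n (head G a) w \<partial>count_space (out_arcs G v))"
    by (simp add: A_mat_sum)
  also have "\<dots> = (\<integral>\<^sup>+a. ennreal (exp (- \<beta> * F a))
      * weight_sum {\<mu>. awalk (head G a) \<mu> w \<and> length \<mu> = n} \<partial>count_space (out_arcs G v))"
    by (intro nn_integral_cong) (simp add: Suc.IH)
  also have "\<dots> = weight_sum {a # \<mu> | a \<mu>. a \<in> out_arcs G v \<and> awalk (head G a) \<mu> w \<and> length \<mu> = n}"
    by (subst cons_walks) simp
  also have "{a # \<mu> | a \<mu>. a \<in> out_arcs G v \<and> awalk (head G a) \<mu> w \<and> length \<mu> = n}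
      = {\<mu>. awalk v \<mu> w \<and> length \<mu> = Suc n}"
    by (auto simp: awalk_Cons_iff length_Suc_conv)
  finally show ?case .
qed

lemma green_weight_sum: "v \<in> verts G \<Longrightarrow> green v w = weight_sum (walks v w)"
proof -
  assume v: "v \<in> verts G"
  have "green v w = (\<integral>\<^sup>+n. (\<integral>\<^sup>+\<mu>. weight (snd (n, \<mu>)) \<partial>count_space {\<mu>. awalk v \<mu> w \<and> length \<mu> = n}) \<partial>count_space UNIV)"
    unfolding A_green_def nn_integral_count_space_nat
    by (simp add: A_pow_weight_sum[OF v] weight_sum_def)
  also have "\<dots> = weight_sum (walks v w)"
    unfolding weight_sum_def
    by (rule nn_integral_count_space_Sigma_image) (auto simp: inj_on_def image_def walks_def)
  finally show ?thesis .
qed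

text \<open>
  All lower bounds for Green's function come from this: concatenations that can be decomposed
  uniquely have multiplicative weights.
\<close>

lemma concat_weight_sum_le:
  assumes "inj_on (\<lambda>(\<mu>, \<nu>). \<mu> @ \<nu>) (Sigma A B)" "\<And>\<mu> \<nu>. \<mu> \<in> A \<Longrightarrow> \<nu> \<in> B \<mu> \<Longrightarrow> \<mu> @ \<nu> \<in> C"
  shows "(\<integral>\<^sup>+\<mu>. weight \<mu> * weight_sum (B \<mu>) \<partial>count_space A) \<le> weight_sum C"
proof -
  have "(\<integral>\<^sup>+\<mu>. weight \<mu> * weight_sum (B \<mu>) \<partial>count_space A)
      = (\<integral>\<^sup>+\<mu>. (\<integral>\<^sup>+\<nu>. weight (case (\<mu>, \<nu>) of (\<mu>, \<nu>) \<Rightarrow> \<mu> @ \<nu>) \<partial>count_space (B \<mu>)) \<partial>count_space A)"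
    by (simp add: weight_sum_def path_weight_append nn_integral_cmult)
  also have "\<dots> = weight_sum ((\<lambda>(\<mu>, \<nu>). \<mu> @ \<nu>) ` Sigma A B)"
    unfolding weight_sum_def by (rule nn_integral_count_space_Sigma_image[OF assms(1) refl])
  also have "\<dots> \<le> weight_sum C" using assms(2) by (intro weight_sum_mono) auto
  finally show ?thesis .
qed

lemma green_step:
  assumes "v \<in> verts G"
  shows "green v w = of_bool (v = w) + (\<integral>\<^sup>+u. A_mat G F \<beta> v u * green u w \<partial>count_space (verts G))"
proof -
  have "(\<integral>\<^sup>+u. A_mat G F \<beta> v u * green u w \<partial>count_space (verts G))
      = (\<Sum>n. A_pow G F \<beta> (Suc n) v w)"
    unfolding A_green_def by (simp add: nn_integral_suminf[symmetric])
  also have "of_bool (v = w) + \<dots> = green v w"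
    unfolding A_green_def by (subst suminf_offset[of _ 1]) (auto intro: summableI)
  finally show ?thesis by simp
qed

text \<open>
  Paths from \<open>v\<close> that begin with \<open>\<mu>\<close> are among the paths from
  \<open>v\<close>.
\<close>

lemma green_factor_le:
  assumes "awalk v \<mu> u"
  shows "weight \<mu> * green u w \<le> green v w"
proof -
  have "v \<in> verts G" "u \<in> verts G"
    using assms by (auto intro: awalk_hd_in_verts awalk_last_in_verts)
  moreover have "(\<integral>\<^sup>+\<mu>. weight \<mu> * weight_sum (walks u w) \<partial>count_space {\<mu>}) \<le> weight_sum (walks v w)"
    using assms by (intro concat_weight_sum_le) (auto simp: inj_on_def walks_def intro: awalk_appendI)
  ultimately show ?thesis
    by (simp add: green_weight_sum nn_integral_count_space_finite)
qed

section \<open>Conformal measures and their transport formula\<close>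

lemma emeasure_shift_density:
  assumes sets: "sets m = sets (path_borel G)" and C [measurable]: "C \<in> sets (path_borel G)"
  shows "emeasure (distr (density m (\<lambda>x. of_bool (x 0 = a))) (path_borel G) shift) C
    = emeasure m {x \<in> space m. x 0 = a \<and> shift x \<in> C}"
proof -
  note sets[measurable_cong]
  have "emeasure (distr (density m (\<lambda>x. of_bool (x 0 = a))) (path_borel G) shift) C
      = (\<integral>\<^sup>+x. of_bool (x 0 = a) * indicator (shift -` C \<inter> space m) x \<partial>m)"
    by (simp add: emeasure_distr emeasure_density)
  also have "\<dots> = (\<integral>\<^sup>+x. indicator {x \<in> space m. x 0 = a \<and> shift x \<in> C} x \<partial>m)"
    by (intro nn_integral_cong) (auto split: split_indicator)
  also have "\<dots> = emeasure m {x \<in> space m. x 0 = a \<and> shift x \<in> C}"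
    by (intro nn_integral_indicator) measurable
  finally show ?thesis .
qed

lemma emeasure_density_start:
  assumes sets: "sets m = sets (path_borel G)" and C [measurable]: "C \<in> sets (path_borel G)"
  shows "emeasure (density m (\<lambda>z. c * of_bool (tail G (z 0) = v))) C = c * emeasure m (C \<inter> cyl_vert G v)"
proof -
  note sets[measurable_cong]
  have sp: "space m = inf_paths G" using sets_eq_imp_space_eq[OF sets] by simp
  have [measurable]: "C \<in> sets m" by (simp add: sets)
  have "emeasure (density m (\<lambda>z. c * of_bool (tail G (z 0) = v))) C
      = (\<integral>\<^sup>+z. c * indicator (C \<inter> cyl_vert G v) z \<partial>m)"
    by (subst emeasure_density)
       (auto intro!: nn_integral_cong simp: sp cyl_vert_def split: split_indicator)
  also have "\<dots> = c * emeasure m (C \<inter> cyl_vert G v)"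
    by (subst nn_integral_cmult) auto
  finally show ?thesis .
qed

abbreviation conformal :: "(nat \<Rightarrow> 'b) measure \<Rightarrow> bool" where
  "conformal \<equiv> conformal_measure G F \<beta>"

lemma conformal_sets: "conformal m \<Longrightarrow> sets m = sets (path_borel G)"
  and conformal_finite: "conformal m \<Longrightarrow> v \<in> verts G \<Longrightarrow> emeasure m (cyl_vert G v) < \<top>"
  by (auto simp: conformal_measure_def regular_borel_measure_def)

lemma conformal_space: "conformal m \<Longrightarrow> space m = inf_paths G"
  using sets_eq_imp_space_eq[OF conformal_sets] by simp

text \<open>
  Conformality, which speaks about images under the shift, in terms of preimages: restricted to the
  cylinder of \<open>a\<close> the shift is injective.
\<close>

lemma conformal_arc:
  assumes m: "conformal m" and a: "a \<in> arcs G" and C: "C \<in> sets (path_borel G)"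
  shows "emeasure m {x \<in> inf_paths G. x 0 = a \<and> shift x \<in> C}
    = ennreal (exp (- \<beta> * F a)) * emeasure m (C \<inter> cyl_vert G (head G a))"
proof -
  let ?B = "shift -` C \<inter> space (path_borel G)"
  have B: "?B \<in> sets (path_borel G)" using C by (intro measurable_sets[OF measurable_shift])
  have s: "shift (case_nat a z) = z" for z :: "nat \<Rightarrow> 'b" by (simp add: fun_eq_iff shift_nth)
  have eq: "shift ` (?B \<inter> cyl_arc G a) = C \<inter> cyl_vert G (head G a)"
    unfolding shift_image_arc[OF a]
    using sets.sets_into_space[OF C] a
    by (auto simp: cyl_arc_def cyl_vert_def s intro: case_nat_inf_paths)
  have "emeasure m (shift ` (?B \<inter> cyl_arc G a)) = ennreal (exp (\<beta> * F a)) * emeasure m (?B \<inter> cyl_arc G a)"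
    using m a B unfolding conformal_measure_def by blast
  then have "emeasure m (C \<inter> cyl_vert G (head G a)) = ennreal (exp (\<beta> * F a)) * emeasure m (?B \<inter> cyl_arc G a)"
    unfolding eq .
  then have "ennreal (exp (- \<beta> * F a)) * emeasure m (C \<inter> cyl_vert G (head G a)) = emeasure m (?B \<inter> cyl_arc G a)"
    by (simp add: mult.assoc[symmetric] ennreal_mult[symmetric] exp_add[symmetric])
  also have "?B \<inter> cyl_arc G a = {x \<in> inf_paths G. x 0 = a \<and> shift x \<in> C}"
    by (auto simp: cyl_arc_def)
  finally show ?thesis ..
qed

lemma conformal_nn_integral_arc:
  assumes m: "conformal m" and a: "a \<in> arcs G" and f [measurable]: "f \<in> borel_measurable (path_borel G)"
  shows "(\<integral>\<^sup>+x. of_bool (x 0 = a) * f (shift x) \<partial>m)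
    = ennreal (exp (- \<beta> * F a)) * (\<integral>\<^sup>+z. of_bool (tail G (z 0) = head G a) * f z \<partial>m)"
proof -
  note conformal_sets[OF m, measurable_cong]
  let ?e = "ennreal (exp (- \<beta> * F a))"
  have "distr (density m (\<lambda>x. of_bool (x 0 = a))) (path_borel G) shift
      = density m (\<lambda>z. ?e * of_bool (tail G (z 0) = head G a))" (is "?L = ?R")
  proof (rule measure_eqI)
    show "sets ?L = sets ?R" by (simp add: conformal_sets[OF m])
    fix C assume "C \<in> sets ?L"
    then have C[measurable]: "C \<in> sets (path_borel G)" by simp
    have "emeasure ?L C = emeasure m {x \<in> inf_paths G. x 0 = a \<and> shift x \<in> C}"
      using emeasure_shift_density[OF conformal_sets[OF m] C, of a] by (simp add: conformal_space[OF m])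
    also have "\<dots> = emeasure ?R C"
      unfolding emeasure_density_start[OF conformal_sets[OF m] C] by (rule conformal_arc[OF m a C])
    finally show "emeasure ?L C = emeasure ?R C" .
  qed
  then have "integral\<^sup>N ?L f = integral\<^sup>N ?R f" by simp
  then show ?thesis
    by (simp add: nn_integral_distr nn_integral_density mult.assoc nn_integral_cmult)
qed

definition ends_at :: "'b list \<Rightarrow> 'a \<Rightarrow> bool" where
  "ends_at \<nu> v \<longleftrightarrow> (\<exists>u. awalk u \<nu> v)"

lemma ends_at_Nil [simp]: "ends_at [] v \<longleftrightarrow> v \<in> verts G"
  by (auto simp: ends_at_def awalk_Nil_iff)

lemma ends_at_singleton: "ends_at [a] v \<longleftrightarrow> a \<in> arcs G \<and> head G a = v"
  by (auto simp: ends_at_def awalk_simps)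

lemma ends_at_Cons_Cons:
  "ends_at (a # b # \<nu>) v \<longleftrightarrow> a \<in> arcs G \<and> head G a = tail G b \<and> ends_at (b # \<nu>) v"
  by (auto simp: ends_at_def awalk_Cons_iff)

text \<open>
  Conformality for finite paths: prepending \<open>\<nu>\<close> multiplies the measure by the
  weight of \<open>\<nu>\<close>.
\<close>

lemma conformal_nn_integral_path:
  assumes m: "conformal m" and \<nu>: "\<nu> \<in> lists (arcs G)"
    and f: "f \<in> borel_measurable (path_borel G)"
  shows "(\<integral>\<^sup>+x. of_bool (starts_with \<nu> x) * f ((shift ^^ length \<nu>) x) \<partial>m)
    = weight \<nu> * (\<integral>\<^sup>+z. of_bool (ends_at \<nu> (tail G (z 0))) * f z \<partial>m)"
  using \<nu>
proof (induction \<nu>)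
  case Nil
  then show ?case
    by (auto intro!: nn_integral_cong simp: conformal_space[OF m] inf_paths_tail)
next
  case (Cons a \<nu>)
  note conformal_sets[OF m, measurable_cong]
  note f [measurable]
  let ?e = "ennreal (exp (- \<beta> * F a))"
  let ?g = "\<lambda>x. of_bool (starts_with \<nu> x) * f ((shift ^^ length \<nu>) x)"
  have a: "a \<in> arcs G" using Cons by simp
  have "(\<integral>\<^sup>+x. of_bool (starts_with (a # \<nu>) x) * f ((shift ^^ length (a # \<nu>)) x) \<partial>m)
      = (\<integral>\<^sup>+x. of_bool (x 0 = a) * ?g (shift x) \<partial>m)"
    by (intro nn_integral_cong) (simp add: funpow_swap1)
  also have "\<dots> = ?e * (\<integral>\<^sup>+z. of_bool (tail G (z 0) = head G a) * ?g z \<partial>m)"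
    by (intro conformal_nn_integral_arc m a) measurable
  also have "\<dots> = weight (a # \<nu>) * (\<integral>\<^sup>+z. of_bool (ends_at (a # \<nu>) (tail G (z 0))) * f z \<partial>m)"
  proof (cases \<nu>)
    case Nil
    with a show ?thesis
      by (auto simp: path_weight_Cons ends_at_singleton intro!: nn_integral_cong arg_cong2[where f="(*)"])
  next
    case (Cons b \<nu>')
    have "(\<integral>\<^sup>+z. of_bool (tail G (z 0) = head G a) * ?g z \<partial>m)
        = (\<integral>\<^sup>+z. of_bool (head G a = tail G b) * ?g z \<partial>m)"
      by (intro nn_integral_cong) (auto simp: Cons)
    also have "\<dots> = of_bool (head G a = tail G b) * (weight \<nu> * (\<integral>\<^sup>+z. of_bool (ends_at \<nu> (tail G (z 0))) * f z \<partial>m))"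
      using Cons.IH Cons.prems by (subst nn_integral_cmult) auto
    also have "\<dots> = weight \<nu> * (\<integral>\<^sup>+z. of_bool (ends_at (a # \<nu>) (tail G (z 0))) * f z \<partial>m)"
      using a by (auto simp: Cons ends_at_Cons_Cons)
    finally show ?thesis by (simp add: path_weight_Cons mult.assoc)
  qed
  finally show ?case .
qed

text \<open>
  The basic mass transport: a path is cut after each of its prefixes \<open>\<nu>\<close>.  Summing
  over the prefixes of a random path amounts to summing the weights of all finite paths that can
  precede it.
\<close>

lemma conformal_transport:
  assumes m: "conformal m" and h: "\<And>\<nu>. \<nu> \<in> lists (arcs G) \<Longrightarrow> h \<nu> \<in> borel_measurable (path_borel G)"
  shows "(\<integral>\<^sup>+x. (\<integral>\<^sup>+\<nu>. of_bool (starts_with \<nu> x) * h \<nu> ((shift ^^ length \<nu>) x) \<partial>count_space (lists (arcs G))) \<partial>m)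
    = (\<integral>\<^sup>+z. (\<integral>\<^sup>+\<nu>. weight \<nu> * (of_bool (ends_at \<nu> (tail G (z 0))) * h \<nu> z) \<partial>count_space (lists (arcs G))) \<partial>m)"
proof -
  note conformal_sets[OF m, measurable_cong]
  have "(\<integral>\<^sup>+x. (\<integral>\<^sup>+\<nu>. of_bool (starts_with \<nu> x) * h \<nu> ((shift ^^ length \<nu>) x) \<partial>count_space (lists (arcs G))) \<partial>m)
    = (\<integral>\<^sup>+\<nu>. (\<integral>\<^sup>+x. of_bool (starts_with \<nu> x) * h \<nu> ((shift ^^ length \<nu>) x) \<partial>m) \<partial>count_space (lists (arcs G)))"
    by (intro nn_integral_count_space_nn_integral countable_lists_arcs)
       (use h in \<open>auto intro!: borel_measurable_times_ennreal\<close>, use h in measurable)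
  also have "\<dots> = (\<integral>\<^sup>+\<nu>. (\<integral>\<^sup>+z. weight \<nu> * (of_bool (ends_at \<nu> (tail G (z 0))) * h \<nu> z) \<partial>m) \<partial>count_space (lists (arcs G)))"
  proof (rule nn_integral_cong)
    fix \<nu> assume "\<nu> \<in> space (count_space (lists (arcs G)))"
    then have \<nu>: "\<nu> \<in> lists (arcs G)" by simp
    note h[OF \<nu>, measurable]
    show "(\<integral>\<^sup>+x. of_bool (starts_with \<nu> x) * h \<nu> ((shift ^^ length \<nu>) x) \<partial>m)
        = (\<integral>\<^sup>+z. weight \<nu> * (of_bool (ends_at \<nu> (tail G (z 0))) * h \<nu> z) \<partial>m)"
      unfolding conformal_nn_integral_path[OF m \<nu> h[OF \<nu>]] by (subst nn_integral_cmult) auto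
  qed
  also have "\<dots> = (\<integral>\<^sup>+z. (\<integral>\<^sup>+\<nu>. weight \<nu> * (of_bool (ends_at \<nu> (tail G (z 0))) * h \<nu> z) \<partial>count_space (lists (arcs G))) \<partial>m)"
    by (intro nn_integral_count_space_nn_integral[symmetric] countable_lists_arcs)
       (use h in \<open>auto intro!: borel_measurable_times_ennreal\<close>)
  finally show ?thesis .
qed

end

section \<open>Following a ray\<close>

context countable_digraph
begin

text \<open>
  Position \<open>i\<close> of \<open>x\<close> is the \<open>j\<close>-th exit: the last visit of
  \<open>x\<close> to the first \<open>j + 1\<close> vertices of \<open>y\<close>, and it happens at
  vertex number \<open>j\<close>.
\<close>

lemma ray_exit_set_shift:
  assumes "x \<in> inf_paths G"
  shows "(shift ^^ i) x \<in> ray_exit_set G y j \<longleftrightarrow>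
    tail G (x i) = tail G (y j) \<and> (\<forall>n>i. \<forall>l\<le>j. tail G (x n) \<noteq> tail G (y l))"
proof -
  have "(\<forall>n>i. P n) \<longleftrightarrow> (\<forall>n\<ge>1. P (i + n))" for P
  proof (intro iffI allI impI)
    fix n assume "\<forall>n\<ge>1. P (i + n)" "i < n"
    then have "P (i + (n - i))" by (metis One_nat_def Suc_leI zero_less_diff)
    with \<open>i < n\<close> show "P n" by simp
  qed simp
  from this[of "\<lambda>n. \<forall>l\<le>j. tail G (x n) \<noteq> tail G (y l)"] show ?thesis
    using assms by (auto simp: ray_exit_set_def shift_funpow_nth shift_funpow_inf_paths image_iff)
qed

lemma ray_exit_set_0:
  "x \<in> ray_exit_set G y j \<longleftrightarrow> x \<in> inf_paths G \<and>
    tail G (x 0) = tail G (y j) \<and> (\<forall>n>0. \<forall>l\<le>j. tail G (x n) \<noteq> tail G (y l))"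
  using ray_exit_set_shift[of x 0 y j] by (auto simp: ray_exit_set_def)

text \<open>Last visits to larger sets happen later.\<close>

lemma ray_exit_time_mono:
  assumes "x \<in> inf_paths G" "(shift ^^ i) x \<in> ray_exit_set G y j" "(shift ^^ i') x \<in> ray_exit_set G y j'" "j \<le> j'"
  shows "i \<le> i'"
  using assms by (metis ray_exit_set_shift not_le_imp_less)

lemma ray_exit_time_unique:
  assumes "x \<in> inf_paths G" "(shift ^^ i) x \<in> ray_exit_set G y j" "(shift ^^ i') x \<in> ray_exit_set G y j"
  shows "i = i'"
  using ray_exit_time_mono[OF assms order_refl] ray_exit_time_mono[OF assms(1,3,2) order_refl] by simp

lemma rays_inj: "y \<in> rays G \<Longrightarrow> tail G (y i) = tail G (y j) \<longleftrightarrow> i = j"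
  by (auto simp: rays_def inj_def)

lemma rays_inf_path: "y \<in> rays G \<Longrightarrow> y \<in> inf_paths G"
  by (simp add: rays_def)

lemma ray_exit_time_strict_mono:
  assumes y: "y \<in> rays G" and x: "x \<in> inf_paths G"
    and "(shift ^^ i) x \<in> ray_exit_set G y j" "(shift ^^ i') x \<in> ray_exit_set G y j'" "j < j'"
  shows "i < i'"
proof -
  have "i \<le> i'" using ray_exit_time_mono[OF x assms(3,4)] \<open>j < j'\<close> by simp
  moreover have "i \<noteq> i'" using assms rays_inj[OF y, of j j'] by (auto simp: ray_exit_set_shift)
  ultimately show ?thesis by simp
qed

definition follows_from :: "(nat \<Rightarrow> 'b) \<Rightarrow> nat \<Rightarrow> (nat \<Rightarrow> 'b) \<Rightarrow> bool" where
  "follows_from y J x \<longleftrightarrow> (\<forall>j\<ge>J. \<exists>i. (shift ^^ i) x \<in> ray_exit_set G y j)"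

lemma follows_from_mono: "follows_from y J x \<Longrightarrow> J \<le> J' \<Longrightarrow> follows_from y J' x"
  by (auto simp: follows_from_def)

text \<open>
  Exit times increase strictly, so the first \<open>n\<close> steps of \<open>x\<close> contain at
  most \<open>n\<close> exits.
\<close>

lemma follows_from_shift:
  assumes y: "y \<in> rays G" and x: "x \<in> inf_paths G" and f: "follows_from y J x"
  shows "follows_from y (J + n) ((shift ^^ n) x)"
proof -
  obtain t where t: "\<And>j. j \<ge> J \<Longrightarrow> (shift ^^ t j) x \<in> ray_exit_set G y j"
    using f unfolding follows_from_def by metis
  have mono: "n' \<le> t (J + n')" for n'
  proof (induction n')
    case (Suc n')
    then show ?case using ray_exit_time_strict_mono[OF y x t t, of "J + n'" "J + Suc n'"] by simp
  qed simp
  show ?thesis unfolding follows_from_def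
  proof (intro allI impI)
    fix j assume j: "J + n \<le> j"
    have "n \<le> t j"
      using mono[of n] ray_exit_time_mono[OF x t[of "J + n"] t[of j]] j by simp
    then have "(shift ^^ (t j - n)) ((shift ^^ n) x) = (shift ^^ t j) x"
      by (simp add: shift_funpow_add)
    then show "\<exists>i. (shift ^^ i) ((shift ^^ n) x) \<in> ray_exit_set G y j"
      using t[of j] j by (intro exI[of _ "t j - n"]) simp
  qed
qed

lemma follows_from_unshift:
  "follows_from y J ((shift ^^ n) x) \<Longrightarrow> follows_from y J x"
  unfolding follows_from_def shift_funpow_add by blast

lemma ray_follow_set_eq:
  "x \<in> ray_follow_set G y k \<longleftrightarrow> x \<in> ray_exit_set G y k \<and> follows_from y k x"
proof -
  have "x \<in> ray_follow_set G y k \<longleftrightarrow> x \<in> ray_exit_set G y k \<and> follows_from y (Suc k) x"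
    by (auto simp: ray_follow_set_def follows_from_def ray_exit_set_def)
  moreover have "follows_from y k x \<longleftrightarrow> follows_from y (Suc k) x" if "x \<in> ray_exit_set G y k"
  proof -
    have "\<exists>i. (shift ^^ i) x \<in> ray_exit_set G y k" using that by (intro exI[of _ 0]) simp
    then show ?thesis unfolding follows_from_def by (metis Suc_leD not_less_eq_eq le_antisym)
  qed
  ultimately show ?thesis by blast
qed

text \<open>
  A path that passes the exits of \<open>y\<close> from number \<open>J\<close> on can be rerouted: replace what
  precedes its \<open>J\<close>-th exit by the initial segment of \<open>y\<close> itself.
\<close>

lemma ray_basin_iff:
  assumes y: "y \<in> rays G"
  shows "x \<in> ray_basin G y \<longleftrightarrow> x \<in> inf_paths G \<and> (\<exists>J. follows_from y J x)"
proof
  assume "x \<in> ray_basin G y"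
  then obtain n k z where x: "x \<in> inf_paths G" and z: "z \<in> ray_follow_set G y 0"
    and eq: "(shift ^^ n) x = (shift ^^ k) z"
    by (auto simp: ray_basin_def)
  have "z \<in> inf_paths G" "follows_from y 0 z"
    using z by (auto simp: ray_follow_set_eq ray_exit_set_0)
  from follows_from_shift[OF y this, of k] have "follows_from y k ((shift ^^ n) x)"
    by (simp add: eq)
  then show "x \<in> inf_paths G \<and> (\<exists>J. follows_from y J x)"
    using x follows_from_unshift by blast
next
  assume "x \<in> inf_paths G \<and> (\<exists>J. follows_from y J x)"
  then obtain J where x: "x \<in> inf_paths G" and J: "follows_from y J x" by blast
  then obtain t where t: "(shift ^^ t) x \<in> ray_exit_set G y J"
    by (auto simp: follows_from_def)
  \<comment> \<open>The initial segment of the ray up to vertex \<open>J\<close>, continued by \<open>x\<close> from its \<open>J\<close>-th exit on.\<close>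
  define z where "z = (\<lambda>i. if i < J then y i else x (t + (i - J)))"
  have yi: "y \<in> inf_paths G" using y by (rule rays_inf_path)
  have tx: "tail G (x t) = tail G (y J)" and av: "\<And>n l. n > t \<Longrightarrow> l \<le> J \<Longrightarrow> tail G (x n) \<noteq> tail G (y l)"
    using t x by (auto simp: ray_exit_set_shift)
  have zs: "tail G (z i) = (if i \<le> J then tail G (y i) else tail G (x (t + (i - J))))" for i
    using tx by (auto simp: z_def)
  have z: "z \<in> inf_paths G"
    unfolding inf_paths_def
  proof safe
    fix i show "z i \<in> arcs G" using x yi by (auto simp: z_def inf_paths_arc)
    have "head G (z i) = (if i < J then tail G (y (Suc i)) else tail G (x (t + (Suc i - J))))"
      using x yi by (auto simp: z_def inf_paths_step[symmetric] Suc_diff_le)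
    then show "head G (z i) = tail G (z (Suc i))" unfolding zs by auto
  qed
  have zJ: "(shift ^^ (J + n)) z = (shift ^^ (t + n)) x" for n
    by (simp add: shift_funpow z_def fun_eq_iff add.assoc)
  have "\<exists>i. (shift ^^ i) z \<in> ray_exit_set G y j" for j
  proof (cases "j \<le> J")
    case True
    have "(shift ^^ j) z \<in> ray_exit_set G y j"
      unfolding ray_exit_set_shift[OF z]
    proof (intro conjI allI impI)
      show "tail G (z j) = tail G (y j)" using True by (simp add: zs)
      fix n l assume "j < n" "l \<le> j"
      then show "tail G (z n) \<noteq> tail G (y l)"
        using av[of "t + (n - J)" l] True rays_inj[OF y, of n l] by (auto simp: zs)
    qed
    then show ?thesis ..
  next
    case False
    then obtain i where i: "(shift ^^ i) x \<in> ray_exit_set G y j"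
      using J unfolding follows_from_def by (meson nat_le_linear)
    have "t \<le> i" using ray_exit_time_mono[OF x t i] False by simp
    then have "(shift ^^ (J + (i - t))) z = (shift ^^ i) x" unfolding zJ by simp
    with i show ?thesis by metis
  qed
  note follow = this
  then have "follows_from y 0 z" by (simp add: follows_from_def)
  moreover have "z \<in> ray_exit_set G y 0"
    using rays_inj[OF y, of _ 0] av[of _ 0] z by (auto simp: ray_exit_set_0 zs)
  ultimately have "z \<in> ray_follow_set G y 0" by (simp add: ray_follow_set_eq)
  moreover have "(shift ^^ t) x = (shift ^^ J) z" using zJ[of 0] by simp
  ultimately show "x \<in> ray_basin G y" using x unfolding ray_basin_def by blast
qed

lemma ray_basin_shift:
  assumes "y \<in> rays G" "x \<in> inf_paths G"
  shows "(shift ^^ n) x \<in> ray_basin G y \<longleftrightarrow> x \<in> ray_basin G y"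
  using assms follows_from_shift[OF assms] follows_from_unshift[of y _ n x]
  by (auto simp: ray_basin_iff)

lemma ray_exit_set_sets [measurable]: "ray_exit_set G y j \<in> sets (path_borel G)"
proof -
  have "ray_exit_set G y j = {x \<in> space (path_borel G).
      tail G (x 0) = tail G (y j) \<and> (\<forall>n. n > 0 \<longrightarrow> \<not> (\<exists>l\<in>{..j}. tail G (x n) = tail G (y l)))}"
    by (auto simp: ray_exit_set_0)
  also have "\<dots> \<in> sets (path_borel G)" by measurable
  finally show ?thesis .
qed

lemma pred_follows_from [measurable]: "Measurable.pred (path_borel G) (follows_from y J)"
proof -
  have "follows_from y J = (\<lambda>x. \<forall>j. J \<le> j \<longrightarrow> (\<exists>i. (shift ^^ i) x \<in> ray_exit_set G y j))"
    by (auto simp: follows_from_def)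
  also have "Measurable.pred (path_borel G) \<dots>" by measurable
  finally show ?thesis .
qed

lemma ray_basin_sets: "y \<in> rays G \<Longrightarrow> ray_basin G y \<in> sets (path_borel G)"
proof -
  assume "y \<in> rays G"
  then have "ray_basin G y = {x \<in> space (path_borel G). \<exists>J. follows_from y J x}"
    by (auto simp: ray_basin_iff)
  also have "\<dots> \<in> sets (path_borel G)" by measurable
  finally show ?thesis .
qed

end

section \<open>The Martin kernel of a ray\<close>

lemma ennreal_inverse_mult_self:
  fixes W :: ennreal
  assumes "W \<noteq> 0" "W \<noteq> \<top>"
  shows "inverse W * W = 1"
  using assms by (metis ennreal_divide_self divide_ennreal_def mult.commute less_top)

locale transient_digraph = weighted_digraph G F \<beta>
  for G :: "('a, 'b) pre_digraph" (structure) and F \<beta> +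
  fixes v0 :: 'a
  assumes v0: "v0 \<in> verts G"
    and green_pos: "v \<in> verts G \<Longrightarrow> 0 < green v0 v"
    and green_finite0: "v \<in> verts G \<Longrightarrow> green v0 v < \<top>"
begin

text \<open>Otherwise Green's function would vanish.\<close>

lemma reachable: "v \<in> verts G \<Longrightarrow> \<exists>\<mu>. awalk v0 \<mu> v"
proof (rule ccontr)
  assume v: "v \<in> verts G" and "\<nexists>\<mu>. awalk v0 \<mu> v"
  then have "walks v0 v = {}" by (auto simp: walks_def)
  then have "green v0 v = 0" by (simp add: green_weight_sum v0 weight_sum_def nn_integral_count_space_finite)
  with green_pos[OF v] show False by simp
qed

lemma green_finite: "u \<in> verts G \<Longrightarrow> v \<in> verts G \<Longrightarrow> green u v < \<top>"
proof -
  assume u: "u \<in> verts G" and v: "v \<in> verts G"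
  obtain \<mu> where "awalk v0 \<mu> u" using reachable[OF u] by blast
  from green_factor_le[OF this, of v] green_finite0[OF v] have "weight \<mu> * green u v < \<top>"
    by (rule le_less_trans)
  then show ?thesis by (auto simp: ennreal_mult_less_top)
qed

definition link :: "(nat \<Rightarrow> 'b) \<Rightarrow> nat \<Rightarrow> ennreal" where
  "link y j = weight_sum (ray_link_paths G y j)"

abbreviation rweight :: "(nat \<Rightarrow> 'b) \<Rightarrow> nat \<Rightarrow> ennreal" where
  "rweight \<equiv> ray_weight G F \<beta>"

abbreviation potential :: "'a \<Rightarrow> (nat \<Rightarrow> 'b) \<Rightarrow> ennreal" where
  "potential \<equiv> ray_potential G F \<beta>"

lemma rweight_0 [simp]: "rweight y 0 = 1"
  and rweight_Suc: "rweight y (Suc k) = rweight y k * link y k"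
  by (simp_all add: ray_weight_def link_def weight_sum_def)

lemma ray_link_paths_subset: "ray_link_paths G y j \<subseteq> walks (tail G (y j)) (tail G (y (Suc j)))"
  by (auto simp: ray_link_paths_def walks_def)

text \<open>The arrow of the ray itself is a link.\<close>

lemma link_pos: "y \<in> rays G \<Longrightarrow> 0 < link y j"
proof -
  assume y: "y \<in> rays G"
  then have yi: "y \<in> inf_paths G" by (rule rays_inf_path)
  have "awalk (tail G (y j)) [y j] (tail G (y (Suc j)))"
    unfolding inf_paths_step[OF yi] by (intro arc_implies_awalk inf_paths_arc yi)
  then have "[y j] \<in> ray_link_paths G y j"
    unfolding ray_link_paths_def by (simp add: inf_paths_step[OF yi, symmetric] rays_inj[OF y] image_iff)
  then show ?thesis unfolding link_def by (rule weight_sum_pos)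
qed

lemma link_finite: "y \<in> rays G \<Longrightarrow> link y j < \<top>"
proof -
  assume y: "y \<in> rays G"
  then have v: "tail G (y i) \<in> verts G" for i using rays_inf_path inf_paths_tail by blast
  have "link y j \<le> green (tail G (y j)) (tail G (y (Suc j)))"
    unfolding link_def by (simp add: green_weight_sum v weight_sum_mono ray_link_paths_subset)
  also have "\<dots> < \<top>" by (intro green_finite v)
  finally show ?thesis .
qed

lemma rweight_pos: "y \<in> rays G \<Longrightarrow> rweight y k \<noteq> 0"
proof (induction k)
  case (Suc k)
  then show ?case using link_pos[of y k] by (simp add: rweight_Suc)
qed simp

lemma rweight_finite: "y \<in> rays G \<Longrightarrow> rweight y k \<noteq> \<top>"
proof (induction k)
  case (Suc k)
  then show ?case using link_finite[of y k] by (simp add: rweight_Suc ennreal_mult_eq_top_iff)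
qed simp

text \<open>
  A concatenation \<open>\<mu>\<nu>\<close> with \<open>\<mu>\<close> ending at the \<open>j\<close>-th vertex of \<open>y\<close> and \<open>\<nu>\<close> a link determines
  its two parts, because the link never returns to that vertex.
\<close>

lemma concat_link_le:
  assumes A: "\<And>\<mu>. \<mu> \<in> A \<Longrightarrow> ends_at \<mu> (tail G (y j))"
    and C: "\<And>\<mu> \<nu>. \<mu> \<in> A \<Longrightarrow> \<nu> \<in> ray_link_paths G y j \<Longrightarrow> \<mu> @ \<nu> \<in> C"
  shows "weight_sum A * link y j \<le> weight_sum C"
proof -
  have eq: "\<mu> = \<mu>'"
    if \<mu>: "\<mu> \<in> A" "\<mu>' \<in> A" and \<nu>: "\<nu> \<in> ray_link_paths G y j" "\<nu>' \<in> ray_link_paths G y j"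
      and e: "\<mu> @ \<nu> = \<mu>' @ \<nu>'" and l: "length \<mu> \<le> length \<mu>'" for \<mu> \<mu>' \<nu> \<nu>'
  proof -
    from e l obtain \<rho> where \<rho>: "\<mu>' = \<mu> @ \<rho>" "\<nu> = \<rho> @ \<nu>'"
      by (auto simp: append_eq_append_conv2)
    show ?thesis
    proof (cases "\<rho> = []")
      case False
      obtain u where u: "awalk u \<mu>' (tail G (y j))" using A[OF \<mu>(2)] by (auto simp: ends_at_def)
      then have "head G (last \<mu>') = tail G (y j)" using False \<rho> by (intro awalk_last_head) auto
      moreover have "last \<mu>' \<in> set \<nu>" using False \<rho> by auto
      ultimately show ?thesis using \<nu>(1) by (auto simp: ray_link_paths_def)
    qed (simp add: \<rho>)
  qed
  have "inj_on (\<lambda>(\<mu>, \<nu>). \<mu> @ \<nu>) (Sigma A (\<lambda>_. ray_link_paths G y j))"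
  proof (rule inj_onI, clarify)
    fix \<mu> \<nu> \<mu>' \<nu>'
    assume a: "\<mu> \<in> A" "\<mu>' \<in> A" "\<nu> \<in> ray_link_paths G y j" "\<nu>' \<in> ray_link_paths G y j" "\<mu> @ \<nu> = \<mu>' @ \<nu>'"
    then have "\<mu> = \<mu>'" using eq[of \<mu> \<mu>' \<nu> \<nu>'] eq[of \<mu>' \<mu> \<nu>' \<nu>] by (cases "length \<mu> \<le> length \<mu>'") auto
    with a show "\<mu> = \<mu>' \<and> \<nu> = \<nu>'" by simp
  qed
  from concat_weight_sum_le[OF this C] have
    "(\<integral>\<^sup>+\<mu>. weight \<mu> * weight_sum (ray_link_paths G y j) \<partial>count_space A) \<le> weight_sum C" by simp
  then show ?thesis by (simp add: link_def weight_sum_def nn_integral_multc)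
qed

lemma green_link_le:
  "v \<in> verts G \<Longrightarrow> green v (tail G (y j)) * link y j \<le> green v (tail G (y (Suc j)))"
  unfolding green_weight_sum
  by (rule concat_link_le) (auto simp: walks_def ends_at_def ray_link_paths_def intro: awalk_appendI)

text \<open>The approximations of \<open>ray_potential\<close>.\<close>

definition kernel :: "nat \<Rightarrow> 'a \<Rightarrow> (nat \<Rightarrow> 'b) \<Rightarrow> ennreal" where
  "kernel k v y = inverse (rweight y k) * green v (tail G (y k))"

text \<open>
  Prolonging paths to the \<open>k\<close>-th vertex by a link reaches the next vertex, and
  \<open>ray_weight\<close> accounts exactly for the links.
\<close>

lemma kernel_incseq:
  assumes y: "y \<in> rays G" and v: "v \<in> verts G"
  shows "incseq (\<lambda>k. kernel k v y)"
proof (rule incseq_SucI)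
  fix k
  have "kernel k v y = inverse (rweight y k * link y k) * (green v (tail G (y k)) * link y k)"
  proof -
    have "inverse (rweight y k * link y k) = inverse (rweight y k) * inverse (link y k)"
      using rweight_pos[OF y, of k] link_pos[OF y, of k] rweight_finite[OF y, of k] link_finite[OF y, of k]
      by (intro ennreal_inverse_mult) (auto simp: less_top)
    moreover have "inverse (link y k) * link y k = 1"
      using link_pos[OF y, of k] link_finite[OF y, of k] by (intro ennreal_inverse_mult_self) auto
    ultimately show ?thesis unfolding kernel_def by (metis mult.assoc mult.commute mult.right_neutral)
  qed
  also have "\<dots> \<le> kernel (Suc k) v y"
    unfolding kernel_def rweight_Suc by (intro mult_left_mono green_link_le v) simp
  finally show "kernel k v y \<le> kernel (Suc k) v y" .
qed

lemma potential_SUP: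
  assumes "y \<in> rays G" "v \<in> verts G"
  shows "potential v y = (SUP k. kernel k v y)"
  using LIMSEQ_SUP[OF kernel_incseq[OF assms]] unfolding ray_potential_def kernel_def[symmetric]
  by (rule limI)

lemma kernel_LIMSEQ:
  "y \<in> rays G \<Longrightarrow> v \<in> verts G \<Longrightarrow> (\<lambda>k. kernel k v y) \<longlonglongrightarrow> potential v y"
  using LIMSEQ_SUP[OF kernel_incseq] potential_SUP by simp

lemma potential_pos: "y \<in> rays G \<Longrightarrow> 0 < potential v0 y"
proof -
  assume y: "y \<in> rays G"
  have "0 < kernel 0 v0 y"
    unfolding kernel_def using green_pos[of "tail G (y 0)"] rays_inf_path[OF y] by (simp add: inf_paths_tail)
  also have "\<dots> \<le> potential v0 y" unfolding potential_SUP[OF y v0] by (rule SUP_upper) simp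
  finally show ?thesis .
qed

lemma potential_factor_le:
  assumes y: "y \<in> rays G" and \<mu>: "awalk v \<mu> u"
  shows "weight \<mu> * potential u y \<le> potential v y"
proof -
  have v: "v \<in> verts G" "u \<in> verts G"
    using \<mu> by (auto intro: awalk_hd_in_verts awalk_last_in_verts)
  have "weight \<mu> * kernel k u y \<le> kernel k v y" for k
    unfolding kernel_def mult.left_commute[of "weight \<mu>"] by (intro mult_left_mono green_factor_le \<mu>) simp
  then show ?thesis
    unfolding potential_SUP[OF y v(1)] potential_SUP[OF y v(2)] SUP_mult_left_ennreal
    by (intro SUP_mono) auto
qed

lemma potential_finite:
  assumes y: "y \<in> rays G" and f: "potential v0 y < \<top>" and v: "v \<in> verts G"
  shows "potential v y < \<top>"
proof -
  obtain \<mu> where "awalk v0 \<mu> v" using reachable[OF v] by blast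
  from potential_factor_le[OF y this] f have "weight \<mu> * potential v y < \<top>" by (rule le_less_trans)
  then show ?thesis by (auto simp: ennreal_mult_less_top)
qed

text \<open>
  Green's function \<open>g(\<cdot>, w)\<close> is harmonic except at its pole \<open>w\<close>.  As
  the poles run along the ray, the defect at \<open>v\<close> disappears in the limit.
\<close>

lemma potential_harmonic:
  assumes y: "y \<in> rays G" and v: "v \<in> verts G"
  shows "potential v y = (\<integral>\<^sup>+a. ennreal (exp (- \<beta> * F a)) * potential (head G a) y \<partial>count_space (out_arcs G v))"
proof -
  let ?o = "\<lambda>k. inverse (rweight y k) * of_bool (v = tail G (y k)) :: ennreal"
  have step: "kernel k v y = ?o k
      + (\<integral>\<^sup>+a. ennreal (exp (- \<beta> * F a)) * kernel k (head G a) y \<partial>count_space (out_arcs G v))" for k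
    unfolding kernel_def green_step[OF v, of "tail G (y k)"] distrib_left A_mat_sum
    by (subst nn_integral_cmult[symmetric]) (auto intro!: nn_integral_cong simp: mult_ac)
  have "eventually (\<lambda>k. ?o k = 0) sequentially"
  proof (cases "\<exists>k. v = tail G (y k)")
    case True
    then obtain k where "v = tail G (y k)" ..
    then show ?thesis
      using rays_inj[OF y] by (intro eventually_sequentiallyI[of "Suc k"]) auto
  qed auto
  then have "?o \<longlonglongrightarrow> 0" by (rule tendsto_eventually)
  moreover have "(\<lambda>k. \<integral>\<^sup>+a. ennreal (exp (- \<beta> * F a)) * kernel k (head G a) y \<partial>count_space (out_arcs G v))
      \<longlonglongrightarrow> (\<integral>\<^sup>+a. ennreal (exp (- \<beta> * F a)) * potential (head G a) y \<partial>count_space (out_arcs G v))"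
  proof -
    let ?f = "\<lambda>k a. of_bool (a \<in> out_arcs G v) * (ennreal (exp (- \<beta> * F a)) * kernel k (head G a) y)"
    let ?u = "\<lambda>a. of_bool (a \<in> out_arcs G v) * (ennreal (exp (- \<beta> * F a)) * potential (head G a) y)"
    have "(\<lambda>k. integral\<^sup>N (count_space UNIV) (?f k)) \<longlonglongrightarrow> integral\<^sup>N (count_space UNIV) ?u"
    proof (rule nn_integral_LIMSEQ)
      show "incseq ?f"
        using kernel_incseq[OF y] by (auto simp: incseq_def le_fun_def of_bool_def intro!: mult_left_mono)
      show "(\<lambda>k. ?f k a) \<longlonglongrightarrow> ?u a" for a
      proof (cases "a \<in> out_arcs G v")
        case True
        then have "(\<lambda>k. kernel k (head G a) y) \<longlonglongrightarrow> potential (head G a) y"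
          by (intro kernel_LIMSEQ y) auto
        then have "(\<lambda>k. ennreal (exp (- \<beta> * F a)) * kernel k (head G a) y)
            \<longlonglongrightarrow> ennreal (exp (- \<beta> * F a)) * potential (head G a) y"
          by (intro tendsto_mult_ennreal tendsto_const) simp_all
        with True show ?thesis by simp
      qed auto
    qed simp
    then show ?thesis unfolding nn_integral_count_space_of_bool[OF subset_UNIV] .
  qed
  ultimately have "(\<lambda>k. kernel k v y) \<longlonglongrightarrow> 0
      + (\<integral>\<^sup>+a. ennreal (exp (- \<beta> * F a)) * potential (head G a) y \<partial>count_space (out_arcs G v))"
    unfolding step by (intro tendsto_add) auto
  from LIMSEQ_unique[OF kernel_LIMSEQ[OF y v] this] show ?thesis by simp
qed

lemma weight_sum_Un_disjoint:
  assumes "A \<inter> B = {}"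
  shows "weight_sum (A \<union> B) = weight_sum A + weight_sum B"
proof -
  have "weight_sum (A \<union> B) = (\<integral>\<^sup>+\<mu>. of_bool (\<mu> \<in> A) * weight \<mu> + of_bool (\<mu> \<in> B) * weight \<mu> \<partial>count_space (A \<union> B))"
    unfolding weight_sum_def using assms by (intro nn_integral_cong) auto
  also have "\<dots> = weight_sum A + weight_sum B"
    by (subst nn_integral_add) (auto simp: nn_integral_count_space_of_bool weight_sum_def)
  finally show ?thesis .
qed

text \<open>
  First returns to the first \<open>k + 1\<close> vertices of the ray.  The last arrow is the one
  that returns, hence \<open>butlast\<close>.
\<close>

definition return_paths :: "(nat \<Rightarrow> 'b) \<Rightarrow> nat \<Rightarrow> 'b list set" where
  "return_paths y k = {\<mu>. \<mu> \<noteq> [] \<and> (\<exists>v. awalk (tail G (y k)) \<mu> v) \<and>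
     head G (last \<mu>) \<in> (\<lambda>i. tail G (y i)) ` {..k} \<and>
     (\<forall>a\<in>set (butlast \<mu>). head G a \<notin> (\<lambda>i. tail G (y i)) ` {..k})}"

definition avoiding_paths :: "(nat \<Rightarrow> 'b) \<Rightarrow> nat \<Rightarrow> nat \<Rightarrow> 'b list set" where
  "avoiding_paths y k n = {\<mu>. awalk (tail G (y k)) \<mu> (tail G (y n)) \<and>
     (\<forall>a\<in>set \<mu>. head G a \<notin> (\<lambda>i. tail G (y i)) ` {..k})}"

text \<open>
  Concatenating links from vertex \<open>k\<close> on yields paths that avoid the first \<open>k +
  1\<close> vertices.
\<close>

lemma rweight_le_avoiding:
  assumes y: "y \<in> rays G" and "k \<le> n"
  shows "rweight y n \<le> rweight y k * weight_sum (avoiding_paths y k n)"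
  using \<open>k \<le> n\<close>
proof (induction n rule: dec_induct)
  case base
  have "[] \<in> avoiding_paths y k k"
    using rays_inf_path[OF y] by (auto simp: avoiding_paths_def awalk_Nil_iff inf_paths_tail)
  from weight_le_sum[OF this] have "1 \<le> weight_sum (avoiding_paths y k k)" by simp
  then show ?case by (metis mult.right_neutral mult_left_mono zero_le)
next
  case (step n)
  have "rweight y (Suc n) \<le> rweight y k * weight_sum (avoiding_paths y k n) * link y n"
    unfolding rweight_Suc by (intro mult_right_mono step.IH) simp
  also have "\<dots> = rweight y k * (weight_sum (avoiding_paths y k n) * link y n)" by (simp add: mult.assoc)
  also have "\<dots> \<le> rweight y k * weight_sum (avoiding_paths y k (Suc n))"
    using step.hyps
    by (intro mult_left_mono concat_link_le)
       (auto simp: avoiding_paths_def ends_at_def ray_link_paths_def intro!: awalk_appendI)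
  finally show ?case .
qed

lemma return_paths_prefix_free:
  assumes "\<mu> \<in> return_paths y k" "\<mu> @ \<rho> \<in> return_paths y k"
  shows "\<rho> = []"
proof (rule ccontr)
  assume "\<rho> \<noteq> []"
  then have "last \<mu> \<in> set (butlast (\<mu> @ \<rho>))"
    using assms(1) by (auto simp: butlast_append return_paths_def)
  then show False using assms by (auto simp: return_paths_def)
qed

text \<open>
  Paths from the \<open>k\<close>-th to the \<open>n\<close>-th vertex are split according to whether they come back to the first
  \<open>k + 1\<close> vertices of the ray.
\<close>

lemma green_first_return:
  assumes v: "tail G (y k) \<in> verts G"
  shows "(\<integral>\<^sup>+\<mu>. weight \<mu> * green (head G (last \<mu>)) (tail G (y n)) \<partial>count_space (return_paths y k))
      + weight_sum (avoiding_paths y k n) \<le> green (tail G (y k)) (tail G (y n))"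
proof -
  let ?C = "{\<mu> @ \<nu> | \<mu> \<nu>. \<mu> \<in> return_paths y k \<and> \<nu> \<in> walks (head G (last \<mu>)) (tail G (y n))}"
  have hv: "head G (last \<mu>) \<in> verts G" and aw: "awalk (tail G (y k)) \<mu> (head G (last \<mu>))"
    if "\<mu> \<in> return_paths y k" for \<mu>
    using that awalk_last_head awalk_last_in_verts by (auto simp: return_paths_def)
  have "(\<integral>\<^sup>+\<mu>. weight \<mu> * green (head G (last \<mu>)) (tail G (y n)) \<partial>count_space (return_paths y k))
      = (\<integral>\<^sup>+\<mu>. weight \<mu> * weight_sum (walks (head G (last \<mu>)) (tail G (y n))) \<partial>count_space (return_paths y k))"
    by (intro nn_integral_cong) (simp add: green_weight_sum hv)
  also have "\<dots> \<le> weight_sum ?C"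
  proof (rule concat_weight_sum_le)
    show "inj_on (\<lambda>(\<mu>, \<nu>). \<mu> @ \<nu>) (Sigma (return_paths y k) (\<lambda>\<mu>. walks (head G (last \<mu>)) (tail G (y n))))"
    proof (rule inj_onI, clarify)
      fix \<mu> \<nu> \<mu>' \<nu>' assume "\<mu> \<in> return_paths y k" "\<mu>' \<in> return_paths y k" "\<mu> @ \<nu> = \<mu>' @ \<nu>'"
      then show "\<mu> = \<mu>' \<and> \<nu> = \<nu>'"
        using return_paths_prefix_free[of \<mu> y k] return_paths_prefix_free[of \<mu>' y k]
        by (auto simp: append_eq_append_conv2)
    qed
  qed auto
  finally have "(\<integral>\<^sup>+\<mu>. weight \<mu> * green (head G (last \<mu>)) (tail G (y n)) \<partial>count_space (return_paths y k))
      + weight_sum (avoiding_paths y k n) \<le> weight_sum ?C + weight_sum (avoiding_paths y k n)"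
    by (rule add_right_mono)
  also have "\<dots> = weight_sum (?C \<union> avoiding_paths y k n)"
  proof (rule weight_sum_Un_disjoint[symmetric])
    have "\<mu> @ \<nu> \<notin> avoiding_paths y k n" if \<mu>: "\<mu> \<in> return_paths y k" for \<mu> \<nu>
    proof -
      have "last \<mu> \<in> set (\<mu> @ \<nu>)" using \<mu> by (auto simp: return_paths_def)
      then show ?thesis using \<mu> unfolding avoiding_paths_def return_paths_def by blast
    qed
    then show "?C \<inter> avoiding_paths y k n = {}" by auto
  qed
  also have "\<dots> \<le> weight_sum (walks (tail G (y k)) (tail G (y n)))"
    by (intro weight_sum_mono) (auto simp: avoiding_paths_def walks_def dest!: aw intro: awalk_appendI)
  finally show ?thesis by (simp add: green_weight_sum v)
qed

text \<open>
  The limit of \<open>green_first_return\<close> divided by \<open>ray_weight\<close>.  The paths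
  that never come back keep a positive share, because they contain the concatenations of the links
  from vertex \<open>k\<close> on.
\<close>

lemma potential_first_return:
  assumes y: "y \<in> rays G"
  shows "(\<integral>\<^sup>+\<mu>. weight \<mu> * potential (head G (last \<mu>)) y \<partial>count_space (return_paths y k))
      + inverse (rweight y k) \<le> potential (tail G (y k)) y"
proof -
  have yv: "tail G (y i) \<in> verts G" for i using rays_inf_path[OF y] by (simp add: inf_paths_tail)
  have hv: "head G (last \<mu>) \<in> verts G" if "\<mu> \<in> return_paths y k" for \<mu>
    using that yv by (auto simp: return_paths_def)
  let ?I = "\<lambda>n. \<integral>\<^sup>+\<mu>. of_bool (\<mu> \<in> return_paths y k) * (weight \<mu> * kernel n (head G (last \<mu>)) y) \<partial>count_space UNIV"
  have "?I \<longlonglongrightarrow> (\<integral>\<^sup>+\<mu>. of_bool (\<mu> \<in> return_paths y k) * (weight \<mu> * potential (head G (last \<mu>)) y) \<partial>count_space UNIV)"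
  proof (rule nn_integral_LIMSEQ)
    show "incseq (\<lambda>n \<mu>. of_bool (\<mu> \<in> return_paths y k) * (weight \<mu> * kernel n (head G (last \<mu>)) y))"
      using kernel_incseq[OF y hv] by (auto simp: incseq_def le_fun_def of_bool_def intro!: mult_left_mono)
    show "(\<lambda>n. of_bool (\<mu> \<in> return_paths y k) * (weight \<mu> * kernel n (head G (last \<mu>)) y))
        \<longlonglongrightarrow> of_bool (\<mu> \<in> return_paths y k) * (weight \<mu> * potential (head G (last \<mu>)) y)" for \<mu>
      using kernel_LIMSEQ[OF y hv, of \<mu>]
      by (cases "\<mu> \<in> return_paths y k") (auto intro!: tendsto_mult_ennreal)
  qed simp
  then have "(\<lambda>n. ?I n + inverse (rweight y k)) \<longlonglongrightarrow>
      (\<integral>\<^sup>+\<mu>. weight \<mu> * potential (head G (last \<mu>)) y \<partial>count_space (return_paths y k)) + inverse (rweight y k)"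
    by (intro tendsto_add) (simp_all add: nn_integral_count_space_of_bool)
  moreover have "?I n + inverse (rweight y k) \<le> kernel n (tail G (y k)) y" if n: "k \<le> n" for n
  proof -
    let ?W = "inverse (rweight y n)"
    have "inverse (rweight y k) \<le> ?W * weight_sum (avoiding_paths y k n)"
    proof -
      have "inverse (rweight y k) = inverse (rweight y k) * (?W * rweight y n)"
        using ennreal_inverse_mult_self[OF rweight_pos[OF y] rweight_finite[OF y]] by simp
      also have "\<dots> \<le> inverse (rweight y k) * (?W * (rweight y k * weight_sum (avoiding_paths y k n)))"
        by (intro mult_left_mono rweight_le_avoiding y n) auto
      also have "\<dots> = (inverse (rweight y k) * rweight y k) * (?W * weight_sum (avoiding_paths y k n))"
        by (simp add: mult_ac)
      finally show ?thesis
        using ennreal_inverse_mult_self[OF rweight_pos[OF y] rweight_finite[OF y]] by simp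
    qed
    then have "?I n + inverse (rweight y k) \<le>
        ?W * ((\<integral>\<^sup>+\<mu>. weight \<mu> * green (head G (last \<mu>)) (tail G (y n)) \<partial>count_space (return_paths y k))
          + weight_sum (avoiding_paths y k n))"
      unfolding distrib_left
    proof (intro add_mono)
      have "?I n = (\<integral>\<^sup>+\<mu>. weight \<mu> * kernel n (head G (last \<mu>)) y \<partial>count_space (return_paths y k))"
        by (rule nn_integral_count_space_of_bool) simp
      also have "\<dots> = ?W * (\<integral>\<^sup>+\<mu>. weight \<mu> * green (head G (last \<mu>)) (tail G (y n)) \<partial>count_space (return_paths y k))"
        by (subst nn_integral_cmult[symmetric]) (auto simp: kernel_def mult_ac)
      finally show "?I n \<le> \<dots>" by simp
    qed
    also have "\<dots> \<le> kernel n (tail G (y k)) y"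
      unfolding kernel_def by (intro mult_left_mono green_first_return yv) simp
    finally show ?thesis .
  qed
  ultimately show ?thesis
    by (intro LIMSEQ_le[OF _ kernel_LIMSEQ[OF y yv]]) auto
qed

end

section \<open>Conformal measures from harmonic vectors\<close>

definition mixture :: "'i measure \<Rightarrow> ('i \<Rightarrow> 'x measure) \<Rightarrow> 'x measure \<Rightarrow> 'x measure" where
  "mixture N \<kappa> M = measure_of (space M) (sets M) (\<lambda>B. \<integral>\<^sup>+i. emeasure (\<kappa> i) B \<partial>N)"

lemma sets_mixture [simp]: "sets (mixture N \<kappa> M) = sets M"
  by (simp add: mixture_def)

lemma emeasure_mixture:
  assumes sets: "\<And>i. i \<in> space N \<Longrightarrow> sets (\<kappa> i) = sets M"
    and meas: "\<And>B. B \<in> sets M \<Longrightarrow> (\<lambda>i. emeasure (\<kappa> i) B) \<in> borel_measurable N"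
    and B: "B \<in> sets M"
  shows "emeasure (mixture N \<kappa> M) B = (\<integral>\<^sup>+i. emeasure (\<kappa> i) B \<partial>N)"
proof (rule emeasure_measure_of[OF mixture_def])
  show "countably_additive (sets (mixture N \<kappa> M)) (\<lambda>B. \<integral>\<^sup>+i. emeasure (\<kappa> i) B \<partial>N)"
  proof (rule countably_additiveI)
    fix A :: "nat \<Rightarrow> 'b set"
    assume A: "range A \<subseteq> sets (mixture N \<kappa> M)" "disjoint_family A"
    then have A': "A n \<in> sets M" for n by auto
    have "(\<Sum>n. \<integral>\<^sup>+i. emeasure (\<kappa> i) (A n) \<partial>N) = (\<integral>\<^sup>+i. (\<Sum>n. emeasure (\<kappa> i) (A n)) \<partial>N)"
      using A' meas by (intro nn_integral_suminf[symmetric]) auto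
    also have "\<dots> = (\<integral>\<^sup>+i. emeasure (\<kappa> i) (\<Union> (range A)) \<partial>N)"
      using A A' sets by (intro nn_integral_cong suminf_emeasure) auto
    finally show "(\<Sum>n. \<integral>\<^sup>+i. emeasure (\<kappa> i) (A n) \<partial>N) = (\<integral>\<^sup>+i. emeasure (\<kappa> i) (\<Union> (range A)) \<partial>N)" .
  qed
qed (use B sets.space_closed in \<open>auto simp: positive_def\<close>)

context weighted_digraph
begin

text \<open>
  Doob's transform of the arrow weights by \<open>h\<close>.  Vertices where \<open>h\<close> vanishes are reached with probability
  zero; from there an arbitrary arrow \<open>a0\<close> is taken.
\<close>

definition transition :: "('a \<Rightarrow> ennreal) \<Rightarrow> 'b \<Rightarrow> 'a \<Rightarrow> 'b measure" where
  "transition h a0 v = (if h v = 0 then return (count_space (arcs G)) a0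
    else density (count_space (arcs G))
      (\<lambda>b. of_bool (tail G b = v) * (ennreal (exp (- \<beta> * F b)) * h (head G b) / h v)))"

definition path_end :: "'a \<Rightarrow> 'b list \<Rightarrow> 'a" where
  "path_end v \<nu> = (if \<nu> = [] then v else head G (last \<nu>))"

lemma path_end_awalk: "awalk v \<nu> u \<Longrightarrow> path_end v \<nu> = u"
  by (cases "\<nu> = []") (auto simp: path_end_def awalk_Nil_iff awalk_last_head)

lemma awalk_snoc_iff:
  "awalk v (\<nu> @ [a]) (head G a) \<longleftrightarrow> awalk v \<nu> (tail G a) \<and> a \<in> arcs G"
  by (induction \<nu> arbitrary: v) (auto simp: awalk_simps)

lemma awalk_path_end_snoc:
  "awalk v (\<nu> @ [a]) (path_end v (\<nu> @ [a])) \<longleftrightarrow>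
    awalk v \<nu> (path_end v \<nu>) \<and> tail G a = path_end v \<nu> \<and> a \<in> arcs G"
proof -
  have "path_end v (\<nu> @ [a]) = head G a" by (simp add: path_end_def)
  then show ?thesis using path_end_awalk[of v \<nu> "tail G a"] by (auto simp only: awalk_snoc_iff)
qed

text \<open>
  Ionescu-Tulcea for the chain with the transition probabilities above.  The factors
  \<open>h\<close> cancel along a path, up to the first and the last one.
\<close>

lemma path_law_exists:
  assumes h: "\<And>v. v \<in> verts G \<Longrightarrow> h v < \<top>"
    and harm: "\<And>v. v \<in> verts G \<Longrightarrow>
      h v = (\<integral>\<^sup>+a. ennreal (exp (- \<beta> * F a)) * h (head G a) \<partial>count_space (out_arcs G v))"
    and v: "v \<in> verts G" "h v \<noteq> 0"
  shows "\<exists>Q. prob_space Q \<and> sets Q = sets (PiM UNIV (\<lambda>_. count_space (arcs G))) \<and>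
    (\<forall>\<nu>\<in>lists (arcs G). h v * emeasure Q {x \<in> space Q. starts_with \<nu> x}
      = of_bool (awalk v \<nu> (path_end v \<nu>)) * weight \<nu> * h (path_end v \<nu>))"
proof -
  let ?A = "count_space (arcs G)"
  have "out_arcs G v \<noteq> {}" using harm[OF v(1)] v(2) by (auto simp: nn_integral_count_space_finite)
  then obtain a0 where a0: "a0 \<in> arcs G" by auto
  define K where "K = transition h a0"
  have K_sets [simp]: "sets (K u) = sets ?A" "space (K u) = arcs G" for u
    by (auto simp: K_def transition_def)
  have K_prob: "prob_space (K u)" if u: "u \<in> verts G" for u
  proof (cases "h u = 0")
    case True
    then show ?thesis using a0 by (auto simp: K_def transition_def intro: prob_space_return)
  next
    case False
    have "emeasure (K u) (space (K u))
        = (\<integral>\<^sup>+b. of_bool (tail G b = u) * (ennreal (exp (- \<beta> * F b)) * h (head G b) / h u) \<partial>?A)"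
      using False by (auto simp: K_def transition_def emeasure_density intro!: nn_integral_cong)
    also have "\<dots> = (\<integral>\<^sup>+b. of_bool (b \<in> out_arcs G u) * (ennreal (exp (- \<beta> * F b)) * h (head G b) / h u) \<partial>?A)"
      by (intro nn_integral_cong) auto
    also have "\<dots> = (\<integral>\<^sup>+b. ennreal (exp (- \<beta> * F b)) * h (head G b) / h u \<partial>count_space (out_arcs G u))"
      by (rule nn_integral_count_space_of_bool) auto
    also have "\<dots> = h u / h u"
      unfolding divide_ennreal_def nn_integral_multc[OF borel_measurable_count_space] harm[OF u, symmetric] ..
    also have "\<dots> = 1" using False h[OF u] by (intro ennreal_divide_self) auto
    finally show ?thesis by (rule prob_spaceI)
  qed
  have K_singleton: "h u * emeasure (K u) {a} = of_bool (tail G a = u) * (ennreal (exp (- \<beta> * F a)) * h (head G a))"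
    if u: "u \<in> verts G" and a: "a \<in> arcs G" for u a
  proof (cases "h u = 0")
    case True
    have "ennreal (exp (- \<beta> * F a)) * h (head G a) \<le> h u" if "tail G a = u"
      unfolding harm[OF u] using that a by (intro nn_integral_ge_point) auto
    with True show ?thesis by auto
  next
    case False
    then have "emeasure (K u) {a} = of_bool (tail G a = u) * (ennreal (exp (- \<beta> * F a)) * h (head G a) / h u)"
      using a by (simp add: K_def transition_def emeasure_density nn_integral_indicator_singleton)
    then have "h u * emeasure (K u) {a}
        = (inverse (h u) * h u) * (of_bool (tail G a = u) * (ennreal (exp (- \<beta> * F a)) * h (head G a)))"
      by (simp only: divide_ennreal_def mult_ac)
    also have "inverse (h u) * h u = 1"
      using False h[OF u] by (intro ennreal_inverse_mult_self) auto
    finally show ?thesis by simp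
  qed
  define P where "P i x = (if i = 0 then K v else K (head G (x (i - 1))))" for i :: nat and x :: "nat \<Rightarrow> 'b"
  have head_verts: "head G (x (i - 1)) \<in> verts G" if "i \<noteq> 0" "x \<in> space (PiM {0..<i} (\<lambda>_. ?A))" for i :: nat and x
  proof -
    have "x \<in> PiE {0..<i} (\<lambda>_. arcs G)" "i - 1 \<in> {0..<i}" using that by (auto simp: space_PiM)
    then have "x (i - 1) \<in> arcs G" by (rule PiE_mem)
    then show ?thesis by (rule head_in_verts)
  qed
  interpret IT: Ionescu_Tulcea P "\<lambda>_. ?A"
  proof (rule Ionescu_Tulcea.intro)
    fix i :: nat
    show "P i \<in> PiM {0..<i} (\<lambda>_. ?A) \<rightarrow>\<^sub>M subprob_algebra ?A"
    proof (cases "i = 0")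
      case True
      have "K v \<in> space (subprob_algebra ?A)"
        using K_prob[OF v(1)] by (auto simp: space_subprob_algebra intro: prob_space_imp_subprob_space)
      then show ?thesis using True by (simp add: P_def[abs_def])
    next
      case False
      have "(\<lambda>a. K (head G a)) \<in> ?A \<rightarrow>\<^sub>M subprob_algebra ?A"
        using K_prob by (auto simp: space_subprob_algebra intro: prob_space_imp_subprob_space)
      then have "(\<lambda>x. K (head G (x (i - 1)))) \<in> PiM {0..<i} (\<lambda>_. ?A) \<rightarrow>\<^sub>M subprob_algebra ?A"
        using False by (intro measurable_compose[OF measurable_component_singleton]) auto
      then show ?thesis using False by (simp add: P_def[abs_def])
    qed
  next
    fix i :: nat and x assume "x \<in> space (PiM {0..<i} (\<lambda>_. ?A))"
    then show "prob_space (P i x)"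
      using head_verts[of i x] K_prob v(1) by (auto simp: P_def)
  qed
  define r where "r \<nu> = restrict (\<lambda>i. \<nu> ! i) {0..<length \<nu>}" for \<nu> :: "'b list"
  have r_space: "r \<nu> \<in> space (PiM {0..<length \<nu>} (\<lambda>_. ?A))" if "\<nu> \<in> lists (arcs G)" for \<nu>
    using that by (auto simp: space_PiM r_def)
  have r_sets: "{r \<nu>} \<in> sets (PiM {0..<length \<nu>} (\<lambda>_. ?A))" if \<nu>: "\<nu> \<in> lists (arcs G)" for \<nu>
  proof -
    have "{r \<nu>} = PiE {0..<length \<nu>} (\<lambda>i. {\<nu> ! i})"
      by (auto simp: r_def PiE_iff extensional_def fun_eq_iff)
    also have "\<dots> \<in> sets (PiM {0..<length \<nu>} (\<lambda>_. ?A))"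
      using \<nu> by (intro sets_PiM_I_finite) auto
    finally show ?thesis .
  qed
  let ?u = "\<lambda>_ :: nat. undefined :: 'b"
  have u_space: "?u \<in> space (PiM {0..<0} (\<lambda>_. ?A))" by (simp add: space_PiM)
  have law: "h v * emeasure (IT.C 0 (length \<nu>) ?u) {r \<nu>}
      = of_bool (awalk v \<nu> (path_end v \<nu>)) * weight \<nu> * h (path_end v \<nu>)"
    if "\<nu> \<in> lists (arcs G)" for \<nu>
    using that
  proof (induction \<nu> rule: rev_induct)
    case Nil
    have "r [] = ?u" by (auto simp: r_def)
    then show ?case
      using v r_sets[of "[]"] by (simp add: path_end_def awalk_Nil_iff)
  next
    case (snoc a \<nu>)
    then have \<nu>: "\<nu> \<in> lists (arcs G)" and a: "a \<in> arcs G" by auto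
    let ?n = "length \<nu>"
    let ?e = "path_end v \<nu>"
    have e: "?e \<in> verts G" using v(1) \<nu> by (cases "\<nu> = []") (auto simp: path_end_def)
    \<comment> \<open>The next arrow is drawn according to the end point of the path so far.\<close>
    have P_r: "P ?n (r \<nu>) = K ?e"
      by (auto simp: P_def r_def path_end_def last_conv_nth)
    have "emeasure (IT.C 0 (length (\<nu> @ [a])) ?u) {r (\<nu> @ [a])}
        = (\<integral>\<^sup>+x. emeasure (IT.eP ?n x) {r (\<nu> @ [a])} \<partial>IT.C 0 ?n ?u)"
      using r_sets[of "\<nu> @ [a]"] a \<nu> IT.space_C[OF u_space, of ?n] IT.space_PiM_not_empty
        prob_space.not_empty[OF IT.prob_space_C[OF u_space, of ?n]]
      by (simp, subst emeasure_bind[where N="PiM {0..<Suc ?n} (\<lambda>_. ?A)"])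
         (auto simp: measurable_cong_sets[OF IT.sets_C[OF u_space] refl])
    also have "\<dots> = (\<integral>\<^sup>+x. emeasure (P ?n (r \<nu>)) {a} * indicator {r \<nu>} x \<partial>IT.C 0 ?n ?u)"
    proof (rule nn_integral_cong)
      fix x assume "x \<in> space (IT.C 0 ?n ?u)"
      then have x: "x \<in> space (PiM {0..<?n} (\<lambda>_. ?A))" using IT.space_C[OF u_space, of ?n] by simp
      have upd: "x(?n := b) = r (\<nu> @ [a]) \<longleftrightarrow> x = r \<nu> \<and> b = a" for b
      proof
        assume eq: "x(?n := b) = r (\<nu> @ [a])"
        have "b = a" using fun_cong[OF eq, of ?n] by (simp add: r_def)
        moreover have "x i = r \<nu> i" for i
        proof (cases "i < ?n")
          case True
          then show ?thesis using fun_cong[OF eq, of i] by (simp add: r_def nth_append)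
        next
          case False
          then show ?thesis using x by (auto simp: space_PiM PiE_iff extensional_def r_def)
        qed
        ultimately show "x = r \<nu> \<and> b = a" by auto
      next
        assume "x = r \<nu> \<and> b = a"
        then show "x(?n := b) = r (\<nu> @ [a])" by (auto simp: r_def fun_eq_iff nth_append)
      qed
      have "emeasure (IT.eP ?n x) {r (\<nu> @ [a])} = emeasure (P ?n x) (fun_upd x ?n -` {r (\<nu> @ [a])} \<inter> space ?A)"
        using r_sets[of "\<nu> @ [a]"] a \<nu> by (intro IT.emeasure_eP x) auto
      also have "fun_upd x ?n -` {r (\<nu> @ [a])} \<inter> space ?A = {b. (x = r \<nu> \<and> b = a) \<and> b \<in> arcs G}"
        unfolding vimage_def Int_def by (simp add: upd)
      also have "\<dots> = (if x = r \<nu> then {a} else {})" using a by auto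
      finally show "emeasure (IT.eP ?n x) {r (\<nu> @ [a])} = emeasure (P ?n (r \<nu>)) {a} * indicator {r \<nu>} x"
        by (auto split: split_indicator)
    qed
    also have "\<dots> = emeasure (K ?e) {a} * emeasure (IT.C 0 ?n ?u) {r \<nu>}"
      using r_sets[OF \<nu>] by (subst nn_integral_cmult_indicator) (auto simp: P_r IT.sets_C[OF u_space])
    finally have "h v * emeasure (IT.C 0 (length (\<nu> @ [a])) ?u) {r (\<nu> @ [a])}
        = emeasure (K ?e) {a} * (h v * emeasure (IT.C 0 ?n ?u) {r \<nu>})"
      by (simp add: mult_ac)
    also have "\<dots> = of_bool (awalk v \<nu> ?e) * weight \<nu> * (h ?e * emeasure (K ?e) {a})"
      unfolding snoc.IH[OF \<nu>] by (simp add: mult_ac)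
    also have "\<dots> = of_bool (awalk v (\<nu> @ [a]) (path_end v (\<nu> @ [a]))) * weight (\<nu> @ [a]) * h (path_end v (\<nu> @ [a]))"
      unfolding K_singleton[OF e a] awalk_path_end_snoc
      using a by (auto simp: path_weight_append path_weight_Cons path_end_def mult_ac)
    finally show ?case .
  qed
  let ?Q = "IT.PF.lim"
  have sets_Q: "sets ?Q = sets (PiM UNIV (\<lambda>_. ?A))" by (rule IT.PF.sets_lim)
  have space_Q: "space ?Q = (UNIV \<rightarrow> arcs G)"
    using sets_eq_imp_space_eq[OF sets_Q] by (auto simp: space_PiM PiE_def)
  have cyl_Q: "emeasure ?Q {x \<in> space ?Q. starts_with \<nu> x} = emeasure (IT.C 0 (length \<nu>) ?u) {r \<nu>}"
    if \<nu>: "\<nu> \<in> lists (arcs G)" for \<nu>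
  proof -
    have "{x \<in> space ?Q. starts_with \<nu> x} = IT.PF.emb UNIV {0..<length \<nu>} {r \<nu>}"
    proof (intro set_eqI iffI)
      fix x assume x: "x \<in> {x \<in> space ?Q. starts_with \<nu> x}"
      then have "x \<in> UNIV \<rightarrow> arcs G" unfolding space_Q by simp
      moreover have "restrict x {0..<length \<nu>} = r \<nu>"
        using x by (auto simp: r_def starts_with_nth fun_eq_iff restrict_def)
      ultimately show "x \<in> IT.PF.emb UNIV {0..<length \<nu>} {r \<nu>}"
        by (auto simp: prod_emb_def PiE_def)
    next
      fix x assume "x \<in> IT.PF.emb UNIV {0..<length \<nu>} {r \<nu>}"
      then have "x \<in> UNIV \<rightarrow> arcs G" and eq: "restrict x {0..<length \<nu>} = r \<nu>"
        by (auto simp: prod_emb_def PiE_def)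
      then have x: "x \<in> space ?Q" unfolding space_Q by simp
      have "x i = \<nu> ! i" if "i < length \<nu>" for i
        using fun_cong[OF eq, of i] that by (simp add: r_def)
      then have "map x [0..<length \<nu>] = \<nu>" by (intro nth_equalityI) auto
      with x show "x \<in> {x \<in> space ?Q. starts_with \<nu> x}" by (simp add: starts_with_iff)
    qed
    also have "emeasure ?Q \<dots> = emeasure (IT.CI {0..<length \<nu>}) {r \<nu>}"
      by (intro IT.lim r_sets \<nu>) simp
    also have "\<dots> = emeasure (IT.C 0 (length \<nu>) ?u) (IT.PF.emb {0..<length \<nu>} {0..<length \<nu>} {r \<nu>})"
      by (intro IT.emeasure_CI r_sets \<nu>) simp
    also have "IT.PF.emb {0..<length \<nu>} {0..<length \<nu>} {r \<nu>} = {r \<nu>}"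
      using r_space[OF \<nu>] by (intro prod_emb_id) (auto simp: space_PiM)
    finally show ?thesis .
  qed
  have "prob_space ?Q"
  proof (rule prob_spaceI)
    have "h v * emeasure ?Q (space ?Q) = h v"
      using law[of "[]"] cyl_Q[of "[]"] v(1) by (simp add: path_end_def awalk_Nil_iff)
    then show "emeasure ?Q (space ?Q) = 1"
      using v h[OF v(1)] by (metis ennreal_mult_cancel_left less_top mult.right_neutral)
  qed
  then show ?thesis using sets_Q law cyl_Q by (intro exI[of _ ?Q]) auto
qed

lemma harmonic_walk_le:
  assumes harm: "\<And>v. v \<in> verts G \<Longrightarrow>
      h v = (\<integral>\<^sup>+a. ennreal (exp (- \<beta> * F a)) * h (head G a) \<partial>count_space (out_arcs G v))"
    and "awalk u \<nu> v"
  shows "weight \<nu> * h v \<le> h u"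
  using assms(2)
proof (induction \<nu> arbitrary: u)
  case Nil
  then show ?case by (simp add: awalk_Nil_iff)
next
  case (Cons a \<nu>)
  then have a: "a \<in> arcs G" "u = tail G a" "awalk (head G a) \<nu> v" by (auto simp: awalk_Cons_iff)
  have "weight (a # \<nu>) * h v = ennreal (exp (- \<beta> * F a)) * (weight \<nu> * h v)"
    by (simp add: path_weight_Cons mult.assoc)
  also have "\<dots> \<le> ennreal (exp (- \<beta> * F a)) * h (head G a)" by (intro mult_left_mono Cons.IH a) simp
  also have "\<dots> \<le> (\<integral>\<^sup>+a. ennreal (exp (- \<beta> * F a)) * h (head G a) \<partial>count_space (out_arcs G u))"
    using a by (intro nn_integral_ge_point) auto
  also have "\<dots> = h u" using a by (intro harm[symmetric]) auto
  finally show ?case .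
qed

lemma starts_with_iff_nth: "starts_with \<nu> x \<longleftrightarrow> (\<forall>i<length \<nu>. x i = \<nu> ! i)"
proof
  assume "\<forall>i<length \<nu>. x i = \<nu> ! i"
  then have "map x [0..<length \<nu>] = \<nu>" by (intro nth_equalityI) auto
  then show "starts_with \<nu> x" by (simp add: starts_with_iff)
qed (simp add: starts_with_nth)

abbreviation arc_sequences :: "(nat \<Rightarrow> 'b) measure" where
  "arc_sequences \<equiv> PiM UNIV (\<lambda>_. count_space (arcs G))"

lemma space_arc_sequences: "space arc_sequences = (UNIV \<rightarrow> arcs G)"
  by (auto simp: space_PiM PiE_def)

lemma arc_sequences_nth: "{x \<in> space arc_sequences. x i = a} \<in> sets arc_sequences"
proof (cases "a \<in> arcs G")
  case True
  have "(\<lambda>x. x i) -` {a} \<inter> space arc_sequences \<in> sets arc_sequences"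
    using True by (intro measurable_sets[OF measurable_component_singleton]) auto
  also have "(\<lambda>x. x i) -` {a} \<inter> space arc_sequences = {x \<in> space arc_sequences. x i = a}" by auto
  finally show ?thesis .
next
  case False
  then have "{x \<in> space arc_sequences. x i = a} = {}" unfolding space_arc_sequences by (auto simp: Pi_iff)
  then show ?thesis by simp
qed

lemma arc_sequences_starts_with: "{x \<in> space arc_sequences. starts_with \<nu> x} \<in> sets arc_sequences"
proof -
  have "{x \<in> space arc_sequences. starts_with \<nu> x} = {x \<in> space arc_sequences. \<forall>i\<in>{..<length \<nu>}. x i = \<nu> ! i}"
    by (auto simp: starts_with_iff_nth)
  also have "\<dots> \<in> sets arc_sequences"
    by (intro sets.sets_Collect_finite_All arc_sequences_nth) simp
  finally show ?thesis .
qed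

lemma arc_sequences_inf_paths: "inf_paths G \<in> sets arc_sequences"
proof -
  have eq: "inf_paths G = (\<Inter>i. \<Union>a\<in>arcs G. \<Union>b\<in>{b \<in> arcs G. head G a = tail G b}.
      {x \<in> space arc_sequences. x i = a} \<inter> {x \<in> space arc_sequences. x (Suc i) = b})" (is "_ = ?I")
  proof (intro set_eqI iffI)
    fix x assume "x \<in> inf_paths G"
    then have "x i \<in> arcs G" "head G (x i) = tail G (x (Suc i))" for i
      by (auto simp: inf_paths_def)
    then show "x \<in> ?I" unfolding space_arc_sequences by blast
  qed (auto simp: inf_paths_def)
  have "(\<Union>a\<in>arcs G. \<Union>b\<in>{b \<in> arcs G. head G a = tail G b}.
    {x \<in> space arc_sequences. x i = a} \<inter> {x \<in> space arc_sequences. x (Suc i) = b}) \<in> sets arc_sequences" for i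
  proof (rule sets.countable_UN''[OF countable_arcs])
    fix a
    have "countable {b \<in> arcs G. head G a = tail G b}"
      by (rule countable_subset[OF _ countable_arcs]) auto
    then show "(\<Union>b\<in>{b \<in> arcs G. head G a = tail G b}.
        {x \<in> space arc_sequences. x i = a} \<inter> {x \<in> space arc_sequences. x (Suc i) = b}) \<in> sets arc_sequences"
      by (rule sets.countable_UN'') (rule sets.Int[OF arc_sequences_nth arc_sequences_nth])
  qed
  then show ?thesis unfolding eq
    by (intro sets.countable_INT'[OF countableI_type UNIV_not_empty] image_subsetI)
qed

lemma arc_sequences_to_paths:
  "(\<lambda>x. x) \<in> restrict_space arc_sequences (inf_paths G) \<rightarrow>\<^sub>M path_borel G"
proof (rule measurable_path_borelI)
  fix \<nu>
  have "(\<lambda>x. x) -` cyl \<nu> \<inter> space (restrict_space arc_sequences (inf_paths G))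
      = inf_paths G \<inter> {x \<in> space arc_sequences. starts_with \<nu> x}"
    by (auto simp: cyl_def space_restrict_space)
  then show "(\<lambda>x. x) -` cyl \<nu> \<inter> space (restrict_space arc_sequences (inf_paths G))
      \<in> sets (restrict_space arc_sequences (inf_paths G))"
    using arc_sequences_starts_with by (auto simp: sets_restrict_space)
qed (auto simp: space_restrict_space)

text \<open>
  The laws started at the vertices are added with weights \<open>h v\<close>.  They charge only
  infinite paths, since any sequence of arrows that is not a path has a prefix of probability zero.
\<close>

lemma harmonic_path_measure:
  assumes h: "\<And>v. v \<in> verts G \<Longrightarrow> h v < \<top>"
    and harm: "\<And>v. v \<in> verts G \<Longrightarrow>
      h v = (\<integral>\<^sup>+a. ennreal (exp (- \<beta> * F a)) * h (head G a) \<partial>count_space (out_arcs G v))"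
  shows "\<exists>m. sets m = sets (path_borel G) \<and>
    (\<forall>u \<nu> v. awalk u \<nu> v \<longrightarrow> \<nu> \<noteq> [] \<longrightarrow> emeasure m (cyl \<nu>) = weight \<nu> * h v)"
proof -
  let ?M = "PiM UNIV (\<lambda>_. count_space (arcs G))"
  define good where "good v Q \<longleftrightarrow> prob_space Q \<and> sets Q = sets ?M \<and>
    (\<forall>\<nu>\<in>lists (arcs G). h v * emeasure Q {x \<in> space Q. starts_with \<nu> x}
      = of_bool (awalk v \<nu> (path_end v \<nu>)) * weight \<nu> * h (path_end v \<nu>))" for v Q
  define Q where "Q v = (SOME Q. good v Q)" for v
  have good: "good v (Q v)" if "v \<in> verts G" "h v \<noteq> 0" for v
    unfolding Q_def using path_law_exists[OF h harm that] by (intro someI_ex[of "good v"]) (simp add: good_def)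
  note space_M = space_arc_sequences and sw = arc_sequences_starts_with
    and paths = arc_sequences_inf_paths and id_meas = arc_sequences_to_paths
  define R where "R v = (if h v = 0 then null_measure (path_borel G)
      else scale_measure (h v) (distr (restrict_space (Q v) (inf_paths G)) (path_borel G) (\<lambda>x. x)))" for v
  have R_sets: "sets (R v) = sets (path_borel G)" for v by (simp add: R_def)
  have R_cyl: "emeasure (R v) (cyl \<nu>) = of_bool (v = u) * (weight \<nu> * h w)"
    if v: "v \<in> verts G" and \<nu>: "awalk u \<nu> w" "\<nu> \<noteq> []" for u v w \<nu>
  proof (cases "h v = 0")
    case True
    then show ?thesis using harmonic_walk_le[OF harm \<nu>(1)] by (auto simp: R_def)
  next
    case False
    have g: "prob_space (Q v)" and sQ: "sets (Q v) = sets ?M"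
      and law: "\<And>\<nu>. \<nu> \<in> lists (arcs G) \<Longrightarrow> h v * emeasure (Q v) {x \<in> space (Q v). starts_with \<nu> x}
        = of_bool (awalk v \<nu> (path_end v \<nu>)) * weight \<nu> * h (path_end v \<nu>)"
      using good[OF v False] by (auto simp: good_def)
    have spQ: "space (Q v) = space ?M" using sets_eq_imp_space_eq[OF sQ] .
    have null: "emeasure (Q v) {x \<in> space ?M. starts_with \<rho> x} = 0"
      if "\<rho> \<in> lists (arcs G)" "\<not> awalk v \<rho> (path_end v \<rho>)" for \<rho>
      using law[OF that(1)] that(2) False by (simp add: spQ)
    have \<nu>_arcs: "\<nu> \<in> lists (arcs G)" using \<nu> by (auto simp: awalk_def)
    have meas: "(\<lambda>x. x) \<in> restrict_space (Q v) (inf_paths G) \<rightarrow>\<^sub>M path_borel G"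
      using id_meas sQ by (simp add: measurable_cong_sets[OF sets_restrict_space_cong[OF sQ] refl])
    have "emeasure (R v) (cyl \<nu>) = h v * emeasure (restrict_space (Q v) (inf_paths G)) (cyl \<nu> \<inter> space (restrict_space (Q v) (inf_paths G)))"
      using False by (simp add: R_def emeasure_distr[OF meas])
    also have "cyl \<nu> \<inter> space (restrict_space (Q v) (inf_paths G)) = inf_paths G \<inter> {x \<in> space ?M. starts_with \<nu> x}"
      by (auto simp: cyl_def space_restrict_space spQ)
    also have "emeasure (restrict_space (Q v) (inf_paths G)) \<dots> = emeasure (Q v) (inf_paths G \<inter> {x \<in> space ?M. starts_with \<nu> x})"
      using paths by (intro emeasure_restrict_space) (auto simp: sQ spQ)
    also have "\<dots> = emeasure (Q v) {x \<in> space ?M. starts_with \<nu> x}"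
    proof (rule emeasure_eq_AE)
      let ?B = "{\<rho> \<in> lists (arcs G). \<not> awalk v \<rho> (path_end v \<rho>)}"
      have "AE x in Q v. \<forall>\<rho>\<in>?B. \<not> starts_with \<rho> x"
      proof (subst AE_ball_countable)
        show "countable ?B" by (rule countable_subset[OF _ countable_lists_arcs]) auto
        show "\<forall>\<rho>\<in>?B. AE x in Q v. \<not> starts_with \<rho> x"
        proof
          fix \<rho> assume "\<rho> \<in> ?B"
          then show "AE x in Q v. \<not> starts_with \<rho> x"
            using null[of \<rho>] sw[of \<rho>] by (intro AE_I[of _ _ "{x \<in> space ?M. starts_with \<rho> x}"]) (auto simp: sQ spQ)
        qed
      qed
      moreover have "AE x in Q v. x \<in> space (Q v)" by (rule AE_space)
      ultimately show "AE x in Q v. x \<in> inf_paths G \<inter> {x \<in> space ?M. starts_with \<nu> x}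
          \<longleftrightarrow> x \<in> {x \<in> space ?M. starts_with \<nu> x}"
      proof eventually_elim
        case (elim x)
        then have arcs: "x i \<in> arcs G" for i by (auto simp: spQ space_M)
        have walk: "awalk v (map x [0..<n]) (path_end v (map x [0..<n]))" for n
        proof -
          have "map x [0..<n] \<in> lists (arcs G)" using arcs by auto
          then show ?thesis using elim(1) starts_with_prefix[of x n] by blast
        qed
        have "head G (x i) = tail G (x (Suc i))" for i
        proof -
          have "map x [0..<Suc (Suc i)] = map x [0..<Suc i] @ [x (Suc i)]" by simp
          then have "tail G (x (Suc i)) = path_end v (map x [0..<Suc i])"
            using walk[of "Suc (Suc i)"] by (simp only: awalk_path_end_snoc)
          then show ?thesis by (simp add: path_end_def)
        qed
        then have "x \<in> inf_paths G" using arcs by (auto simp: inf_paths_def)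
        then show ?case by simp
      qed
      show "inf_paths G \<inter> {x \<in> space ?M. starts_with \<nu> x} \<in> sets (Q v)" using paths sw by (auto simp: sQ)
      show "{x \<in> space ?M. starts_with \<nu> x} \<in> sets (Q v)" using sw by (auto simp: sQ)
    qed
    also have "h v * \<dots> = of_bool (awalk v \<nu> (path_end v \<nu>)) * weight \<nu> * h (path_end v \<nu>)"
      using law[OF \<nu>_arcs] by (simp add: spQ)
    also have "\<dots> = of_bool (v = u) * (weight \<nu> * h w)"
    proof -
      have "path_end v \<nu> = w" using \<nu> awalk_last_head by (auto simp: path_end_def)
      moreover have "awalk v \<nu> w \<longleftrightarrow> v = u" using \<nu> awalk_end_unique' by blast
      ultimately show ?thesis by (simp add: mult.assoc)
    qed
    finally show ?thesis .
  qed
  define m where "m = mixture (count_space (verts G)) R (path_borel G)"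
  have em: "emeasure m B = (\<integral>\<^sup>+v. emeasure (R v) B \<partial>count_space (verts G))" if "B \<in> sets (path_borel G)" for B
    unfolding m_def using that R_sets by (intro emeasure_mixture) auto
  have "emeasure m (cyl \<nu>) = weight \<nu> * h w" if \<nu>: "awalk u \<nu> w" "\<nu> \<noteq> []" for u \<nu> w
  proof -
    have u: "u \<in> verts G" using \<nu>(1) by (rule awalk_hd_in_verts)
    have "emeasure m (cyl \<nu>) = (\<integral>\<^sup>+v. of_bool (v \<in> {u}) * (weight \<nu> * h w) \<partial>count_space (verts G))"
      unfolding em[OF cyl_sets] by (intro nn_integral_cong) (use \<nu> R_cyl in auto)
    also have "\<dots> = (\<integral>\<^sup>+v. weight \<nu> * h w \<partial>count_space {u})"
      using u by (intro nn_integral_count_space_of_bool) auto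
    also have "\<dots> = weight \<nu> * h w" by (simp add: nn_integral_count_space_finite)
    finally show ?thesis .
  qed
  moreover have "sets m = sets (path_borel G)" by (simp add: m_def)
  ultimately show ?thesis by blast
qed

lemma cyl_vert_union: "cyl_vert G v = (\<Union>a\<in>out_arcs G v. cyl [a])"
proof (intro set_eqI iffI)
  fix x assume "x \<in> cyl_vert G v"
  then show "x \<in> (\<Union>a\<in>out_arcs G v. cyl [a])"
    using inf_paths_arc[of x 0] by (intro UN_I[of "x 0"]) (auto simp: cyl_vert_def cyl_def)
qed (auto simp: cyl_vert_def cyl_def)

text \<open>
  Conformality of all Borel sets follows from the cylinders: both sides of the defining equation are
  measures in the Borel set.
\<close>

lemma conformalI_cyl:
  assumes sets: "sets m = sets (path_borel G)"
    and h: "\<And>v. v \<in> verts G \<Longrightarrow> h v < \<top>"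
    and harm: "\<And>v. v \<in> verts G \<Longrightarrow>
      h v = (\<integral>\<^sup>+a. ennreal (exp (- \<beta> * F a)) * h (head G a) \<partial>count_space (out_arcs G v))"
    and cyl: "\<And>u \<nu> v. awalk u \<nu> v \<Longrightarrow> \<nu> \<noteq> [] \<Longrightarrow> emeasure m (cyl \<nu>) = weight \<nu> * h v"
    and v: "v \<in> verts G" "h v \<noteq> 0"
  shows "conformal m" "\<And>v. v \<in> verts G \<Longrightarrow> emeasure m (cyl_vert G v) = h v"
proof -
  note sets[measurable_cong]
  have sp: "space m = inf_paths G" using sets_eq_imp_space_eq[OF sets] by simp
  show vert: "emeasure m (cyl_vert G v) = h v" if v: "v \<in> verts G" for v
  proof -
    have "emeasure m (cyl_vert G v) = (\<integral>\<^sup>+a. emeasure m (cyl [a]) \<partial>count_space (out_arcs G v))"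
      unfolding cyl_vert_union
    proof (rule emeasure_UN_countable)
      show "countable (out_arcs G v)" using countable_arcs by (rule countable_subset[rotated]) auto
      show "disjoint_family_on (\<lambda>a. cyl [a]) (out_arcs G v)" by (auto simp: disjoint_family_on_def cyl_def)
    qed (simp add: sets)
    also have "\<dots> = (\<integral>\<^sup>+a. ennreal (exp (- \<beta> * F a)) * h (head G a) \<partial>count_space (out_arcs G v))"
    proof (rule nn_integral_cong)
      fix a assume "a \<in> space (count_space (out_arcs G v))"
      then have "awalk (tail G a) [a] (head G a)" by (intro arc_implies_awalk) auto
      from cyl[OF this] show "emeasure m (cyl [a]) = ennreal (exp (- \<beta> * F a)) * h (head G a)"
        by (simp add: path_weight_Cons)
    qed
    also have "\<dots> = h v" by (rule harm[OF v, symmetric])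
    finally show ?thesis .
  qed
  have arc: "emeasure m {x \<in> space m. x 0 = a \<and> shift x \<in> C}
      = ennreal (exp (- \<beta> * F a)) * emeasure m (C \<inter> cyl_vert G (head G a))"
    if a: "a \<in> arcs G" and C: "C \<in> sets (path_borel G)" for a C
  proof -
    let ?e = "ennreal (exp (- \<beta> * F a))"
    let ?L = "distr (density m (\<lambda>x. of_bool (x 0 = a))) (path_borel G) shift"
    let ?R = "density m (\<lambda>z. ?e * of_bool (tail G (z 0) = head G a))"
    note eL = emeasure_shift_density[OF sets, of _ a]
      and eR = emeasure_density_start[OF sets]
    have cyl_Cons: "emeasure ?L (cyl \<nu>) = emeasure m (cyl (a # \<nu>))" for \<nu>
      unfolding eL[OF cyl_sets] by (rule arg_cong[where f="emeasure m"]) (auto simp: sp cyl_def)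
    have "?L = ?R"
    proof (rule path_measure_eqI)
      show "sets ?L = sets (path_borel G)" "sets ?R = sets (path_borel G)" by (simp_all add: sets)
      show "emeasure ?L (cyl [b]) \<noteq> \<infinity>" for b
      proof -
        have "emeasure ?L (cyl [b]) \<le> emeasure m (cyl_vert G (tail G a))"
          unfolding cyl_Cons by (intro emeasure_mono) ((force simp: cyl_def cyl_vert_def), (simp add: sets))
        also have "\<dots> < \<top>" using a h by (simp add: vert)
        finally show ?thesis by simp
      qed
      fix u \<nu> w assume \<nu>: "awalk u \<nu> w" "\<nu> \<noteq> []"
      show "emeasure ?L (cyl \<nu>) = emeasure ?R (cyl \<nu>)"
      proof (cases "u = head G a")
        case True
        then have "awalk (tail G a) (a # \<nu>) w" using \<nu> a by (simp add: awalk_Cons_iff)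
        moreover have "cyl \<nu> \<inter> cyl_vert G (head G a) = cyl \<nu>"
          using \<nu> True starts_with_start by (auto simp: cyl_def cyl_vert_def)
        ultimately show ?thesis
          unfolding cyl_Cons eR[OF cyl_sets] using cyl[of "tail G a" "a # \<nu>" w] cyl[OF \<nu>]
          by (simp add: path_weight_Cons mult.assoc)
      next
        case False
        have "cyl (a # \<nu>) = {}"
        proof -
          have "tail G (x (Suc 0)) = head G a" "tail G (x (Suc 0)) = u" if "x \<in> cyl (a # \<nu>)" for x
            using that \<nu> starts_with_start[of \<nu> "shift x" u w] inf_paths_step[of x 0] by (auto simp: cyl_def shift_nth)
          with False show ?thesis by blast
        qed
        moreover have "cyl \<nu> \<inter> cyl_vert G (head G a) = {}"
          using \<nu> False starts_with_start by (fastforce simp: cyl_def cyl_vert_def)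
        ultimately show ?thesis unfolding cyl_Cons eR[OF cyl_sets] by simp
      qed
    qed
    then show ?thesis using eL[OF C] eR[OF C] by simp
  qed
  have "emeasure m (shift ` (B \<inter> cyl_arc G a)) = ennreal (exp (\<beta> * F a)) * emeasure m (B \<inter> cyl_arc G a)"
    if a: "a \<in> arcs G" and B: "B \<in> sets (path_borel G)" for a B
  proof -
    let ?C = "shift ` (B \<inter> cyl_arc G a)"
    have C: "?C \<in> sets (path_borel G)" by (rule shift_image_sets[OF a B])
    have inC: "shift x \<in> ?C \<longleftrightarrow> x \<in> B" if x: "x \<in> inf_paths G" "x 0 = a" for x
    proof -
      have "case_nat a (shift x) = x" using x(2) by (auto simp: fun_eq_iff shift_nth split: nat.split)
      then show ?thesis unfolding shift_image_arc[OF a] using x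
        by (auto simp: cyl_arc_def shift_nth inf_paths_step)
    qed
    have "{x \<in> space m. x 0 = a \<and> shift x \<in> ?C} = B \<inter> cyl_arc G a"
      using inC sets.sets_into_space[OF B] by (auto simp: sp cyl_arc_def)
    moreover have "?C \<inter> cyl_vert G (head G a) = ?C"
      unfolding shift_image_arc[OF a] by (auto simp: cyl_vert_def)
    ultimately have "emeasure m (B \<inter> cyl_arc G a) = ennreal (exp (- \<beta> * F a)) * emeasure m ?C"
      using arc[OF a C] by simp
    then show ?thesis
      by (simp add: mult.assoc[symmetric] ennreal_mult[symmetric] exp_add[symmetric])
  qed
  moreover have "emeasure m (space m) \<noteq> 0"
  proof -
    have "h v \<le> emeasure m (space m)"
      unfolding vert[OF v(1), symmetric] by (rule emeasure_space)
    with v(2) show ?thesis by auto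
  qed
  ultimately show "conformal m"
    using sets vert h by (auto simp: conformal_measure_def regular_borel_measure_def)
qed

end

section \<open>Almost every path wanders\<close>

lemma borel_measurable_nn_integral_countable:
  fixes f :: "'i \<Rightarrow> 'x \<Rightarrow> ennreal"
  assumes I: "countable I" and f: "\<And>i. i \<in> I \<Longrightarrow> f i \<in> borel_measurable M"
  shows "(\<lambda>x. \<integral>\<^sup>+i. f i x \<partial>count_space I) \<in> borel_measurable M"
proof (cases "finite I")
  case True
  then show ?thesis using f by (simp add: nn_integral_count_space_finite)
next
  case False
  have "(\<integral>\<^sup>+i. f i x \<partial>count_space I) = (\<Sum>n. f (from_nat_into I n) x)" for x
    unfolding nn_integral_count_space_nat[symmetric]
    by (rule nn_integral_bij_count_space[OF bij_betw_from_nat_into[OF I False], symmetric])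
  moreover have "f (from_nat_into I n) \<in> borel_measurable M" for n
    using False by (intro f from_nat_into) auto
  ultimately show ?thesis by simp
qed

context transient_digraph
begin

text \<open>
  By mass transport the expected number of visits to \<open>u\<close> is Green's function times the
  mass of \<open>u\<close>, hence finite.
\<close>

lemma visits_finite:
  assumes m: "conformal m" and v: "v \<in> verts G" and u: "u \<in> verts G"
  shows "AE x in m. tail G (x 0) = v \<longrightarrow> finite {i. tail G (x i) = u}"
proof -
  note conformal_sets[OF m, measurable_cong]
  let ?L = "lists (arcs G)"
  let ?h = "\<lambda>\<nu> z. of_bool (tail G (z 0) = u) * of_bool (awalk v \<nu> u) :: ennreal"
  let ?N = "\<lambda>x. \<integral>\<^sup>+\<nu>. of_bool (starts_with \<nu> x) * ?h \<nu> ((shift ^^ length \<nu>) x) \<partial>count_space ?L"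
  have "integral\<^sup>N m ?N
      = (\<integral>\<^sup>+z. (\<integral>\<^sup>+\<nu>. weight \<nu> * (of_bool (ends_at \<nu> (tail G (z 0))) * ?h \<nu> z) \<partial>count_space ?L) \<partial>m)"
    by (rule conformal_transport[OF m]) measurable
  also have "\<dots> = (\<integral>\<^sup>+z. green v u * indicator (cyl_vert G u) z \<partial>m)"
  proof (rule nn_integral_cong)
    fix z assume z: "z \<in> space m"
    have "(\<integral>\<^sup>+\<nu>. weight \<nu> * (of_bool (ends_at \<nu> (tail G (z 0))) * ?h \<nu> z) \<partial>count_space ?L)
        = (\<integral>\<^sup>+\<nu>. of_bool (\<nu> \<in> walks v u) * (of_bool (tail G (z 0) = u) * weight \<nu>) \<partial>count_space ?L)"
      by (intro nn_integral_cong) (auto simp: walks_def ends_at_def)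
    also have "\<dots> = of_bool (tail G (z 0) = u) * green v u"
      unfolding nn_integral_count_space_of_bool[OF walks_subset] green_weight_sum[OF v] weight_sum_def
      by (rule nn_integral_cmult) simp
    finally show "(\<integral>\<^sup>+\<nu>. weight \<nu> * (of_bool (ends_at \<nu> (tail G (z 0))) * ?h \<nu> z) \<partial>count_space ?L)
        = green v u * indicator (cyl_vert G u) z"
      using z by (simp add: conformal_space[OF m] cyl_vert_def)
  qed
  also have "\<dots> = green v u * emeasure m (cyl_vert G u)"
    by (rule nn_integral_cmult_indicator) (simp add: conformal_sets[OF m])
  also have "\<dots> < \<top>"
    using green_finite[OF v u] conformal_finite[OF m u] by (simp add: ennreal_mult_less_top)
  finally have "integral\<^sup>N m ?N \<noteq> \<infinity>" by simp
  moreover have "?N \<in> borel_measurable m"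
    by (rule borel_measurable_nn_integral_countable[OF countable_lists_arcs]) measurable
  ultimately have "AE x in m. ?N x \<noteq> \<infinity>" by (intro nn_integral_noteq_infinite) auto
  then have "AE x in m. ?N x \<noteq> \<infinity> \<and> x \<in> space m" using AE_space by eventually_elim auto
  then show ?thesis
  proof (rule AE_mp, intro AE_I2 impI)
    fix x assume x: "?N x \<noteq> \<infinity> \<and> x \<in> space m" and xv: "tail G (x 0) = v"
    have xp: "x \<in> inf_paths G" using x by (simp add: conformal_space[OF m])
    let ?I = "{i. tail G (x i) = u}"
    \<comment> \<open>Infinitely many visits would give infinitely many prefixes counted in \<open>?N x\<close>.\<close>
    let ?X = "(\<lambda>i. map x [0..<i]) ` ?I"
    have "emeasure (count_space ?L) ?X \<le> (\<integral>\<^sup>+\<nu>. indicator ?X \<nu> \<partial>count_space ?L)"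
      using inf_paths_arc[OF xp] by (subst nn_integral_indicator) auto
    also have "\<dots> \<le> ?N x"
    proof (rule nn_integral_mono)
      fix \<nu>
      have "of_bool (starts_with \<nu> x) * ?h \<nu> ((shift ^^ length \<nu>) x) = 1" if "\<nu> \<in> ?X"
      proof -
        from that obtain i where i: "tail G (x i) = u" "\<nu> = map x [0..<i]" by auto
        with inf_path_walk[OF xp, of 0 i] xv show ?thesis
          by (simp add: starts_with_prefix shift_funpow_nth)
      qed
      then show "indicator ?X \<nu> \<le> of_bool (starts_with \<nu> x) * ?h \<nu> ((shift ^^ length \<nu>) x)"
        by (cases "\<nu> \<in> ?X") simp_all
    qed
    finally have "emeasure (count_space ?L) ?X \<noteq> \<infinity>" using x by (auto simp: top_unique)
    moreover have "?X \<subseteq> ?L" using inf_paths_arc[OF xp] by auto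
    ultimately have "finite ?X" by (metis emeasure_count_space_infinite infinity_ennreal_def)
    moreover have "inj_on (\<lambda>i. map x [0..<i]) ?I"
      by (rule inj_onI) (metis length_map length_upt diff_zero)
    ultimately show "finite ?I" by (rule finite_imageD)
  qed
qed

lemma AE_wandering:
  assumes m: "conformal m"
  shows "AE x in m. x \<in> wandering G"
proof -
  have "AE x in m. \<forall>v\<in>verts G. \<forall>u\<in>verts G. tail G (x 0) = v \<longrightarrow> finite {i. tail G (x i) = u}"
    unfolding AE_ball_countable[OF countable_verts] using visits_finite[OF m] by blast
  moreover have "AE x in m. x \<in> space m" by (rule AE_space)
  ultimately show ?thesis
  proof eventually_elim
    case (elim x)
    then have x: "x \<in> inf_paths G" by (simp add: conformal_space[OF m])
    have fin: "finite {i. tail G (x i) = u}" if "u \<in> verts G" for u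
      using elim(1) that inf_paths_tail[OF x, of 0] by blast
    have "\<exists>N. \<forall>i\<ge>N. tail G (x i) \<notin> H" if H: "finite H" "H \<subseteq> verts G" for H
    proof -
      have "finite (\<Union>u\<in>H. {i. tail G (x i) = u})" using H fin by (intro finite_UN_I) auto
      then obtain N where N: "(\<Union>u\<in>H. {i. tail G (x i) = u}) \<subseteq> {..<N}"
        using finite_nat_bounded by blast
      have "tail G (x i) \<notin> H" if "N \<le> i" for i
      proof
        assume "tail G (x i) \<in> H"
        then have "i \<in> {..<N}" using N by blast
        with that show False by simp
      qed
      then show ?thesis by blast
    qed
    with x show ?case by (auto simp: wandering_def)
  qed
qed

section \<open>Quantities that depend on finitely many vertices of a ray\<close>

text \<open>
  There are countably many finite sequences of vertices, so measurability in \<open>x\<close> can be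
  checked while the relevant part of the ray is kept fixed.
\<close>

lemma measurable_vertex_local:
  fixes n :: nat
  assumes Y: "\<And>j. (\<lambda>x. tail G (Y x j)) \<in> M \<rightarrow>\<^sub>M count_space UNIV"
    and Yv: "\<And>x j. x \<in> space M \<Longrightarrow> tail G (Y x j) \<in> verts G"
    and loc: "\<And>y y' x. (\<And>j. j < n \<Longrightarrow> tail G (y j) = tail G (y' j)) \<Longrightarrow> f y x = f y' x"
    and f: "\<And>y. f y \<in> M \<rightarrow>\<^sub>M N"
  shows "(\<lambda>x. f (Y x) x) \<in> M \<rightarrow>\<^sub>M N"
proof -
  let ?X = "\<lambda>y. map (\<lambda>j. tail G (y j)) [0..<n]"
  let ?L = "{l \<in> lists (verts G). length l = n}"
  define s where "s l = (SOME y. ?X y = l)" for l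
  have "(\<lambda>x. f (s (?X (Y x))) x) \<in> M \<rightarrow>\<^sub>M N"
  proof (rule measurable_compose_countable'[where I="?L"])
    show "f (s l) \<in> M \<rightarrow>\<^sub>M N" for l by (rule f)
    show cL: "countable ?L"
      by (rule countable_subset[OF _ countable_lists[OF countable_verts]]) auto
    show "(\<lambda>x. ?X (Y x)) \<in> M \<rightarrow>\<^sub>M count_space ?L"
      unfolding measurable_count_space_eq_countable[OF cL]
    proof (intro conjI ballI)
      show "(\<lambda>x. ?X (Y x)) \<in> space M \<rightarrow> ?L" using Yv by auto
      fix l assume l: "l \<in> ?L"
      have "(\<lambda>x. ?X (Y x)) -` {l} \<inter> space M = {x \<in> space M. \<forall>j\<in>{..<n}. tail G (Y x j) = l ! j}"
      proof -
        have "?X (Y x) = l \<longleftrightarrow> (\<forall>j\<in>{..<n}. tail G (Y x j) = l ! j)" for x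
          using l by (subst list_eq_iff_nth_eq) auto
        then show ?thesis by auto
      qed
      also have "\<dots> \<in> sets M"
      proof (rule sets.sets_Collect_finite_All)
        fix j
        have "(\<lambda>x. tail G (Y x j)) -` {l ! j} \<inter> space M \<in> sets M"
          by (rule measurable_sets[OF Y]) simp
        also have "(\<lambda>x. tail G (Y x j)) -` {l ! j} \<inter> space M = {x \<in> space M. tail G (Y x j) = l ! j}"
          by auto
        finally show "{x \<in> space M. tail G (Y x j) = l ! j} \<in> sets M" .
      qed simp
      finally show "(\<lambda>x. ?X (Y x)) -` {l} \<inter> space M \<in> sets M" .
    qed
  qed
  moreover have "f (s (?X y)) x = f y x" for y x
  proof (rule loc)
    fix j assume "j < n"
    have "?X (s (?X y)) = ?X y" unfolding s_def by (rule someI[where P="\<lambda>y'. ?X y' = ?X y", OF refl])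
    from arg_cong[OF this, of "\<lambda>l. l ! j"] \<open>j < n\<close>
    show "tail G (s (?X y) j) = tail G (y j)" by simp
  qed
  ultimately show ?thesis by simp
qed

lemma ray_exit_set_local:
  "(\<And>j. j < Suc k \<Longrightarrow> tail G (y j) = tail G (y' j)) \<Longrightarrow> ray_exit_set G y k = ray_exit_set G y' k"
  by (simp add: ray_exit_set_def)

lemma ray_link_paths_local:
  "(\<And>j. j < Suc (Suc k) \<Longrightarrow> tail G (y j) = tail G (y' j)) \<Longrightarrow> ray_link_paths G y k = ray_link_paths G y' k"
  by (simp add: ray_link_paths_def)

lemma link_local:
  "(\<And>j. j < Suc (Suc k) \<Longrightarrow> tail G (y j) = tail G (y' j)) \<Longrightarrow> link y k = link y' k"
  unfolding link_def by (simp add: ray_link_paths_local[of k y y'])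

lemma rweight_local:
  "(\<And>j. j < Suc k \<Longrightarrow> tail G (y j) = tail G (y' j)) \<Longrightarrow> rweight y k = rweight y' k"
proof (induction k)
  case (Suc k)
  then have "link y k = link y' k" by (intro link_local) simp
  with Suc show ?case by (simp add: rweight_Suc)
qed simp

lemma kernel_local:
  "(\<And>j. j < Suc k \<Longrightarrow> tail G (y j) = tail G (y' j)) \<Longrightarrow> kernel k v y = kernel k v y'"
  unfolding kernel_def using rweight_local[of k y y'] by simp

section \<open>Conformal measures as seen from a field of rays\<close>

text \<open>
  A field of rays attaches to each path \<open>x\<close> a ray \<open>Y x\<close> that does not change under the shift.  Only
  paths in an invariant set \<open>D\<close> need to get a ray.
\<close>

definition ray_field :: "(nat \<Rightarrow> 'b) set \<Rightarrow> ((nat \<Rightarrow> 'b) \<Rightarrow> (nat \<Rightarrow> 'b)) \<Rightarrow> bool" where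
  "ray_field D Y \<longleftrightarrow>
    D \<in> sets (path_borel G) \<and> (\<forall>x\<in>inf_paths G. shift x \<in> D \<longleftrightarrow> x \<in> D) \<and>
    (\<forall>j. (\<lambda>x. tail G (Y x j)) \<in> path_borel G \<rightarrow>\<^sub>M count_space UNIV) \<and>
    (\<forall>x\<in>inf_paths G. \<forall>j. tail G (Y x j) \<in> verts G) \<and>
    (\<forall>x\<in>inf_paths G. Y (shift x) = Y x) \<and> (\<forall>x\<in>D. Y x \<in> rays G)"

definition invariant :: "((nat \<Rightarrow> 'b) \<Rightarrow> ennreal) \<Rightarrow> bool" where
  "invariant g \<longleftrightarrow> g \<in> borel_measurable (path_borel G) \<and> (\<forall>x\<in>inf_paths G. g (shift x) = g x)"

lemma shift_funpow_invariant:
  assumes "\<And>x. x \<in> inf_paths G \<Longrightarrow> f (shift x) = f x" "x \<in> inf_paths G"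
  shows "f ((shift ^^ n) x) = f x"
  using assms by (induction n) (auto simp: shift_funpow_inf_paths)

context
  fixes D Y
  assumes field: "ray_field D Y"
begin

lemma field_sets [measurable]: "D \<in> sets (path_borel G)"
  and field_rays: "x \<in> D \<Longrightarrow> Y x \<in> rays G"
  and field_measurable: "(\<lambda>x. tail G (Y x j)) \<in> path_borel G \<rightarrow>\<^sub>M count_space UNIV"
  and field_verts: "x \<in> inf_paths G \<Longrightarrow> tail G (Y x j) \<in> verts G"
  using field unfolding ray_field_def by blast+

lemma field_inf_paths: "x \<in> D \<Longrightarrow> x \<in> inf_paths G"
  using sets.sets_into_space[OF field_sets] by auto

lemma field_shift: "x \<in> inf_paths G \<Longrightarrow> Y ((shift ^^ n) x) = Y x"
  using field unfolding ray_field_def by (intro shift_funpow_invariant) blast+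

lemma field_D_shift: "x \<in> inf_paths G \<Longrightarrow> (shift ^^ n) x \<in> D \<longleftrightarrow> x \<in> D"
  using field unfolding ray_field_def by (intro shift_funpow_invariant[where f="\<lambda>x. x \<in> D"]) blast+

lemma field_local:
  fixes n :: nat
  assumes "\<And>y y' x. (\<And>j. j < n \<Longrightarrow> tail G (y j) = tail G (y' j)) \<Longrightarrow> f y x = f y' x"
    and "\<And>y. f y \<in> path_borel G \<rightarrow>\<^sub>M N"
  shows "(\<lambda>x. f (Y x) x) \<in> path_borel G \<rightarrow>\<^sub>M N"
proof (rule measurable_vertex_local[where n=n])
  show "f y x = f y' x" if "\<And>j. j < n \<Longrightarrow> tail G (y j) = tail G (y' j)" for y y' x
    by (rule assms(1)[OF that])
qed (simp_all add: field_measurable field_verts assms(2))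

lemma field_exit [measurable]:
  "Measurable.pred (path_borel G) (\<lambda>x. (shift ^^ i) x \<in> ray_exit_set G (Y x) k)"
proof (rule field_local[where f="\<lambda>y x. (shift ^^ i) x \<in> ray_exit_set G y k" and n="Suc k"])
  show "Measurable.pred (path_borel G) (\<lambda>x. (shift ^^ i) x \<in> ray_exit_set G y k)" for y
    by measurable
  show "(shift ^^ i) x \<in> ray_exit_set G y k \<longleftrightarrow> (shift ^^ i) x \<in> ray_exit_set G y' k"
    if "\<And>j. j < Suc k \<Longrightarrow> tail G (y j) = tail G (y' j)" for y y' x
    using ray_exit_set_local[of k y y'] that by simp
qed

lemma field_exit0 [measurable]:
  "Measurable.pred (path_borel G) (\<lambda>x. x \<in> ray_exit_set G (Y x) k)"
  using field_exit[of 0 k] by simp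

lemma field_follows [measurable]: "Measurable.pred (path_borel G) (\<lambda>x. follows_from (Y x) k x)"
proof -
  have "(\<lambda>x. follows_from (Y x) k x)
      = (\<lambda>x. \<forall>j. k \<le> j \<longrightarrow> (\<exists>i. (shift ^^ i) x \<in> ray_exit_set G (Y x) j))"
    by (auto simp: follows_from_def)
  also have "Measurable.pred (path_borel G) \<dots>" by measurable
  finally show ?thesis .
qed

lemma field_link_paths [measurable]:
  "Measurable.pred (path_borel G) (\<lambda>x. \<nu> \<in> ray_link_paths G (Y x) k)"
proof (rule field_local[where f="\<lambda>y x. \<nu> \<in> ray_link_paths G y k" and n="Suc (Suc k)"])
  show "\<nu> \<in> ray_link_paths G y k \<longleftrightarrow> \<nu> \<in> ray_link_paths G y' k"
    if "\<And>j. j < Suc (Suc k) \<Longrightarrow> tail G (y j) = tail G (y' j)" for y y'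
    using ray_link_paths_local[of k y y'] that by simp
qed simp

lemma field_rweight [measurable]: "(\<lambda>x. rweight (Y x) k) \<in> borel_measurable (path_borel G)"
  by (rule field_local[where f="\<lambda>y x. rweight y k" and n="Suc k"]) (auto intro: rweight_local)

lemma field_kernel [measurable]: "(\<lambda>x. kernel k v (Y x)) \<in> borel_measurable (path_borel G)"
  by (rule field_local[where f="\<lambda>y x. kernel k v y" and n="Suc k"]) (auto intro: kernel_local)

text \<open>A path passes the exit of a given number at most once, so it has at most one prefix ending there.\<close>

lemma exit_prefix_sum:
  assumes x: "x \<in> inf_paths G"
    and S: "\<And>z. z \<in> S \<Longrightarrow> z \<in> ray_exit_set G (Y z) k"
  shows "(\<integral>\<^sup>+\<nu>. of_bool (starts_with \<nu> x) * (of_bool ((shift ^^ length \<nu>) x \<in> S) * of_bool (P \<nu>) * c)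
      \<partial>count_space (lists (arcs G)))
    = of_bool (\<exists>i. (shift ^^ i) x \<in> S \<and> P (map x [0..<i])) * (c :: ennreal)"
proof -
  let ?P = "\<lambda>\<nu>. starts_with \<nu> x \<and> (shift ^^ length \<nu>) x \<in> S \<and> P \<nu>"
  have "(\<integral>\<^sup>+\<nu>. of_bool (starts_with \<nu> x) * (of_bool ((shift ^^ length \<nu>) x \<in> S) * of_bool (P \<nu>) * c)
      \<partial>count_space (lists (arcs G))) = (\<integral>\<^sup>+\<nu>. of_bool (?P \<nu>) * c \<partial>count_space (lists (arcs G)))"
    by (intro nn_integral_cong) auto
  also have "\<dots> = (\<integral>\<^sup>+\<nu>. of_bool (?P \<nu>) \<partial>count_space (lists (arcs G))) * c"
    by (rule nn_integral_multc) simp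
  also have "(\<integral>\<^sup>+\<nu>. of_bool (?P \<nu>) \<partial>count_space (lists (arcs G))) = of_bool (\<exists>\<nu>\<in>lists (arcs G). ?P \<nu>)"
  proof (rule of_bool_Bex_eq_nn_integral[symmetric])
    fix \<mu> \<nu> assume \<mu>: "?P \<mu>" and \<nu>: "?P \<nu>"
    have "(shift ^^ length \<mu>) x \<in> ray_exit_set G (Y x) k" "(shift ^^ length \<nu>) x \<in> ray_exit_set G (Y x) k"
      using \<mu> \<nu> S field_shift[OF x] by metis+
    then have "length \<mu> = length \<nu>" using ray_exit_time_unique[OF x] by blast
    with \<mu> \<nu> show "\<mu> = \<nu>" by (metis starts_with_iff)
  qed
  also have "(\<exists>\<nu>\<in>lists (arcs G). ?P \<nu>) \<longleftrightarrow> (\<exists>i. (shift ^^ i) x \<in> S \<and> P (map x [0..<i]))"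
  proof
    assume "\<exists>\<nu>\<in>lists (arcs G). ?P \<nu>"
    then show "\<exists>i. (shift ^^ i) x \<in> S \<and> P (map x [0..<i])" by (metis starts_with_iff)
  next
    assume "\<exists>i. (shift ^^ i) x \<in> S \<and> P (map x [0..<i])"
    then obtain i where "(shift ^^ i) x \<in> S" "P (map x [0..<i])" by blast
    then show "\<exists>\<nu>\<in>lists (arcs G). ?P \<nu>"
      using inf_paths_arc[OF x] by (intro bexI[of _ "map x [0..<i]"]) (auto simp: starts_with_prefix)
  qed
  finally show ?thesis .
qed

text \<open>Green's function counts how a path starting at \<open>v\<close> gets to its \<open>k\<close>-th exit.\<close>

lemma transport_green:
  assumes m: "conformal m" and v: "v \<in> verts G"
    and S [measurable]: "S \<in> sets (path_borel G)"
    and exit: "\<And>z. z \<in> S \<Longrightarrow> z \<in> ray_exit_set G (Y z) k"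
    and g: "invariant g"
  shows "(\<integral>\<^sup>+x. of_bool (tail G (x 0) = v \<and> (\<exists>i. (shift ^^ i) x \<in> S)) * g x \<partial>m)
    = (\<integral>\<^sup>+z. of_bool (z \<in> S) * (green v (tail G (Y z k)) * g z) \<partial>m)"
proof -
  have gm [measurable]: "g \<in> borel_measurable (path_borel G)" using g by (simp add: invariant_def)
  let ?L = "lists (arcs G)"
  let ?h = "\<lambda>\<nu> z. of_bool (z \<in> S) * of_bool (awalk v \<nu> (tail G (z 0))) * g z"
  have "(\<integral>\<^sup>+x. of_bool (tail G (x 0) = v \<and> (\<exists>i. (shift ^^ i) x \<in> S)) * g x \<partial>m)
      = (\<integral>\<^sup>+x. (\<integral>\<^sup>+\<nu>. of_bool (starts_with \<nu> x) * ?h \<nu> ((shift ^^ length \<nu>) x) \<partial>count_space ?L) \<partial>m)"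
  proof (rule nn_integral_cong)
    fix x assume "x \<in> space m"
    then have x: "x \<in> inf_paths G" by (simp add: conformal_space[OF m])
    have gx: "g ((shift ^^ n) x) = g x" for n
      using g x by (intro shift_funpow_invariant) (auto simp: invariant_def)
    have walk: "awalk v (map x [0..<i]) (tail G (x i)) \<longleftrightarrow> tail G (x 0) = v" for i
    proof
      assume aw: "awalk v (map x [0..<i]) (tail G (x i))"
      show "tail G (x 0) = v"
      proof (cases "i = 0")
        case True
        with aw show ?thesis by (simp add: awalk_Nil_iff)
      next
        case False
        with aw starts_with_start[OF starts_with_prefix aw] show ?thesis by simp
      qed
    qed (use inf_path_walk[OF x, of 0 i] in simp)
    have "(\<integral>\<^sup>+\<nu>. of_bool (starts_with \<nu> x) * ?h \<nu> ((shift ^^ length \<nu>) x) \<partial>count_space ?L)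
        = (\<integral>\<^sup>+\<nu>. of_bool (starts_with \<nu> x) * (of_bool ((shift ^^ length \<nu>) x \<in> S)
            * of_bool (awalk v \<nu> (tail G (x (length \<nu>)))) * g x) \<partial>count_space ?L)"
      by (simp add: gx shift_funpow_nth)
    also have "\<dots> = of_bool (\<exists>i. (shift ^^ i) x \<in> S \<and> awalk v (map x [0..<i]) (tail G (x (length (map x [0..<i]))))) * g x"
      by (rule exit_prefix_sum[OF x exit])
    also have "\<dots> = of_bool (tail G (x 0) = v \<and> (\<exists>i. (shift ^^ i) x \<in> S)) * g x"
      using walk by auto
    finally show "of_bool (tail G (x 0) = v \<and> (\<exists>i. (shift ^^ i) x \<in> S)) * g x
      = (\<integral>\<^sup>+\<nu>. of_bool (starts_with \<nu> x) * ?h \<nu> ((shift ^^ length \<nu>) x) \<partial>count_space ?L)" ..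
  qed
  also have "\<dots> = (\<integral>\<^sup>+z. (\<integral>\<^sup>+\<nu>. weight \<nu> * (of_bool (ends_at \<nu> (tail G (z 0))) * ?h \<nu> z) \<partial>count_space ?L) \<partial>m)"
    by (rule conformal_transport[OF m]) measurable
  also have "\<dots> = (\<integral>\<^sup>+z. of_bool (z \<in> S) * (green v (tail G (Y z k)) * g z) \<partial>m)"
  proof (rule nn_integral_cong)
    fix z
    have "(\<integral>\<^sup>+\<nu>. weight \<nu> * (of_bool (ends_at \<nu> (tail G (z 0))) * ?h \<nu> z) \<partial>count_space ?L)
        = (\<integral>\<^sup>+\<nu>. of_bool (\<nu> \<in> walks v (tail G (z 0))) * ((of_bool (z \<in> S) * g z) * weight \<nu>) \<partial>count_space ?L)"
      by (intro nn_integral_cong) (auto simp: walks_def ends_at_def mult_ac)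
    also have "\<dots> = (of_bool (z \<in> S) * g z) * green v (tail G (z 0))"
      unfolding nn_integral_count_space_of_bool[OF walks_subset] green_weight_sum[OF v] weight_sum_def
      by (rule nn_integral_cmult) simp
    also have "\<dots> = of_bool (z \<in> S) * (green v (tail G (Y z k)) * g z)"
      using exit[of z] by (cases "z \<in> S") (auto simp: ray_exit_set_0 mult_ac)
    finally show "(\<integral>\<^sup>+\<nu>. weight \<nu> * (of_bool (ends_at \<nu> (tail G (z 0))) * ?h \<nu> z) \<partial>count_space ?L)
        = of_bool (z \<in> S) * (green v (tail G (Y z k)) * g z)" .
  qed
  finally show ?thesis .
qed

text \<open>Between two consecutive exits a path runs along a link.\<close>

lemma transport_link:
  assumes m: "conformal m"
    and S [measurable]: "S \<in> sets (path_borel G)"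
    and exit: "\<And>z. z \<in> S \<Longrightarrow> Y z \<in> rays G \<and> z \<in> ray_exit_set G (Y z) (Suc k)"
    and g: "invariant g"
  shows "(\<integral>\<^sup>+x. of_bool (x \<in> ray_exit_set G (Y x) k \<and> (\<exists>i. (shift ^^ i) x \<in> S)) * g x \<partial>m)
    = (\<integral>\<^sup>+z. of_bool (z \<in> S) * (link (Y z) k * g z) \<partial>m)"
proof -
  have gm [measurable]: "g \<in> borel_measurable (path_borel G)" using g by (simp add: invariant_def)
  let ?L = "lists (arcs G)"
  let ?h = "\<lambda>\<nu> z. of_bool (z \<in> S) * of_bool (\<nu> \<in> ray_link_paths G (Y z) k) * g z"
  have "(\<integral>\<^sup>+x. of_bool (x \<in> ray_exit_set G (Y x) k \<and> (\<exists>i. (shift ^^ i) x \<in> S)) * g x \<partial>m)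
      = (\<integral>\<^sup>+x. (\<integral>\<^sup>+\<nu>. of_bool (starts_with \<nu> x) * ?h \<nu> ((shift ^^ length \<nu>) x) \<partial>count_space ?L) \<partial>m)"
  proof (rule nn_integral_cong)
    fix x assume "x \<in> space m"
    then have x: "x \<in> inf_paths G" by (simp add: conformal_space[OF m])
    have gx: "g ((shift ^^ n) x) = g x" for n
      using g x by (intro shift_funpow_invariant) (auto simp: invariant_def)
    let ?y = "Y x"
    have iff: "(\<exists>i. (shift ^^ i) x \<in> S \<and> map x [0..<i] \<in> ray_link_paths G ?y k)
        \<longleftrightarrow> x \<in> ray_exit_set G ?y k \<and> (\<exists>i. (shift ^^ i) x \<in> S)"
    proof -
      have "map x [0..<i] \<in> ray_link_paths G ?y k \<longleftrightarrow> x \<in> ray_exit_set G ?y k"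
        if i: "(shift ^^ i) x \<in> S" for i
      proof -
        have y: "?y \<in> rays G" and ex: "(shift ^^ i) x \<in> ray_exit_set G ?y (Suc k)"
          using exit[OF i] by (simp_all add: field_shift[OF x])
        have xi: "tail G (x i) = tail G (?y (Suc k))"
          and av: "\<And>n l. n > i \<Longrightarrow> l \<le> Suc k \<Longrightarrow> tail G (x n) \<noteq> tail G (?y l)"
          using ex by (auto simp: ray_exit_set_shift[OF x])
        have aw: "awalk (tail G (x 0)) (map x [0..<i]) (tail G (x i))"
          using inf_path_walk[OF x, of 0 i] by simp
        show ?thesis
        proof
          assume l: "map x [0..<i] \<in> ray_link_paths G ?y k"
          then have "tail G (x 0) = tail G (?y k)"
            using starts_with_start[OF starts_with_prefix[of x i]] by (auto simp: ray_link_paths_def)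
          moreover have "tail G (x n) \<noteq> tail G (?y l)" if "0 < n" "l \<le> k" for n l
          proof (cases "i < n")
            case True
            then show ?thesis using av[of n l] that by simp
          next
            case False
            then have "x (n - 1) \<in> set (map x [0..<i])" using that by auto
            then have "head G (x (n - 1)) \<notin> (\<lambda>i. tail G (?y i)) ` {..k}"
              using l by (auto simp: ray_link_paths_def)
            moreover have "head G (x (n - 1)) = tail G (x n)"
              using inf_paths_step[OF x, of "n - 1"] that by simp
            ultimately show ?thesis using that by auto
          qed
          ultimately show "x \<in> ray_exit_set G ?y k" using x by (auto simp: ray_exit_set_0)
        next
          assume e: "x \<in> ray_exit_set G ?y k"
          then have x0: "tail G (x 0) = tail G (?y k)"
            and av0: "\<And>n l. 0 < n \<Longrightarrow> l \<le> k \<Longrightarrow> tail G (x n) \<noteq> tail G (?y l)"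
            by (auto simp: ray_exit_set_0)
          have "i \<noteq> 0" using x0 xi rays_inj[OF y, of k "Suc k"] by (cases i) auto
          moreover have "head G a \<notin> (\<lambda>i. tail G (?y i)) ` {..k}" if a: "a \<in> set (map x [0..<i])" for a
          proof -
            obtain n where "a = x n" using a by auto
            then have "head G a = tail G (x (Suc n))" using inf_paths_step[OF x, of n] by simp
            then show ?thesis using av0[of "Suc n"] by auto
          qed
          ultimately show "map x [0..<i] \<in> ray_link_paths G ?y k"
            using aw x0 xi by (auto simp: ray_link_paths_def)
        qed
      qed
      then show ?thesis by auto
    qed
    have "(\<integral>\<^sup>+\<nu>. of_bool (starts_with \<nu> x) * ?h \<nu> ((shift ^^ length \<nu>) x) \<partial>count_space ?L)
        = (\<integral>\<^sup>+\<nu>. of_bool (starts_with \<nu> x) * (of_bool ((shift ^^ length \<nu>) x \<in> S)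
            * of_bool (\<nu> \<in> ray_link_paths G ?y k) * g x) \<partial>count_space ?L)"
      by (simp add: gx field_shift[OF x])
    also have "\<dots> = of_bool (\<exists>i. (shift ^^ i) x \<in> S \<and> map x [0..<i] \<in> ray_link_paths G ?y k) * g x"
      using exit by (intro exit_prefix_sum[OF x, where k="Suc k"]) auto
    finally show "of_bool (x \<in> ray_exit_set G ?y k \<and> (\<exists>i. (shift ^^ i) x \<in> S)) * g x
      = (\<integral>\<^sup>+\<nu>. of_bool (starts_with \<nu> x) * ?h \<nu> ((shift ^^ length \<nu>) x) \<partial>count_space ?L)"
      unfolding iff ..
  qed
  also have "\<dots> = (\<integral>\<^sup>+z. (\<integral>\<^sup>+\<nu>. weight \<nu> * (of_bool (ends_at \<nu> (tail G (z 0))) * ?h \<nu> z) \<partial>count_space ?L) \<partial>m)"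
    by (rule conformal_transport[OF m]) measurable
  also have "\<dots> = (\<integral>\<^sup>+z. of_bool (z \<in> S) * (link (Y z) k * g z) \<partial>m)"
  proof (rule nn_integral_cong)
    fix z
    have sub: "ray_link_paths G (Y z) k \<subseteq> ?L"
      using ray_link_paths_subset walks_subset by (rule subset_trans)
    have "(\<integral>\<^sup>+\<nu>. weight \<nu> * (of_bool (ends_at \<nu> (tail G (z 0))) * ?h \<nu> z) \<partial>count_space ?L)
        = (\<integral>\<^sup>+\<nu>. of_bool (\<nu> \<in> ray_link_paths G (Y z) k) * ((of_bool (z \<in> S) * g z) * weight \<nu>) \<partial>count_space ?L)"
    proof (rule nn_integral_cong)
      fix \<nu>
      have "ends_at \<nu> (tail G (z 0))" if "z \<in> S" "\<nu> \<in> ray_link_paths G (Y z) k"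
        using that exit[OF that(1)] by (auto simp: ends_at_def ray_link_paths_def ray_exit_set_0)
      then show "weight \<nu> * (of_bool (ends_at \<nu> (tail G (z 0))) * ?h \<nu> z)
          = of_bool (\<nu> \<in> ray_link_paths G (Y z) k) * ((of_bool (z \<in> S) * g z) * weight \<nu>)"
        by (auto simp: mult_ac)
    qed
    also have "\<dots> = (of_bool (z \<in> S) * g z) * link (Y z) k"
      unfolding nn_integral_count_space_of_bool[OF sub] link_def weight_sum_def
      by (rule nn_integral_cmult) simp
    also have "\<dots> = of_bool (z \<in> S) * (link (Y z) k * g z)" by (simp add: mult_ac)
    finally show "(\<integral>\<^sup>+\<nu>. weight \<nu> * (of_bool (ends_at \<nu> (tail G (z 0))) * ?h \<nu> z) \<partial>count_space ?L)
        = of_bool (z \<in> S) * (link (Y z) k * g z)" .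
  qed
  finally show ?thesis .
qed

definition exit_follow :: "nat \<Rightarrow> (nat \<Rightarrow> 'b) set" where
  "exit_follow k = {x \<in> D. x \<in> ray_exit_set G (Y x) k \<and> follows_from (Y x) k x}"

lemma exit_follow_sets [measurable]: "exit_follow k \<in> sets (path_borel G)"
proof -
  have "exit_follow k = {x \<in> space (path_borel G). x \<in> D \<and> x \<in> ray_exit_set G (Y x) k \<and> follows_from (Y x) k x}"
    using field_inf_paths by (auto simp: exit_follow_def)
  also have "\<dots> \<in> sets (path_borel G)" by measurable
  finally show ?thesis .
qed

text \<open>Cutting a path at its \<open>k\<close>-th exit does not affect the later exits.\<close>

lemma exit_follow_iff:
  assumes x: "x \<in> inf_paths G"
  shows "(\<exists>i. (shift ^^ i) x \<in> exit_follow k) \<longleftrightarrow> x \<in> D \<and> follows_from (Y x) k x"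
proof
  assume "\<exists>i. (shift ^^ i) x \<in> exit_follow k"
  then show "x \<in> D \<and> follows_from (Y x) k x"
    using follows_from_unshift by (auto simp: exit_follow_def field_shift[OF x] field_D_shift[OF x])
next
  assume f: "x \<in> D \<and> follows_from (Y x) k x"
  then obtain i where i: "(shift ^^ i) x \<in> ray_exit_set G (Y x) k"
    unfolding follows_from_def by blast
  have "follows_from (Y x) k ((shift ^^ i) x)"
    unfolding follows_from_def
  proof (intro allI impI)
    fix j assume j: "k \<le> j"
    then obtain n where n: "(shift ^^ n) x \<in> ray_exit_set G (Y x) j"
      using f unfolding follows_from_def by blast
    have "i \<le> n" by (rule ray_exit_time_mono[OF x i n j])
    then have "(shift ^^ (n - i)) ((shift ^^ i) x) = (shift ^^ n) x" by (simp add: shift_funpow_add)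
    with n show "\<exists>n. (shift ^^ n) ((shift ^^ i) x) \<in> ray_exit_set G (Y x) j" by metis
  qed
  with i f have "(shift ^^ i) x \<in> exit_follow k"
    by (simp add: exit_follow_def field_shift[OF x] field_D_shift[OF x])
  then show "\<exists>i. (shift ^^ i) x \<in> exit_follow k" ..
qed

lemma exit_follow_Suc:
  assumes x: "x \<in> inf_paths G"
  shows "x \<in> exit_follow k \<longleftrightarrow> x \<in> ray_exit_set G (Y x) k \<and> (\<exists>i. (shift ^^ i) x \<in> exit_follow (Suc k))"
proof -
  have "follows_from (Y x) k x \<longleftrightarrow> follows_from (Y x) (Suc k) x" if e: "x \<in> ray_exit_set G (Y x) k"
  proof
    assume f: "follows_from (Y x) (Suc k) x"
    show "follows_from (Y x) k x" unfolding follows_from_def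
    proof (intro allI impI)
      fix j assume "k \<le> j"
      then consider "j = k" | "Suc k \<le> j" by linarith
      then show "\<exists>i. (shift ^^ i) x \<in> ray_exit_set G (Y x) j"
      proof cases
        case 1
        with e show ?thesis by (intro exI[of _ 0]) simp
      next
        case 2
        with f show ?thesis by (auto simp: follows_from_def)
      qed
    qed
  qed (auto elim: follows_from_mono)
  then show ?thesis unfolding exit_follow_iff[OF x] by (auto simp: exit_follow_def)
qed

text \<open>
  Iterating \<open>transport_link\<close>: the weights of the successive links multiply up to
  \<open>ray_weight\<close>.
\<close>

lemma transport_rweight:
  assumes m: "conformal m" and g: "invariant g"
  shows "(\<integral>\<^sup>+x. of_bool (x \<in> exit_follow 0) * g x \<partial>m)
    = (\<integral>\<^sup>+x. of_bool (x \<in> exit_follow k) * (rweight (Y x) k * g x) \<partial>m)"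
proof (induction k)
  case (Suc k)
  let ?g = "\<lambda>x. rweight (Y x) k * g x"
  have inv: "invariant ?g"
    using g field by (auto simp: invariant_def ray_field_def intro!: borel_measurable_times_ennreal field_rweight)
  note Suc.IH
  also have "(\<integral>\<^sup>+x. of_bool (x \<in> exit_follow k) * ?g x \<partial>m)
      = (\<integral>\<^sup>+x. of_bool (x \<in> ray_exit_set G (Y x) k \<and> (\<exists>i. (shift ^^ i) x \<in> exit_follow (Suc k))) * ?g x \<partial>m)"
    by (intro nn_integral_cong) (simp add: exit_follow_Suc conformal_space[OF m])
  also have "\<dots> = (\<integral>\<^sup>+x. of_bool (x \<in> exit_follow (Suc k)) * (link (Y x) k * ?g x) \<partial>m)"
    using field_rays by (intro transport_link[OF m exit_follow_sets _ inv]) (auto simp: exit_follow_def)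
  also have "\<dots> = (\<integral>\<^sup>+x. of_bool (x \<in> exit_follow (Suc k)) * (rweight (Y x) (Suc k) * g x) \<partial>m)"
    by (simp add: rweight_Suc mult_ac)
  finally show ?case .
qed simp

text \<open>
  Combine \<open>transport_green\<close> with \<open>transport_rweight\<close>, applied to
  \<open>g\<close> times the kernel, which is again invariant.
\<close>

lemma transport_kernel:
  assumes m: "conformal m" and v: "v \<in> verts G" and g: "invariant g"
  shows "(\<integral>\<^sup>+x. of_bool (tail G (x 0) = v \<and> x \<in> D \<and> follows_from (Y x) k x) * g x \<partial>m)
    = (\<integral>\<^sup>+x. of_bool (x \<in> exit_follow 0) * (kernel k v (Y x) * g x) \<partial>m)"
proof -
  have inv: "invariant (\<lambda>x. kernel k v (Y x) * g x)"
    using g field by (auto simp: invariant_def ray_field_def intro!: borel_measurable_times_ennreal field_kernel)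
  have "(\<integral>\<^sup>+x. of_bool (tail G (x 0) = v \<and> x \<in> D \<and> follows_from (Y x) k x) * g x \<partial>m)
      = (\<integral>\<^sup>+x. of_bool (tail G (x 0) = v \<and> (\<exists>i. (shift ^^ i) x \<in> exit_follow k)) * g x \<partial>m)"
    by (intro nn_integral_cong) (simp add: exit_follow_iff conformal_space[OF m])
  also have "\<dots> = (\<integral>\<^sup>+x. of_bool (x \<in> exit_follow k) * (green v (tail G (Y x k)) * g x) \<partial>m)"
    by (rule transport_green[OF m v exit_follow_sets _ g]) (simp add: exit_follow_def)
  also have "\<dots> = (\<integral>\<^sup>+x. of_bool (x \<in> exit_follow k) * (rweight (Y x) k * (kernel k v (Y x) * g x)) \<partial>m)"
  proof (rule nn_integral_cong)
    fix x
    have "rweight (Y x) k * (kernel k v (Y x) * g x) = green v (tail G (Y x k)) * g x" if "x \<in> exit_follow k"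
    proof -
      have y: "Y x \<in> rays G" using that field_rays by (simp add: exit_follow_def)
      have "rweight (Y x) k * (kernel k v (Y x) * g x)
          = (inverse (rweight (Y x) k) * rweight (Y x) k) * (green v (tail G (Y x k)) * g x)"
        by (simp only: kernel_def mult_ac)
      also have "inverse (rweight (Y x) k) * rweight (Y x) k = 1"
        by (rule ennreal_inverse_mult_self[OF rweight_pos[OF y] rweight_finite[OF y]])
      finally show ?thesis by simp
    qed
    then show "of_bool (x \<in> exit_follow k) * (green v (tail G (Y x k)) * g x)
        = of_bool (x \<in> exit_follow k) * (rweight (Y x) k * (kernel k v (Y x) * g x))" by simp
  qed
  also have "\<dots> = (\<integral>\<^sup>+x. of_bool (x \<in> exit_follow 0) * (kernel k v (Y x) * g x) \<partial>m)"
    by (rule transport_rweight[OF m inv, symmetric])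
  finally show ?thesis .
qed

text \<open>
  The limit of \<open>transport_kernel\<close>, by monotone convergence on both sides: the integral of an invariant
  function over the paths from \<open>v\<close> is an integral of the Martin kernel over the paths that pass every exit
  of their ray, starting at its first vertex.
\<close>

theorem ray_field_formula:
  assumes m: "conformal m" and v: "v \<in> verts G" and g: "invariant g"
  shows "(\<integral>\<^sup>+x. of_bool (tail G (x 0) = v \<and> x \<in> D \<and> x \<in> ray_basin G (Y x)) * g x \<partial>m)
    = (\<integral>\<^sup>+x. of_bool (x \<in> exit_follow 0) * (potential v (Y x) * g x) \<partial>m)"
proof -
  note conformal_sets[OF m, measurable_cong]
  have gm [measurable]: "g \<in> borel_measurable (path_borel G)" using g by (simp add: invariant_def)
  let ?a = "\<lambda>k x. of_bool (tail G (x 0) = v \<and> x \<in> D \<and> follows_from (Y x) k x) * g x"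
  let ?b = "\<lambda>k x. of_bool (x \<in> exit_follow 0) * (kernel k v (Y x) * g x)"
  have "(\<integral>\<^sup>+x. of_bool (tail G (x 0) = v \<and> x \<in> D \<and> x \<in> ray_basin G (Y x)) * g x \<partial>m)
      = (\<integral>\<^sup>+x. (SUP k. ?a k x) \<partial>m)"
  proof (rule nn_integral_cong)
    fix x
    have "of_bool (tail G (x 0) = v \<and> x \<in> D \<and> x \<in> ray_basin G (Y x)) * g x \<le> (SUP k. ?a k x)"
    proof (cases "tail G (x 0) = v \<and> x \<in> D \<and> x \<in> ray_basin G (Y x)")
      case True
      then obtain k where "follows_from (Y x) k x" using ray_basin_iff[OF field_rays] by blast
      with True show ?thesis by (intro SUP_upper2[of k]) auto
    qed auto
    moreover have "(SUP k. ?a k x) \<le> of_bool (tail G (x 0) = v \<and> x \<in> D \<and> x \<in> ray_basin G (Y x)) * g x"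
    proof (rule SUP_least)
      fix k
      have "x \<in> ray_basin G (Y x)" if "x \<in> D" "follows_from (Y x) k x"
        using that ray_basin_iff[OF field_rays] field_inf_paths by blast
      then show "?a k x \<le> of_bool (tail G (x 0) = v \<and> x \<in> D \<and> x \<in> ray_basin G (Y x)) * g x" by auto
    qed
    ultimately show "of_bool (tail G (x 0) = v \<and> x \<in> D \<and> x \<in> ray_basin G (Y x)) * g x = (SUP k. ?a k x)"
      by (rule antisym)
  qed
  also have "\<dots> = (SUP k. integral\<^sup>N m (?a k))"
  proof (rule nn_integral_monotone_convergence_SUP)
    show "incseq ?a"
      by (auto simp: incseq_def le_fun_def dest: follows_from_mono)
  qed measurable
  also have "\<dots> = (SUP k. integral\<^sup>N m (?b k))"
    by (simp only: transport_kernel[OF m v g])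
  also have "\<dots> = (\<integral>\<^sup>+x. (SUP k. ?b k x) \<partial>m)"
  proof (rule nn_integral_monotone_convergence_SUP[symmetric])
    have "?b i x \<le> ?b j x" if "i \<le> j" for i j x
    proof (cases "x \<in> exit_follow 0")
      case True
      then have "Y x \<in> rays G" using field_rays by (simp add: exit_follow_def)
      from incseqD[OF kernel_incseq[OF this v] that] True show ?thesis by (simp add: mult_right_mono)
    qed simp
    then show "incseq ?b" by (auto simp: incseq_def le_fun_def)
  qed measurable
  also have "\<dots> = (\<integral>\<^sup>+x. of_bool (x \<in> exit_follow 0) * (potential v (Y x) * g x) \<partial>m)"
  proof (rule nn_integral_cong)
    fix x
    show "(SUP k. ?b k x) = of_bool (x \<in> exit_follow 0) * (potential v (Y x) * g x)"
    proof (cases "x \<in> exit_follow 0")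
      case True
      then have "Y x \<in> rays G" using field_rays by (simp add: exit_follow_def)
      from potential_SUP[OF this v] True show ?thesis by (simp add: SUP_mult_right_ennreal)
    qed simp
  qed
  finally show ?thesis .
qed

end
end

section \<open>The conformal measure of a summable ray\<close>

lemma ennreal_add_le_cancel:
  fixes a b c :: ennreal
  shows "a + b \<le> a + c \<Longrightarrow> a < \<top> \<Longrightarrow> b \<le> c"
  by (auto simp: ennreal_add_left_cancel_le)

context weighted_digraph
begin

lemma conformal_cyl:
  assumes m: "conformal m" and \<nu>: "awalk u \<nu> v" "\<nu> \<noteq> []"
  shows "emeasure m (cyl \<nu>) = weight \<nu> * emeasure m (cyl_vert G v)"
proof -
  note conformal_sets[OF m, simp] conformal_space[OF m, simp]
  have L: "\<nu> \<in> lists (arcs G)" using \<nu> by (auto simp: awalk_def)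
  have "emeasure m (cyl \<nu>) = (\<integral>\<^sup>+x. indicator (cyl \<nu>) x \<partial>m)" by simp
  also have "\<dots> = (\<integral>\<^sup>+x. of_bool (starts_with \<nu> x) * 1 \<partial>m)"
    by (intro nn_integral_cong) (auto simp: cyl_def split: split_indicator)
  also have "\<dots> = weight \<nu> * (\<integral>\<^sup>+z. of_bool (ends_at \<nu> (tail G (z 0))) * 1 \<partial>m)"
    by (rule conformal_nn_integral_path[OF m L]) simp
  also have "(\<integral>\<^sup>+z. of_bool (ends_at \<nu> (tail G (z 0))) * 1 \<partial>m) = (\<integral>\<^sup>+z. indicator (cyl_vert G v) z \<partial>m)"
  proof (rule nn_integral_cong)
    fix z assume "z \<in> space m"
    moreover have "ends_at \<nu> w \<longleftrightarrow> w = v" for w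
      using \<nu> awalk_end_unique' unfolding ends_at_def by blast
    ultimately show "of_bool (ends_at \<nu> (tail G (z 0))) * 1 = (indicator (cyl_vert G v) z :: ennreal)"
      by (auto simp: cyl_vert_def)
  qed
  also have "\<dots> = emeasure m (cyl_vert G v)" by simp
  finally show ?thesis .
qed

lemma conformal_eqI:
  assumes m: "conformal m" and m': "conformal m'"
    and eq: "\<And>v. v \<in> verts G \<Longrightarrow> emeasure m (cyl_vert G v) = emeasure m' (cyl_vert G v)"
  shows "m = m'"
proof (rule path_measure_eqI[OF conformal_sets[OF m] conformal_sets[OF m']])
  fix a assume "a \<in> arcs G"
  then have aw: "awalk (tail G a) [a] (head G a)" by (rule arc_implies_awalk)
  have "emeasure m (cyl_vert G (head G a)) < \<top>"
    by (rule conformal_finite[OF m awalk_last_in_verts[OF aw]])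
  then show "emeasure m (cyl [a]) \<noteq> \<infinity>"
    by (simp add: conformal_cyl[OF m aw] ennreal_mult_eq_top_iff)
next
  fix u \<nu> v assume \<nu>: "awalk u \<nu> v" "\<nu> \<noteq> []"
  show "emeasure m (cyl \<nu>) = emeasure m' (cyl \<nu>)"
    by (simp add: conformal_cyl[OF m \<nu>] conformal_cyl[OF m' \<nu>] eq awalk_last_in_verts[OF \<nu>(1)])
qed

end

context transient_digraph
begin

lemma constant_ray_field:
  assumes y: "y \<in> rays G"
  shows "ray_field (inf_paths G) (\<lambda>_. y)"
  unfolding ray_field_def
proof (intro conjI ballI allI iffI)
  show "inf_paths G \<in> sets (path_borel G)" by (metis sets.top space_path_borel)
  show "shift x \<in> inf_paths G" if "x \<in> inf_paths G" for x using that by (rule shift_inf_paths)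
  show "tail G (y j) \<in> verts G" for j by (rule inf_paths_tail[OF rays_inf_path[OF y]])
qed (use y in simp_all)

lemma invariant_const: "invariant (\<lambda>_. c)"
  by (simp add: invariant_def)

text \<open>The formula \<open>ray_field_formula\<close> for a single ray, attached to all paths.\<close>

lemma cyl_vert_basin:
  assumes y: "y \<in> rays G" and m: "conformal m" and v: "v \<in> verts G"
  shows "emeasure m (cyl_vert G v \<inter> ray_basin G y) = potential v y * emeasure m (ray_follow_set G y 0)"
proof -
  note field = constant_ray_field[OF y]
  note conformal_sets[OF m, measurable_cong]
  have F: "exit_follow (inf_paths G) (\<lambda>_. y) 0 = ray_follow_set G y 0"
    by (auto simp: exit_follow_def[OF field] ray_follow_set_eq ray_exit_set_0)
  have Fs: "ray_follow_set G y 0 \<in> sets m"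
    using exit_follow_sets[OF field, of 0] by (simp add: F conformal_sets[OF m])
  have Bs: "cyl_vert G v \<inter> ray_basin G y \<in> sets m"
    using ray_basin_sets[OF y] by (simp add: conformal_sets[OF m])
  have "emeasure m (cyl_vert G v \<inter> ray_basin G y)
      = (\<integral>\<^sup>+x. indicator (cyl_vert G v \<inter> ray_basin G y) x \<partial>m)"
    using Bs by simp
  also have "\<dots> = (\<integral>\<^sup>+x. of_bool (tail G (x 0) = v \<and> x \<in> inf_paths G \<and> x \<in> ray_basin G y) * 1 \<partial>m)"
    by (intro nn_integral_cong) (auto simp: cyl_vert_def conformal_space[OF m] split: split_indicator)
  also have "\<dots> = (\<integral>\<^sup>+x. of_bool (x \<in> ray_follow_set G y 0) * (potential v y * 1) \<partial>m)"
    using ray_field_formula[OF field m v invariant_const[of 1]] unfolding F .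
  also have "\<dots> = (\<integral>\<^sup>+x. potential v y * indicator (ray_follow_set G y 0) x \<partial>m)"
    by (intro nn_integral_cong) (auto split: split_indicator)
  also have "\<dots> = potential v y * emeasure m (ray_follow_set G y 0)"
    by (rule nn_integral_cmult_indicator[OF Fs])
  finally show ?thesis .
qed

text \<open>
  A path from the \<open>k\<close>-th vertex leaves the first \<open>k + 1\<close> vertices for good or begins with a first return
  path, and the cylinders of first return paths are disjoint.
\<close>

lemma cyl_vert_first_return:
  assumes y: "y \<in> rays G" and m: "conformal m"
  shows "emeasure m (cyl_vert G (tail G (y k))) \<le> emeasure m (ray_exit_set G y k)
    + (\<integral>\<^sup>+\<mu>. weight \<mu> * emeasure m (cyl_vert G (head G (last \<mu>))) \<partial>count_space (return_paths y k))"
proof -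
  note conformal_sets[OF m, simp]
  let ?H = "(\<lambda>i. tail G (y i)) ` {..k}"
  have sub: "return_paths y k \<subseteq> lists (arcs G)"
  proof
    fix \<mu> assume "\<mu> \<in> return_paths y k"
    then obtain v where "awalk (tail G (y k)) \<mu> v" unfolding return_paths_def by blast
    then show "\<mu> \<in> lists (arcs G)" unfolding awalk_def by auto
  qed
  have cover: "cyl_vert G (tail G (y k)) \<subseteq> ray_exit_set G y k \<union> (\<Union>\<mu>\<in>return_paths y k. cyl \<mu>)"
  proof
    fix x assume "x \<in> cyl_vert G (tail G (y k))"
    then have x: "x \<in> inf_paths G" and x0: "tail G (x 0) = tail G (y k)" by (auto simp: cyl_vert_def)
    show "x \<in> ray_exit_set G y k \<union> (\<Union>\<mu>\<in>return_paths y k. cyl \<mu>)"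
    proof (cases "\<exists>n>0. tail G (x n) \<in> ?H")
      case False
      then have "tail G (x n) \<noteq> tail G (y l)" if "0 < n" "l \<le> k" for n l
        using that by (metis atMost_iff image_eqI)
      then have "x \<in> ray_exit_set G y k" using x x0 by (simp add: ray_exit_set_0)
      then show ?thesis by simp
    next
      case True
      \<comment> \<open>The first return time.\<close>
      define n where "n = (LEAST n. 0 < n \<and> tail G (x n) \<in> ?H)"
      have n: "0 < n" "tail G (x n) \<in> ?H" unfolding n_def using LeastI_ex[OF True] by blast+
      have least: "tail G (x i) \<notin> ?H" if "0 < i" "i < n" for i
        using not_less_Least[of i "\<lambda>n. 0 < n \<and> tail G (x n) \<in> ?H"] that unfolding n_def by blast
      obtain n' where n': "n = Suc n'" using n(1) by (cases n) auto
      let ?\<mu> = "map x [0..<n]"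
      have "awalk (tail G (y k)) ?\<mu> (tail G (x n))"
        using inf_path_walk[OF x, of 0 n] x0 by simp
      moreover have "head G (last ?\<mu>) = tail G (x n)"
        using inf_paths_step[OF x, of n'] by (simp add: n')
      moreover have "head G a \<notin> ?H" if "a \<in> set (butlast ?\<mu>)" for a
      proof -
        from that obtain i where "a = x i" "i < n'" by (auto simp: n')
        with least[of "Suc i"] inf_paths_step[OF x, of i] show ?thesis by (simp add: n')
      qed
      moreover have "?\<mu> \<noteq> []" using n(1) by simp
      ultimately have "?\<mu> \<in> return_paths y k" using n(2) unfolding return_paths_def by auto
      moreover have "x \<in> cyl ?\<mu>" using x by (simp add: cyl_def starts_with_prefix)
      ultimately show ?thesis by blast
    qed
  qed
  have U: "(\<Union>\<mu>\<in>return_paths y k. cyl \<mu>) \<in> sets (path_borel G)"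
    by (intro sets.countable_UN'' countable_subset[OF sub countable_lists_arcs] cyl_sets)
  have "emeasure m (cyl_vert G (tail G (y k))) \<le> emeasure m (ray_exit_set G y k \<union> (\<Union>\<mu>\<in>return_paths y k. cyl \<mu>))"
    using sets.Un[OF ray_exit_set_sets U] by (intro emeasure_mono[OF cover]) simp
  also have "\<dots> \<le> emeasure m (ray_exit_set G y k) + emeasure m (\<Union>\<mu>\<in>return_paths y k. cyl \<mu>)"
    using U ray_exit_set_sets by (intro emeasure_subadditive) simp_all
  also have "emeasure m (\<Union>\<mu>\<in>return_paths y k. cyl \<mu>) = (\<integral>\<^sup>+\<mu>. emeasure m (cyl \<mu>) \<partial>count_space (return_paths y k))"
  proof (rule emeasure_UN_countable)
    show "disjoint_family_on cyl (return_paths y k)"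
      unfolding disjoint_family_on_def
    proof (intro ballI impI)
      fix \<mu> \<nu> assume \<mu>: "\<mu> \<in> return_paths y k" "\<nu> \<in> return_paths y k" "\<mu> \<noteq> \<nu>"
      show "cyl \<mu> \<inter> cyl \<nu> = {}"
      proof (rule ccontr)
        assume "cyl \<mu> \<inter> cyl \<nu> \<noteq> {}"
        then obtain x where "starts_with \<mu> x" "starts_with \<nu> x" by (auto simp: cyl_def)
        then consider \<rho> where "\<nu> = \<mu> @ \<rho>" | \<rho> where "\<mu> = \<nu> @ \<rho>"
          by (metis starts_with_take nat_le_linear)
        then show False
        proof cases
          case 1
          with \<mu> return_paths_prefix_free[of \<mu> y k \<rho>] show False by simp
        next
          case 2
          with \<mu> return_paths_prefix_free[of \<nu> y k \<rho>] show False by simp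
        qed
      qed
    qed
  qed (use countable_subset[OF sub countable_lists_arcs] in auto)
  also have "\<dots> = (\<integral>\<^sup>+\<mu>. weight \<mu> * emeasure m (cyl_vert G (head G (last \<mu>))) \<partial>count_space (return_paths y k))"
  proof (rule nn_integral_cong)
    fix \<mu> assume "\<mu> \<in> space (count_space (return_paths y k))"
    then obtain v where "awalk (tail G (y k)) \<mu> v" "\<mu> \<noteq> []" by (auto simp: return_paths_def)
    then show "emeasure m (cyl \<mu>) = weight \<mu> * emeasure m (cyl_vert G (head G (last \<mu>)))"
      using conformal_cyl[OF m] awalk_last_head by simp
  qed
  finally show ?thesis .
qed

text \<open>
  Approximations of \<open>ray_follow_set\<close> that prescribe finitely many exits only, so that
  their measures can be computed.
\<close>

definition exits_upto :: "(nat \<Rightarrow> 'b) \<Rightarrow> nat \<Rightarrow> nat \<Rightarrow> (nat \<Rightarrow> 'b) set" where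
  "exits_upto y k j = {x \<in> ray_exit_set G y j. \<forall>l. j \<le> l \<and> l \<le> k \<longrightarrow> (\<exists>i. (shift ^^ i) x \<in> ray_exit_set G y l)}"

lemma exits_upto_sets [measurable]: "exits_upto y k j \<in> sets (path_borel G)"
proof -
  have "exits_upto y k j = {x \<in> space (path_borel G). x \<in> ray_exit_set G y j \<and>
      (\<forall>l. j \<le> l \<and> l \<le> k \<longrightarrow> (\<exists>i. (shift ^^ i) x \<in> ray_exit_set G y l))}"
    by (auto simp: exits_upto_def ray_exit_set_0)
  also have "\<dots> \<in> sets (path_borel G)" by measurable
  finally show ?thesis .
qed

lemma exits_upto_self: "exits_upto y k k = ray_exit_set G y k"
proof -
  have "\<exists>i. (shift ^^ i) x \<in> ray_exit_set G y k" if "x \<in> ray_exit_set G y k" for x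
    using that by (intro exI[of _ 0]) simp
  then show ?thesis by (auto simp: exits_upto_def dest: antisym)
qed

lemma exits_upto_Suc:
  assumes x: "x \<in> inf_paths G" and jk: "j < k"
  shows "x \<in> exits_upto y k j \<longleftrightarrow> x \<in> ray_exit_set G y j \<and> (\<exists>i. (shift ^^ i) x \<in> exits_upto y k (Suc j))"
proof
  assume e: "x \<in> exits_upto y k j"
  then obtain t where t: "\<And>l. j \<le> l \<Longrightarrow> l \<le> k \<Longrightarrow> (shift ^^ t l) x \<in> ray_exit_set G y l"
    unfolding exits_upto_def by (auto simp: mem_Collect_eq) metis
  have "(shift ^^ t (Suc j)) x \<in> exits_upto y k (Suc j)"
    unfolding exits_upto_def
  proof (intro CollectI conjI allI impI)
    show "(shift ^^ t (Suc j)) x \<in> ray_exit_set G y (Suc j)" using t[of "Suc j"] jk by simp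
    fix l assume l: "Suc j \<le> l \<and> l \<le> k"
    have "t (Suc j) \<le> t l"
      using ray_exit_time_mono[OF x t[of "Suc j"] t[of l]] l jk by simp
    then have "(shift ^^ (t l - t (Suc j))) ((shift ^^ t (Suc j)) x) = (shift ^^ t l) x"
      by (simp add: shift_funpow_add)
    with t[of l] l show "\<exists>i. (shift ^^ i) ((shift ^^ t (Suc j)) x) \<in> ray_exit_set G y l"
      by (intro exI[of _ "t l - t (Suc j)"]) simp
  qed
  with e show "x \<in> ray_exit_set G y j \<and> (\<exists>i. (shift ^^ i) x \<in> exits_upto y k (Suc j))"
    by (auto simp: exits_upto_def)
next
  assume a: "x \<in> ray_exit_set G y j \<and> (\<exists>i. (shift ^^ i) x \<in> exits_upto y k (Suc j))"
  then obtain i where i: "(shift ^^ i) x \<in> exits_upto y k (Suc j)" by blast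
  show "x \<in> exits_upto y k j"
    unfolding exits_upto_def
  proof (intro CollectI conjI allI impI)
    show "x \<in> ray_exit_set G y j" using a by simp
    fix l assume l: "j \<le> l \<and> l \<le> k"
    show "\<exists>i. (shift ^^ i) x \<in> ray_exit_set G y l"
    proof (cases "l = j")
      case True
      with a show ?thesis by (intro exI[of _ 0]) simp
    next
      case False
      then have "Suc j \<le> l \<and> l \<le> k" using l by simp
      then obtain n where "(shift ^^ n) ((shift ^^ i) x) \<in> ray_exit_set G y l"
        using i unfolding exits_upto_def by blast
      then show ?thesis unfolding shift_funpow_add by blast
    qed
  qed
qed

text \<open>With finitely many exits prescribed, the mass is a product over the links in between.\<close>

lemma emeasure_exits_upto:
  assumes y: "y \<in> rays G" and m: "conformal m" and "j \<le> k"
  shows "rweight y j * emeasure m (exits_upto y k j) = rweight y k * emeasure m (ray_exit_set G y k)"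
  using \<open>j \<le> k\<close>
proof (induction j rule: inc_induct)
  case base
  then show ?case by (simp add: exits_upto_self)
next
  case (step j)
  note conformal_sets[OF m, simp]
  have "emeasure m (exits_upto y k j) = (\<integral>\<^sup>+x. indicator (exits_upto y k j) x \<partial>m)"
    by simp
  also have "\<dots> = (\<integral>\<^sup>+x. of_bool (x \<in> ray_exit_set G y j \<and> (\<exists>i. (shift ^^ i) x \<in> exits_upto y k (Suc j))) * 1 \<partial>m)"
    using step.hyps
    by (intro nn_integral_cong) (simp add: exits_upto_Suc[symmetric] conformal_space[OF m] indicator_def)
  also have "\<dots> = (\<integral>\<^sup>+z. of_bool (z \<in> exits_upto y k (Suc j)) * (link y j * 1) \<partial>m)"
    by (rule transport_link[OF constant_ray_field[OF y] m exits_upto_sets _ invariant_const])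
       (use y in \<open>auto simp: exits_upto_def\<close>)
  also have "\<dots> = (\<integral>\<^sup>+z. link y j * indicator (exits_upto y k (Suc j)) z \<partial>m)"
    by (intro nn_integral_cong) (auto split: split_indicator)
  also have "\<dots> = link y j * emeasure m (exits_upto y k (Suc j))"
    by (rule nn_integral_cmult_indicator) simp
  finally show ?case using step.IH by (simp add: rweight_Suc mult.assoc)
qed

text \<open>
  Take the path measure of the harmonic vector \<open>V(\<cdot>, y) / V(v0, y)\<close>.  The first
  return comparison bounds its mass on \<open>ray_follow_set\<close> from below by the inverse of
  \<open>V(v0, y)\<close>.  By \<open>cyl_vert_basin\<close> the end of \<open>y\<close> then
  carries the whole mass at each vertex.
\<close>

lemma ray_conformal_exists:
  assumes y: "y \<in> rays G" and fin: "potential v0 y < \<top>"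
  shows "\<exists>m. m \<in> normalized_conformal_measures G F \<beta> v0 \<and> concentrated_on m (ray_basin G y)"
proof -
  let ?c = "inverse (potential v0 y)"
  have c: "?c \<noteq> 0" "?c \<noteq> \<top>"
    using fin potential_pos[OF y] by (auto simp: ennreal_inverse_eq_0_iff ennreal_inverse_eq_top_iff)
  then have c_fin: "?c < \<top>" using less_top by blast
  define h where "h v = potential v y * ?c" for v
  have h_fin: "h v < \<top>" if "v \<in> verts G" for v
    unfolding h_def ennreal_mult_less_top using potential_finite[OF y fin that] c_fin by blast
  have h_harm: "h v = (\<integral>\<^sup>+a. ennreal (exp (- \<beta> * F a)) * h (head G a) \<partial>count_space (out_arcs G v))"
    if "v \<in> verts G" for v
    unfolding h_def potential_harmonic[OF y that] by (subst nn_integral_multc[symmetric]) (simp_all add: mult.assoc)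
  have h_v0: "h v0 = 1"
    using fin potential_pos[OF y] ennreal_inverse_mult_self[of "potential v0 y"] by (simp add: h_def mult.commute)
  obtain m where m_sets: "sets m = sets (path_borel G)"
    and m_cyl: "\<And>u \<nu> v. awalk u \<nu> v \<Longrightarrow> \<nu> \<noteq> [] \<Longrightarrow> emeasure m (cyl \<nu>) = weight \<nu> * h v"
    using harmonic_path_measure[OF h_fin h_harm] by blast
  have h_v0': "h v0 \<noteq> 0" by (simp add: h_v0)
  have m: "conformal m"
    by (rule conformalI_cyl(1)[OF m_sets h_fin h_harm m_cyl v0 h_v0']) assumption+
  have m_vert: "emeasure m (cyl_vert G v) = h v" if "v \<in> verts G" for v
    by (rule conformalI_cyl(2)[OF m_sets h_fin h_harm m_cyl v0 h_v0' that]) assumption+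
  note m_sets[simp]
  have yv: "tail G (y i) \<in> verts G" for i using rays_inf_path[OF y] by (rule inf_paths_tail)
  \<comment> \<open>The return terms on both sides are equal and finite, and can be cancelled.\<close>
  have exit_ge: "?c \<le> rweight y k * emeasure m (ray_exit_set G y k)" for k
  proof -
    let ?R = "\<integral>\<^sup>+\<mu>. weight \<mu> * potential (head G (last \<mu>)) y \<partial>count_space (return_paths y k)"
    have hv: "head G (last \<mu>) \<in> verts G" if "\<mu> \<in> return_paths y k" for \<mu>
      using that yv by (auto simp: return_paths_def)
    have R: "(\<integral>\<^sup>+\<mu>. weight \<mu> * emeasure m (cyl_vert G (head G (last \<mu>))) \<partial>count_space (return_paths y k)) = ?R * ?c"
      by (subst nn_integral_multc[symmetric])
         (auto intro!: nn_integral_cong simp: m_vert hv h_def mult.assoc)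
    have "?R * ?c + inverse (rweight y k) * ?c \<le> potential (tail G (y k)) y * ?c"
      unfolding distrib_right[symmetric] by (intro mult_right_mono potential_first_return y) simp
    also have "\<dots> \<le> emeasure m (ray_exit_set G y k) + ?R * ?c"
      using cyl_vert_first_return[OF y m, of k] unfolding R m_vert[OF yv] h_def .
    finally have le: "?R * ?c + inverse (rweight y k) * ?c \<le> ?R * ?c + emeasure m (ray_exit_set G y k)"
      by (simp add: add.commute)
    have "?R \<le> potential (tail G (y k)) y"
      using potential_first_return[OF y, of k] by (rule order_trans[rotated]) simp
    then have "?R < \<top>" using potential_finite[OF y fin yv] by (rule le_less_trans)
    then have "?R * ?c < \<top>" unfolding ennreal_mult_less_top using c_fin by blast
    then have le': "inverse (rweight y k) * ?c \<le> emeasure m (ray_exit_set G y k)"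
      by (rule ennreal_add_le_cancel[OF le])
    have "?c = inverse (rweight y k) * rweight y k * ?c"
      using ennreal_inverse_mult_self[OF rweight_pos[OF y] rweight_finite[OF y], of k] by simp
    also have "\<dots> = rweight y k * (inverse (rweight y k) * ?c)" by (simp add: mult_ac)
    also have "\<dots> \<le> rweight y k * emeasure m (ray_exit_set G y k)"
      by (intro mult_left_mono le') simp
    finally show ?thesis .
  qed
  have "?c \<le> emeasure m (ray_follow_set G y 0)"
  proof -
    have eq: "ray_follow_set G y 0 = (\<Inter>k. exits_upto y k 0)"
    proof (intro set_eqI iffI)
      fix x assume "x \<in> ray_follow_set G y 0"
      then show "x \<in> (\<Inter>k. exits_upto y k 0)"
        unfolding ray_follow_set_eq exits_upto_def follows_from_def by blast
    next
      fix x assume x: "x \<in> (\<Inter>k. exits_upto y k 0)"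
      have "\<exists>i. (shift ^^ i) x \<in> ray_exit_set G y j" for j
        using INT_D[OF x, of j] unfolding exits_upto_def by blast
      moreover have "x \<in> ray_exit_set G y 0"
        using INT_D[OF x, of 0] unfolding exits_upto_def by blast
      ultimately show "x \<in> ray_follow_set G y 0"
        unfolding ray_follow_set_eq follows_from_def by blast
    qed
    have "?c \<le> emeasure m (exits_upto y k 0)" for k
      using exit_ge[of k] emeasure_exits_upto[OF y m, of 0 k] by simp
    then have "?c \<le> (INF k. emeasure m (exits_upto y k 0))" by (rule INF_greatest)
    also have "\<dots> = emeasure m (\<Inter>k. exits_upto y k 0)"
    proof (rule INF_emeasure_decseq)
      show "decseq (\<lambda>k. exits_upto y k 0)" by (auto simp: decseq_def exits_upto_def)
      have "emeasure m (exits_upto y k 0) \<le> emeasure m (cyl_vert G (tail G (y 0)))" for k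
      proof (rule emeasure_mono)
        show "exits_upto y k 0 \<subseteq> cyl_vert G (tail G (y 0))"
          by (auto simp: exits_upto_def ray_exit_set_0 cyl_vert_def)
      qed simp
      also have "\<dots> < \<top>" by (rule conformal_finite[OF m yv])
      finally show "emeasure m (exits_upto y k 0) \<noteq> \<infinity>" for k by (simp add: less_top)
    qed auto
    finally show ?thesis unfolding eq .
  qed
  then have basin: "h v \<le> emeasure m (cyl_vert G v \<inter> ray_basin G y)" if "v \<in> verts G" for v
    unfolding cyl_vert_basin[OF y m that] h_def by (rule mult_left_mono) simp
  have B: "ray_basin G y \<in> sets m" using ray_basin_sets[OF y] by simp
  have null: "emeasure m (cyl_vert G v - ray_basin G y) = 0" if v: "v \<in> verts G" for v
  proof -
    have "emeasure m (cyl_vert G v - ray_basin G y) = emeasure m (cyl_vert G v - (cyl_vert G v \<inter> ray_basin G y))"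
      by (rule arg_cong[where f="emeasure m"]) auto
    also have "\<dots> = emeasure m (cyl_vert G v) - emeasure m (cyl_vert G v \<inter> ray_basin G y)"
    proof (rule emeasure_Diff)
      have "emeasure m (cyl_vert G v \<inter> ray_basin G y) \<le> emeasure m (cyl_vert G v)"
        by (intro emeasure_mono) auto
      then show "emeasure m (cyl_vert G v \<inter> ray_basin G y) \<noteq> \<infinity>"
        using conformal_finite[OF m v] by (auto simp: top_unique)
    qed (use B in auto)
    also have "\<dots> = 0" using basin[OF v] by (simp add: m_vert[OF v] diff_eq_0_iff_ennreal h_fin[OF v])
    finally show ?thesis .
  qed
  have "emeasure m (space m - ray_basin G y) = 0"
  proof -
    have "space m - ray_basin G y = (\<Union>v\<in>verts G. cyl_vert G v - ray_basin G y)"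
      using inf_paths_tail[of _ 0] by (auto simp: conformal_space[OF m] cyl_vert_def)
    also have "\<dots> \<in> null_sets m"
      using B null by (intro null_sets_UN' countable_verts) (auto simp: null_sets_def)
    finally show ?thesis by auto
  qed
  then have "concentrated_on m (ray_basin G y)" using B by (simp add: concentrated_on_def)
  moreover have "m \<in> normalized_conformal_measures G F \<beta> v0"
    using m m_vert[OF v0] h_v0 by (simp add: normalized_conformal_measures_def)
  ultimately show ?thesis by blast
qed

lemma normalizedD:
  "m \<in> normalized_conformal_measures G F \<beta> v0 \<Longrightarrow> conformal m"
  "m \<in> normalized_conformal_measures G F \<beta> v0 \<Longrightarrow> emeasure m (cyl_vert G v0) = 1"
  by (auto simp: normalized_conformal_measures_def)

text \<open>The unknown factor in \<open>cyl_vert_basin\<close> is fixed by the normalization.\<close>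

lemma concentrated_cyl_vert:
  assumes y: "y \<in> rays G" and fin: "potential v0 y < \<top>"
    and m: "m \<in> normalized_conformal_measures G F \<beta> v0" and conc: "concentrated_on m (ray_basin G y)"
    and v: "v \<in> verts G"
  shows "emeasure m (cyl_vert G v) = potential v y / potential v0 y"
proof -
  note cm = normalizedD[OF m]
  have B: "ray_basin G y \<in> sets m" and "emeasure m (space m - ray_basin G y) = 0"
    using conc unfolding concentrated_on_def by blast+
  then have null: "space m - ray_basin G y \<in> null_sets m" by (intro null_setsI sets.compl_sets)
  note conformal_sets[OF cm(1), simp]
  let ?f = "emeasure m (ray_follow_set G y 0)"
  have eq: "emeasure m (cyl_vert G v) = potential v y * ?f" if v: "v \<in> verts G" for v
  proof -
    have "emeasure m (cyl_vert G v) = emeasure m (cyl_vert G v - (space m - ray_basin G y))"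
      using emeasure_Diff_null_set[OF null, of "cyl_vert G v"] by simp
    also have "cyl_vert G v - (space m - ray_basin G y) = cyl_vert G v \<inter> ray_basin G y"
      by (auto simp: conformal_space[OF cm(1)] cyl_vert_def)
    finally show ?thesis by (simp add: cyl_vert_basin[OF y cm(1) v])
  qed
  have p: "potential v0 y \<noteq> 0" "potential v0 y \<noteq> \<top>" using fin potential_pos[OF y] by auto
  have "?f = inverse (potential v0 y) * potential v0 y * ?f"
    using ennreal_inverse_mult_self[OF p] by simp
  also have "\<dots> = inverse (potential v0 y)"
    using eq[OF v0] cm(2) by (simp add: mult.assoc)
  finally show ?thesis using eq[OF v] by (simp add: divide_ennreal_def)
qed

lemma ray_measure_props:
  assumes y: "y \<in> rays G" and fin: "potential v0 y < \<top>"
  shows "ray_measure G F \<beta> v0 y \<in> normalized_conformal_measures G F \<beta> v0"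
    and "concentrated_on (ray_measure G F \<beta> v0 y) (ray_basin G y)"
    and "v \<in> verts G \<Longrightarrow> emeasure (ray_measure G F \<beta> v0 y) (cyl_vert G v) = potential v y / potential v0 y"
proof -
  let ?P = "\<lambda>m. m \<in> normalized_conformal_measures G F \<beta> v0 \<and> concentrated_on m (ray_basin G y)"
  have "\<exists>!m. ?P m"
  proof (rule ex_ex1I)
    show "\<exists>m. ?P m" by (rule ray_conformal_exists[OF y fin])
    show "m = m'" if "?P m" "?P m'" for m m'
      using that by (intro conformal_eqI) (auto simp: normalizedD concentrated_cyl_vert[OF y fin])
  qed
  then have "?P (ray_measure G F \<beta> v0 y)" unfolding ray_measure_def by (rule theI')
  then show n: "ray_measure G F \<beta> v0 y \<in> normalized_conformal_measures G F \<beta> v0"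
    and c: "concentrated_on (ray_measure G F \<beta> v0 y) (ray_basin G y)" by blast+
  show "emeasure (ray_measure G F \<beta> v0 y) (cyl_vert G v) = potential v y / potential v0 y" if "v \<in> verts G"
    by (rule concentrated_cyl_vert[OF y fin n c that])
qed

section \<open>Measurable families of path measures\<close>

text \<open>
  A Dynkin system argument, run separately on each cylinder of a single arrow, where the measures
  are finite and complements can be subtracted.
\<close>

lemma measurable_path_kernel:
  assumes sets: "\<And>i. i \<in> space N \<Longrightarrow> sets (\<kappa> i) = sets (path_borel G)"
    and fin: "\<And>i a. i \<in> space N \<Longrightarrow> a \<in> arcs G \<Longrightarrow> emeasure (\<kappa> i) (cyl [a]) < \<top>"
    and meas: "\<And>u \<nu> v. awalk u \<nu> v \<Longrightarrow> \<nu> \<noteq> [] \<Longrightarrow> (\<lambda>i. emeasure (\<kappa> i) (cyl \<nu>)) \<in> borel_measurable N"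
    and B: "B \<in> sets (path_borel G)"
  shows "(\<lambda>i. emeasure (\<kappa> i) B) \<in> borel_measurable N"
proof -
  have meas': "(\<lambda>i. emeasure (\<kappa> i) (cyl \<nu>)) \<in> borel_measurable N" if "\<nu> \<noteq> []" for \<nu>
  proof (cases "cyl \<nu> = {}")
    case False
    then obtain x where "x \<in> inf_paths G" "starts_with \<nu> x" by (auto simp: cyl_def)
    from meas[OF starts_with_walk[OF this] that] show ?thesis .
  qed simp
  have part: "(\<lambda>i. emeasure (\<kappa> i) (B \<inter> cyl [a])) \<in> borel_measurable N"
    if a: "a \<in> arcs G" and B: "B \<in> sets (path_borel G)" for a B
  proof -
    have sub: "insert {} (range cyl) \<subseteq> Pow (inf_paths G)" by (auto simp: cyl_def)
    from B have "B \<in> sigma_sets (inf_paths G) (insert {} (range cyl))" by (simp add: sets_path_borel)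
    from Int_stable_cyl sub this show ?thesis
    proof (induction rule: sigma_sets_induct_disjoint)
      case (basic A)
      then consider "A = {}" | "A = cyl []" | \<nu> where "A = cyl \<nu>" "\<nu> \<noteq> []" by blast
      then show ?case
      proof cases
        case 2
        then have "A \<inter> cyl [a] = cyl [a]" by (auto simp: cyl_def)
        then show ?thesis using meas' by simp
      next
        case 3
        then consider "A \<inter> cyl [a] = {}" | "A \<inter> cyl [a] = cyl \<nu>" | "A \<inter> cyl [a] = cyl [a]"
          using cyl_Int[of \<nu> "[a]"] by blast
        then show ?thesis using meas' 3 by cases simp_all
      qed simp
    next
      case (compl A)
      then have A: "A \<in> sets (path_borel G)" by (simp add: sets_path_borel)
      have "emeasure (\<kappa> i) ((inf_paths G - A) \<inter> cyl [a]) = emeasure (\<kappa> i) (cyl [a]) - emeasure (\<kappa> i) (A \<inter> cyl [a])"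
        if i: "i \<in> space N" for i
      proof -
        have "(inf_paths G - A) \<inter> cyl [a] = cyl [a] - A \<inter> cyl [a]" by (auto simp: cyl_def)
        moreover have "emeasure (\<kappa> i) (A \<inter> cyl [a]) \<le> emeasure (\<kappa> i) (cyl [a])"
          using cyl_sets by (intro emeasure_mono) (simp_all add: sets[OF i])
        then have "emeasure (\<kappa> i) (A \<inter> cyl [a]) \<noteq> \<infinity>"
          using fin[OF i a] by (auto simp: top_unique)
        then have "emeasure (\<kappa> i) (cyl [a] - A \<inter> cyl [a]) = emeasure (\<kappa> i) (cyl [a]) - emeasure (\<kappa> i) (A \<inter> cyl [a])"
          using A by (intro emeasure_Diff) (simp_all add: sets[OF i])
        ultimately show ?thesis by simp
      qed
      moreover have "(\<lambda>i. emeasure (\<kappa> i) (cyl [a]) - emeasure (\<kappa> i) (A \<inter> cyl [a])) \<in> borel_measurable N"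
        using compl meas' by (intro borel_measurable_minus_ennreal) auto
      ultimately show ?case by (simp cong: measurable_cong)
    next
      case (union A)
      then have A: "A n \<in> sets (path_borel G)" for n by (auto simp: sets_path_borel)
      have "emeasure (\<kappa> i) (\<Union> (range A) \<inter> cyl [a]) = (\<Sum>n. emeasure (\<kappa> i) (A n \<inter> cyl [a]))" if i: "i \<in> space N" for i
      proof -
        have "\<Union> (range A) \<inter> cyl [a] = (\<Union>n. A n \<inter> cyl [a])" by auto
        moreover have "disjoint_family (\<lambda>n. A n \<inter> cyl [a])"
          using union by (auto simp: disjoint_family_on_def)
        moreover have "range (\<lambda>n. A n \<inter> cyl [a]) \<subseteq> sets (\<kappa> i)"
          using A cyl_sets by (auto simp: sets[OF i])
        ultimately show ?thesis using suminf_emeasure[of "\<lambda>n. A n \<inter> cyl [a]" "\<kappa> i"] by simp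
      qed
      moreover have "(\<lambda>i. \<Sum>n. emeasure (\<kappa> i) (A n \<inter> cyl [a])) \<in> borel_measurable N"
        using union.IH by measurable
      ultimately show ?case by (simp cong: measurable_cong)
    qed simp
  qed
  have "emeasure (\<kappa> i) B = (\<integral>\<^sup>+a. emeasure (\<kappa> i) (B \<inter> cyl [a]) \<partial>count_space (arcs G))" if i: "i \<in> space N" for i
  proof -
    have "B = (\<Union>a\<in>arcs G. B \<inter> cyl [a])"
      using sets.sets_into_space[OF B] inf_paths_arc[of _ 0] by (auto simp: cyl_def)
    then have "emeasure (\<kappa> i) B = emeasure (\<kappa> i) (\<Union>a\<in>arcs G. B \<inter> cyl [a])" by simp
    also have "\<dots> = (\<integral>\<^sup>+a. emeasure (\<kappa> i) (B \<inter> cyl [a]) \<partial>count_space (arcs G))"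
    proof (rule emeasure_UN_countable[OF _ countable_arcs])
      show "disjoint_family_on (\<lambda>a. B \<inter> cyl [a]) (arcs G)"
        by (auto simp: disjoint_family_on_def cyl_def)
    qed (simp add: sets[OF i] sets.Int[OF B cyl_sets])
    finally show ?thesis .
  qed
  moreover have "(\<lambda>i. \<integral>\<^sup>+a. emeasure (\<kappa> i) (B \<inter> cyl [a]) \<partial>count_space (arcs G)) \<in> borel_measurable N"
    using part B by (intro borel_measurable_nn_integral_countable countable_arcs)
  ultimately show ?thesis by (simp cong: measurable_cong)
qed

end

section \<open>Ends as classes of wandering paths\<close>

context countable_digraph
begin

definition avoids_to :: "'a set \<Rightarrow> 'a \<Rightarrow> 'a \<Rightarrow> bool" where
  "avoids_to H u v \<longleftrightarrow> (\<exists>\<mu>. awalk u \<mu> v \<and> set (awalk_verts u \<mu>) \<inter> H = {})"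

lemma leads_to_iff:
  "leads_to G p q \<longleftrightarrow> (\<forall>H N. finite H \<and> H \<subseteq> verts G \<longrightarrow>
    (\<exists>n1\<ge>N. \<exists>n2\<ge>N. avoids_to H (tail G (p n1)) (tail G (q n2))))"
  by (simp add: leads_to_def avoids_to_def)

lemma awalk_verts_append_set:
  assumes "awalk u \<mu> v" "awalk v \<nu> w"
  shows "set (awalk_verts u (\<mu> @ \<nu>)) \<subseteq> set (awalk_verts u \<mu>) \<union> set (awalk_verts v \<nu>)"
  unfolding set_awalk_verts[OF awalk_appendI[OF assms]] set_awalk_verts[OF assms(1)] set_awalk_verts[OF assms(2)]
  by auto

lemma avoids_to_trans:
  assumes "avoids_to H u v" "avoids_to H v w"
  shows "avoids_to H u w"
proof -
  obtain \<mu> \<nu> where \<mu>: "awalk u \<mu> v" "set (awalk_verts u \<mu>) \<inter> H = {}"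
    and \<nu>: "awalk v \<nu> w" "set (awalk_verts v \<nu>) \<inter> H = {}"
    using assms unfolding avoids_to_def by blast
  have "set (awalk_verts u (\<mu> @ \<nu>)) \<inter> H = {}"
    using awalk_verts_append_set[OF \<mu>(1) \<nu>(1)] \<mu>(2) \<nu>(2) by blast
  then show ?thesis using awalk_appendI[OF \<mu>(1) \<nu>(1)] unfolding avoids_to_def by blast
qed

lemma avoids_to_segment:
  assumes x: "x \<in> inf_paths G" and av: "\<And>j. i \<le> j \<Longrightarrow> tail G (x j) \<notin> H" and "i \<le> k"
  shows "avoids_to H (tail G (x i)) (tail G (x k))"
proof -
  obtain n where k: "k = i + n" using \<open>i \<le> k\<close> le_Suc_ex by blast
  have aw: "awalk (tail G (x i)) (map x [i..<i + n]) (tail G (x (i + n)))" by (rule inf_path_walk[OF x])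
  have "set (awalk_verts (tail G (x i)) (map x [i..<i + n])) \<inter> H = {}"
  proof -
    have "head G (x j) \<notin> H" if "i \<le> j" for j
      using av[of "Suc j"] that inf_paths_step[OF x, of j] by simp
    then show ?thesis unfolding set_awalk_verts[OF aw] using av by auto
  qed
  with aw show ?thesis unfolding avoids_to_def k by blast
qed

lemma wandering_inf_path: "x \<in> wandering G \<Longrightarrow> x \<in> inf_paths G"
  by (simp add: wandering_def)

lemma wandering_leaves:
  assumes "x \<in> wandering G" "finite H" "H \<subseteq> verts G"
  obtains N where "\<And>i. N \<le> i \<Longrightarrow> tail G (x i) \<notin> H"
  using assms unfolding wandering_def by blast

lemma leads_to_refl:
  assumes p: "p \<in> wandering G"
  shows "leads_to G p p"
  unfolding leads_to_iff
proof (intro allI impI)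
  fix H N assume H: "finite H \<and> H \<subseteq> verts G"
  obtain N0 where N0: "\<And>i. N0 \<le> i \<Longrightarrow> tail G (p i) \<notin> H" using wandering_leaves[OF p] H by blast
  have "avoids_to H (tail G (p (max N N0))) (tail G (p (max N N0)))"
    by (rule avoids_to_segment[OF wandering_inf_path[OF p]]) (use N0 in auto)
  then show "\<exists>n1\<ge>N. \<exists>n2\<ge>N. avoids_to H (tail G (p n1)) (tail G (p n2))"
    by (meson max.cobounded1)
qed

lemma leads_to_trans:
  assumes q: "q \<in> wandering G" and pq: "leads_to G p q" and qr: "leads_to G q r"
  shows "leads_to G p r"
  unfolding leads_to_iff
proof (intro allI impI)
  fix H N assume H: "finite H \<and> H \<subseteq> verts G"
  obtain N0 where N0: "\<And>i. N0 \<le> i \<Longrightarrow> tail G (q i) \<notin> H" using wandering_leaves[OF q] H by blast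
  obtain n1 n2 where n: "max N N0 \<le> n1" "max N N0 \<le> n2" "avoids_to H (tail G (p n1)) (tail G (q n2))"
    using pq H unfolding leads_to_iff by blast
  obtain n1' n2' where n': "n2 \<le> n1'" "n2 \<le> n2'" "avoids_to H (tail G (q n1')) (tail G (r n2'))"
    using qr H unfolding leads_to_iff by blast
  have "avoids_to H (tail G (q n2)) (tail G (q n1'))"
    by (rule avoids_to_segment[OF wandering_inf_path[OF q] _ n'(1)]) (use N0 n in auto)
  then have "avoids_to H (tail G (p n1)) (tail G (r n2'))"
    using n(3) n'(3) avoids_to_trans by blast
  moreover have "N \<le> n1" "N \<le> n2'" using n n' by auto
  ultimately show "\<exists>n1\<ge>N. \<exists>n2\<ge>N. avoids_to H (tail G (p n1)) (tail G (r n2))" by blast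
qed

lemma mem_end_class: "x \<in> end_class G p \<longleftrightarrow>
    p \<in> wandering G \<and> x \<in> wandering G \<and> leads_to G p x \<and> leads_to G x p"
  by (simp add: end_class_def end_rel_def)

lemma self_mem_end_class: "x \<in> wandering G \<Longrightarrow> x \<in> end_class G x"
  by (simp add: mem_end_class leads_to_refl)

lemma end_class_eq:
  assumes "x \<in> end_class G p"
  shows "end_class G x = end_class G p"
proof -
  have px: "p \<in> wandering G" "x \<in> wandering G" "leads_to G p x" "leads_to G x p"
    using assms by (simp_all add: mem_end_class)
  have "leads_to G x z \<longleftrightarrow> leads_to G p z" "leads_to G z x \<longleftrightarrow> leads_to G z p" if "z \<in> wandering G" for z
    using leads_to_trans px that by blast+
  with px show ?thesis by (auto simp: mem_end_class)
qed

lemma ends_image: "ends G = end_class G ` wandering G"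
  by (auto simp: ends_def quotient_def end_class_def)

lemma end_class_in_ends: "x \<in> wandering G \<Longrightarrow> end_class G x \<in> ends G"
  by (simp add: ends_image)

lemma ends_mem:
  assumes "E \<in> ends G" "x \<in> E"
  shows "x \<in> wandering G" "end_class G x = E"
proof -
  obtain p where "E = end_class G p" using assms(1) unfolding ends_image by blast
  with assms(2) have "x \<in> end_class G p" by simp
  then show "x \<in> wandering G" "end_class G x = E"
    using end_class_eq \<open>E = end_class G p\<close> by (simp_all add: mem_end_class)
qed

lemma exit_paths_extend:
  assumes "exit_paths G H v w \<noteq> {}" "avoids_to H w w'"
  shows "exit_paths G H v w' \<noteq> {}"
proof -
  obtain \<mu> \<rho> where \<mu>: "v \<in> H" "awalk v \<mu> w" "\<forall>a\<in>set \<mu>. head G a \<notin> H"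
    and \<rho>: "awalk w \<rho> w'" "set (awalk_verts w \<rho>) \<inter> H = {}"
    using assms unfolding exit_paths_def avoids_to_def by blast
  have "head G a \<notin> H" if "a \<in> set \<rho>" for a
    using that \<rho> unfolding set_awalk_verts[OF \<rho>(1)] by auto
  moreover have "w' \<notin> H"
    using \<rho> awlast_of_awalk[OF \<rho>(1)] last_in_set[of "awalk_verts w \<rho>"] awalk_verts_non_Nil[of w \<rho>]
    by (auto simp: NOMATCH_def)
  ultimately have "\<mu> @ \<rho> \<in> exit_paths G H v w'"
    using \<mu> awalk_appendI[OF \<mu>(2) \<rho>(1)] by (auto simp: exit_paths_def)
  then show ?thesis by blast
qed

text \<open>
  Beyond its last visit to \<open>H\<close>, the path \<open>p\<close> can be followed up to the
  start of a connection to \<open>q\<close> that avoids \<open>H\<close>.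
\<close>

lemma exit_verts_leads_to:
  assumes p: "p \<in> wandering G" and pq: "leads_to G p q" and H: "finite H" "H \<subseteq> verts G"
  shows "exit_verts G H p \<subseteq> exit_verts G H q"
proof
  fix v assume v: "v \<in> exit_verts G H p"
  obtain N0 where N0: "\<And>i. N0 \<le> i \<Longrightarrow> tail G (p i) \<notin> H" using wandering_leaves[OF p H] by blast
  have "\<exists>n\<ge>N. exit_paths G H v (tail G (q n)) \<noteq> {}" for N
  proof -
    obtain n where n: "max N N0 \<le> n" "exit_paths G H v (tail G (p n)) \<noteq> {}"
      using v unfolding exit_verts_def by blast
    obtain n1 n2 where n12: "n \<le> n1" "n \<le> n2" "avoids_to H (tail G (p n1)) (tail G (q n2))"
      using pq H unfolding leads_to_iff by blast
    have "avoids_to H (tail G (p n)) (tail G (p n1))"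
      by (rule avoids_to_segment[OF wandering_inf_path[OF p] _ n12(1)]) (use N0 n in auto)
    then have "exit_paths G H v (tail G (q n2)) \<noteq> {}"
      using n(2) n12(3) exit_paths_extend by blast
    then show ?thesis using n n12 by (intro exI[of _ n2]) auto
  qed
  with v show "v \<in> exit_verts G H q" by (simp add: exit_verts_def)
qed

lemma exit_verts_end:
  assumes "x \<in> end_class G p" "finite H" "H \<subseteq> verts G"
  shows "exit_verts G H x = exit_verts G H p"
  using assms exit_verts_leads_to unfolding mem_end_class by blast

section \<open>Measurability of the passage from paths to ends\<close>

text \<open>It suffices to test single vertices, and there are countably many.\<close>

lemma wandering_sets: "wandering G \<in> sets (path_borel G)"
proof -
  have "wandering G = {x \<in> space (path_borel G). \<forall>u\<in>verts G. \<exists>N. \<forall>i. N \<le> i \<longrightarrow> tail G (x i) \<noteq> u}"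
  proof (intro set_eqI iffI)
    fix x assume x: "x \<in> wandering G"
    have "\<exists>N. \<forall>i. N \<le> i \<longrightarrow> tail G (x i) \<noteq> u" if "u \<in> verts G" for u
      using wandering_leaves[OF x, of "{u}"] that by auto
    with x show "x \<in> {x \<in> space (path_borel G). \<forall>u\<in>verts G. \<exists>N. \<forall>i. N \<le> i \<longrightarrow> tail G (x i) \<noteq> u}"
      by (simp add: wandering_inf_path)
  next
    fix x assume x: "x \<in> {x \<in> space (path_borel G). \<forall>u\<in>verts G. \<exists>N. \<forall>i. N \<le> i \<longrightarrow> tail G (x i) \<noteq> u}"
    then obtain N where N: "\<And>u i. u \<in> verts G \<Longrightarrow> N u \<le> i \<Longrightarrow> tail G (x i) \<noteq> u"
      unfolding mem_Collect_eq by metis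
    have "\<exists>N. \<forall>i\<ge>N. tail G (x i) \<notin> H" if H: "finite H" "H \<subseteq> verts G" for H
    proof (intro exI allI impI notI)
      fix i assume i: "Max (insert 0 (N ` H)) \<le> i" and t: "tail G (x i) \<in> H"
      have "N (tail G (x i)) \<le> Max (insert 0 (N ` H))" using H t by (intro Max_ge) auto
      with i have "N (tail G (x i)) \<le> i" by simp
      with N[of "tail G (x i)" i] t H show False by auto
    qed
    with x show "x \<in> wandering G" by (simp add: wandering_def)
  qed
  also have "\<dots> \<in> sets (path_borel G)"
  proof (rule sets.sets_Collect_countable_All'[OF _ countable_verts])
    show "{x \<in> space (path_borel G). \<exists>N. \<forall>i. N \<le> i \<longrightarrow> tail G (x i) \<noteq> u} \<in> sets (path_borel G)" for u
      by measurable
  qed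
  finally show ?thesis .
qed

lemma exit_verts_sets:
  assumes H: "finite H" and I: "I \<subseteq> H"
  shows "{x \<in> space (path_borel G). exit_verts G H x = I} \<in> sets (path_borel G)"
proof -
  have "exit_verts G H x = I \<longleftrightarrow> (\<forall>v\<in>H. (\<forall>N. \<exists>n. N \<le> n \<and> exit_paths G H v (tail G (x n)) \<noteq> {}) \<longleftrightarrow> v \<in> I)" for x
    using I unfolding exit_verts_def by blast
  then have "{x \<in> space (path_borel G). exit_verts G H x = I} = {x \<in> space (path_borel G).
      \<forall>v\<in>H. (\<forall>N. \<exists>n. N \<le> n \<and> exit_paths G H v (tail G (x n)) \<noteq> {}) \<longleftrightarrow> v \<in> I}" by simp
  also have "\<dots> \<in> sets (path_borel G)"
  proof (rule sets.sets_Collect_finite_All[OF _ H])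
    fix v
    have [measurable]: "Measurable.pred (path_borel G) (\<lambda>x. exit_paths G H v (tail G (x n)) \<noteq> {})" for n
      by (rule measurable_compose[OF measurable_tail]) simp
    show "{x \<in> space (path_borel G). (\<forall>N. \<exists>n. N \<le> n \<and> exit_paths G H v (tail G (x n)) \<noteq> {}) \<longleftrightarrow> v \<in> I} \<in> sets (path_borel G)"
      by measurable
  qed
  finally show ?thesis .
qed

end

lemma generated_topology_neighbourhood:
  "generate_topology_on S U \<Longrightarrow> x \<in> U \<Longrightarrow> \<exists>T. finite T \<and> T \<subseteq> S \<and> T \<noteq> {} \<and> x \<in> \<Inter>T \<and> \<Inter>T \<subseteq> U"
proof (induction rule: generate_topology_on.induct)
  case (Int a b)
  then obtain T1 T2 where "finite T1" "T1 \<subseteq> S" "T1 \<noteq> {}" "x \<in> \<Inter>T1" "\<Inter>T1 \<subseteq> a"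
    "finite T2" "T2 \<subseteq> S" "T2 \<noteq> {}" "x \<in> \<Inter>T2" "\<Inter>T2 \<subseteq> b" by auto
  then show ?case by (intro exI[of _ "T1 \<union> T2"]) auto
next
  case (UN K)
  then obtain k where k: "k \<in> K" "x \<in> k" by blast
  from UN.IH[OF k] obtain T where "finite T" "T \<subseteq> S" "T \<noteq> {}" "x \<in> \<Inter>T" "\<Inter>T \<subseteq> k" by blast
  with k(1) show ?case by (intro exI[of _ T]) auto
next
  case (Basis s)
  then show ?case by (intro exI[of _ "{s}"]) auto
qed simp

text \<open>A countable subbase of a topology also generates its Borel sets.\<close>

lemma measurable_borel_of_generated:
  assumes S: "countable S" and f: "f \<in> space M \<rightarrow> \<Union>S"
    and pre: "\<And>s. s \<in> S \<Longrightarrow> f -` s \<inter> space M \<in> sets M"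
  shows "f \<in> M \<rightarrow>\<^sub>M borel_of (topology_generated_by S)"
  unfolding borel_of_def
proof (rule measurable_measure_of)
  show "{U. openin (topology_generated_by S) U} \<subseteq> Pow (topspace (topology_generated_by S))"
    by (rule subsetI, rule PowI, rule openin_subset, simp)
  show "f \<in> space M \<rightarrow> topspace (topology_generated_by S)"
    using f by (simp add: topology_generated_by_topspace)
  fix U assume "U \<in> {U. openin (topology_generated_by S) U}"
  then have U: "generate_topology_on S U" by (simp add: openin_topology_generated_by_iff)
  let ?B = "{T. T \<subseteq> S \<and> finite T \<and> T \<noteq> {} \<and> \<Inter>T \<subseteq> U}"
  have "U = (\<Union>T\<in>?B. \<Inter>T)"
  proof (intro set_eqI iffI)
    fix x assume "x \<in> U"
    then obtain T where "T \<in> ?B" "x \<in> \<Inter>T"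
      using generated_topology_neighbourhood[OF U, of x] by auto
    then show "x \<in> (\<Union>T\<in>?B. \<Inter>T)" by (rule UN_I)
  next
    fix x assume "x \<in> (\<Union>T\<in>?B. \<Inter>T)"
    then obtain T where "T \<in> ?B" "x \<in> \<Inter>T" by (rule UN_E)
    then show "x \<in> U" by auto
  qed
  then have "f -` U \<inter> space M = f -` (\<Union>T\<in>?B. \<Inter>T) \<inter> space M" by (rule arg_cong)
  also have "\<dots> = (\<Union>T\<in>?B. f -` (\<Inter>T) \<inter> space M)"
    by (simp only: vimage_UN UN_simps)
  also have "\<dots> \<in> sets M"
  proof (rule sets.countable_UN'')
    have "countable {T. finite T \<and> T \<subseteq> S}" using S by (rule countable_Collect_finite_subset)
    then show "countable ?B" by (rule countable_subset[rotated]) auto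
    fix T assume T: "T \<in> ?B"
    have "f -` (\<Inter>T) \<inter> space M = (\<Inter>s\<in>T. f -` s \<inter> space M)" using T by auto
    also have "\<dots> \<in> sets M" using T pre by (intro sets.finite_INT) auto
    finally show "f -` (\<Inter>T) \<inter> space M \<in> sets M" .
  qed
  finally show "f -` U \<inter> space M \<in> sets M" .
qed

lemma measurable_borel_of_subtopology:
  assumes f: "f \<in> M \<rightarrow>\<^sub>M borel_of X" and S: "f ` space M \<subseteq> S"
  shows "f \<in> M \<rightarrow>\<^sub>M borel_of (subtopology X S)"
  unfolding borel_of_def[of "subtopology X S"]
proof (rule measurable_measure_of)
  show "{U. openin (subtopology X S) U} \<subseteq> Pow (topspace (subtopology X S))"
    by (rule subsetI, rule PowI, rule openin_subset, simp)
  show "f \<in> space M \<rightarrow> topspace (subtopology X S)"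
    using S measurable_space[OF f] by auto
  fix U assume "U \<in> {U. openin (subtopology X S) U}"
  then obtain V where V: "openin X V" "U = V \<inter> S" by (auto simp: openin_subtopology)
  have "f -` U \<inter> space M = f -` V \<inter> space M" using S V(2) by auto
  also have "\<dots> \<in> sets M" by (rule measurable_sets[OF f openin_sets_borel_of[OF V(1)]])
  finally show "f -` U \<inter> space M \<in> sets M" .
qed

lemma measurable_id_subtopology: "(\<lambda>x. x) \<in> borel_of (subtopology X S) \<rightarrow>\<^sub>M borel_of X"
  unfolding borel_of_def[of X]
proof (rule measurable_measure_of)
  show "{U. openin X U} \<subseteq> Pow (topspace X)" by (rule subsetI, rule PowI, rule openin_subset, simp)
  show "(\<lambda>x. x) \<in> space (borel_of (subtopology X S)) \<rightarrow> topspace X" by simp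
  fix U assume "U \<in> {U. openin X U}"
  then have U: "openin X U" by simp
  have "(\<lambda>x. x) -` U \<inter> space (borel_of (subtopology X S)) = U \<inter> S"
    using openin_subset[OF U] by auto
  also have "\<dots> \<in> sets (borel_of (subtopology X S))"
    using U by (intro openin_sets_borel_of) (auto simp: openin_subtopology)
  finally show "(\<lambda>x. x) -` U \<inter> space (borel_of (subtopology X S)) \<in> sets (borel_of (subtopology X S))" .
qed

context countable_digraph
begin

abbreviation end_borel :: "(nat \<Rightarrow> 'b) set measure" where
  "end_borel \<equiv> borel_of (end_topology G)"

lemma topspace_end_topology:
  assumes "verts G \<noteq> {}"
  shows "topspace (end_topology G) = ends G"
proof -
  obtain v where v: "v \<in> verts G" using assms by blast
  have "E \<in> \<Union> {end_class G ` {p \<in> wandering G. exit_verts G H p = I} | H I.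
        finite H \<and> H \<subseteq> verts G \<and> H \<noteq> {} \<and> I \<subseteq> H}" if E: "E \<in> ends G" for E
  proof -
    obtain p where p: "p \<in> wandering G" "E = end_class G p" using E unfolding ends_image by blast
    then have "E \<in> end_class G ` {q \<in> wandering G. exit_verts G {v} q = exit_verts G {v} p}" by auto
    moreover have "exit_verts G {v} p \<subseteq> {v}" by (auto simp: exit_verts_def)
    ultimately show ?thesis using v by blast
  qed
  then show ?thesis
    unfolding end_topology_def topology_generated_by_topspace by (auto simp: ends_image)
qed

text \<open>
  The topology of the end space has a countable subbase, whose preimages are determined by
  \<open>exit_verts\<close>.
\<close>

lemma end_class_measurable:
  assumes "verts G \<noteq> {}"
  shows "end_class G \<in> restrict_space (path_borel G) (wandering G) \<rightarrow>\<^sub>M end_borel"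
  unfolding end_topology_def
proof (rule measurable_borel_of_generated)
  let ?F = "{H. finite H \<and> H \<subseteq> verts G}"
  let ?S = "{end_class G ` {p \<in> wandering G. exit_verts G H p = I} | H I.
        finite H \<and> H \<subseteq> verts G \<and> H \<noteq> {} \<and> I \<subseteq> H}"
  have "countable ?F" using countable_verts by (rule countable_Collect_finite_subset)
  then have "countable ((\<lambda>(H, I). end_class G ` {p \<in> wandering G. exit_verts G H p = I}) ` (?F \<times> ?F))"
    by (intro countable_image countable_SIGMA)
  moreover have "?S \<subseteq> (\<lambda>(H, I). end_class G ` {p \<in> wandering G. exit_verts G H p = I}) ` (?F \<times> ?F)"
  proof
    fix s assume "s \<in> ?S"
    then obtain H I where H: "finite H" "H \<subseteq> verts G" "I \<subseteq> H"
      and s: "s = end_class G ` {p \<in> wandering G. exit_verts G H p = I}" by blast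
    then have "(H, I) \<in> ?F \<times> ?F" using finite_subset[of I H] by auto
    then show "s \<in> (\<lambda>(H, I). end_class G ` {p \<in> wandering G. exit_verts G H p = I}) ` (?F \<times> ?F)"
      by (rule rev_image_eqI) (simp add: s)
  qed
  ultimately show "countable ?S" by (rule countable_subset[rotated])
  show "end_class G \<in> space (restrict_space (path_borel G) (wandering G)) \<rightarrow> \<Union>?S"
    using topspace_end_topology[OF assms] end_class_in_ends
    unfolding end_topology_def topology_generated_by_topspace by (auto simp: space_restrict_space)
  fix s assume "s \<in> ?S"
  then obtain H I where H: "finite H" "H \<subseteq> verts G" "I \<subseteq> H"
    and s: "s = end_class G ` {p \<in> wandering G. exit_verts G H p = I}" by blast
  have "end_class G -` s \<inter> space (restrict_space (path_borel G) (wandering G))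
      = wandering G \<inter> {x \<in> space (path_borel G). exit_verts G H x = I}"
  proof (intro set_eqI iffI)
    fix x assume "x \<in> end_class G -` s \<inter> space (restrict_space (path_borel G) (wandering G))"
    then obtain p where x: "x \<in> wandering G" and p: "end_class G x = end_class G p" "exit_verts G H p = I"
      unfolding s by (auto simp: space_restrict_space)
    then have "exit_verts G H x = I"
      using exit_verts_end[OF _ H(1,2), of x p] self_mem_end_class[OF x] by simp
    with x show "x \<in> wandering G \<inter> {x \<in> space (path_borel G). exit_verts G H x = I}"
      by (simp add: wandering_inf_path)
  next
    fix x assume "x \<in> wandering G \<inter> {x \<in> space (path_borel G). exit_verts G H x = I}"
    then show "x \<in> end_class G -` s \<inter> space (restrict_space (path_borel G) (wandering G))"
      unfolding s by (auto simp: space_restrict_space)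
  qed
  then show "end_class G -` s \<inter> space (restrict_space (path_borel G) (wandering G))
      \<in> sets (restrict_space (path_borel G) (wandering G))"
    using exit_verts_sets[OF H(1,3)] by (auto simp: sets_restrict_space)
qed

lemma shift_wandering:
  assumes x: "x \<in> inf_paths G"
  shows "shift x \<in> wandering G \<longleftrightarrow> x \<in> wandering G"
proof -
  have "(\<exists>N. \<forall>i\<ge>N. tail G (shift x i) \<notin> H) \<longleftrightarrow> (\<exists>N. \<forall>i\<ge>N. tail G (x i) \<notin> H)" for H
  proof
    assume "\<exists>N. \<forall>i\<ge>N. tail G (shift x i) \<notin> H"
    then obtain N where N: "\<And>i. N \<le> i \<Longrightarrow> tail G (x (Suc i)) \<notin> H" by (auto simp: shift_nth)
    have "tail G (x i) \<notin> H" if "Suc N \<le> i" for i using N[of "i - 1"] that by (cases i) auto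
    then show "\<exists>N. \<forall>i\<ge>N. tail G (x i) \<notin> H" by blast
  next
    assume "\<exists>N. \<forall>i\<ge>N. tail G (x i) \<notin> H"
    then obtain N where "\<forall>i\<ge>N. tail G (x i) \<notin> H" by blast
    then show "\<exists>N. \<forall>i\<ge>N. tail G (shift x i) \<notin> H" by (intro exI[of _ N]) (auto simp: shift_nth)
  qed
  then show ?thesis using x shift_inf_paths[OF x] by (simp add: wandering_def)
qed

end

section \<open>Decomposition along the ends\<close>

locale end_selected_digraph = transient_digraph G F \<beta> v0
  for G :: "('a, 'b) pre_digraph" (structure) and F \<beta> v0 +
  fixes \<xi> :: "(nat \<Rightarrow> 'b) set \<Rightarrow> (nat \<Rightarrow> 'b)"
  assumes selector: "end_selector G \<xi>"
begin

lemma topspace_ends [simp]: "topspace (end_topology G) = ends G"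
  using topspace_end_topology v0 by auto

lemma space_end_borel: "space end_borel = ends G"
  by simp

lemma selector_measurable:
  "\<xi> \<in> end_borel \<rightarrow>\<^sub>M borel_of (subtopology (path_topology G) (reduced_rays G))"
  and selector_basin: "E \<in> ends G \<Longrightarrow> ray_basin G (\<xi> E) = E"
  using selector unfolding end_selector_def by blast+

lemma selector_reduced: "E \<in> ends G \<Longrightarrow> \<xi> E \<in> reduced_rays G"
  using measurable_space[OF selector_measurable, of E] unfolding space_end_borel by simp

lemma selector_ray: "E \<in> ends G \<Longrightarrow> \<xi> E \<in> rays G"
  using selector_reduced[of E] by (simp add: reduced_rays_def)

lemma openin_tail: "openin (path_topology G) {p \<in> inf_paths G. tail G (p j) \<in> A}"
proof -
  have "{p \<in> inf_paths G. tail G (p j) \<in> A} = \<Union> (cyl ` {\<nu>. j < length \<nu> \<and> tail G (\<nu> ! j) \<in> A})"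
  proof (intro set_eqI iffI)
    fix p assume "p \<in> {p \<in> inf_paths G. tail G (p j) \<in> A}"
    then show "p \<in> \<Union> (cyl ` {\<nu>. j < length \<nu> \<and> tail G (\<nu> ! j) \<in> A})"
      by (intro UN_I[of "map p [0..<Suc j]"]) (auto simp: cyl_def starts_with_prefix nth_append simp del: upt_Suc)
  qed (auto simp: cyl_def starts_with_nth)
  then show ?thesis using openin_cyl by auto
qed

lemma selector_tail_measurable: "(\<lambda>E. tail G (\<xi> E j)) \<in> end_borel \<rightarrow>\<^sub>M count_space UNIV"
proof (rule measurableI)
  fix A :: "'a set"
  let ?R = "subtopology (path_topology G) (reduced_rays G)"
  let ?V = "{p \<in> inf_paths G. tail G (p j) \<in> A} \<inter> reduced_rays G"
  have V: "?V \<in> sets (borel_of ?R)"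
    using openin_tail by (intro openin_sets_borel_of) (auto simp: openin_subtopology)
  from measurable_sets[OF selector_measurable V] have "\<xi> -` ?V \<inter> space end_borel \<in> sets end_borel" .
  also have "\<xi> -` ?V \<inter> space end_borel = (\<lambda>E. tail G (\<xi> E j)) -` A \<inter> space end_borel"
    using selector_reduced selector_ray rays_inf_path unfolding space_end_borel by blast
  finally show "(\<lambda>E. tail G (\<xi> E j)) -` A \<inter> space end_borel \<in> sets end_borel" .
qed simp

lemma kernel_selector_measurable: "(\<lambda>E. kernel k v (\<xi> E)) \<in> borel_measurable end_borel"
proof (rule measurable_vertex_local[where n="Suc k" and f="\<lambda>y _. kernel k v y"])
  show "tail G (\<xi> E j) \<in> verts G" if "E \<in> space end_borel" for E j
    using that selector_ray rays_inf_path inf_paths_tail unfolding space_end_borel by blast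
  show "kernel k v y = kernel k v y'" if "\<And>j. j < Suc k \<Longrightarrow> tail G (y j) = tail G (y' j)" for y y'
    by (rule kernel_local[OF that])
qed (auto simp: selector_tail_measurable)

lemma potential_selector_measurable:
  assumes v: "v \<in> verts G"
  shows "(\<lambda>E. potential v (\<xi> E)) \<in> borel_measurable end_borel"
proof -
  have "(\<lambda>E. SUP k. kernel k v (\<xi> E)) \<in> borel_measurable end_borel"
    using kernel_selector_measurable by (intro borel_measurable_SUP) auto
  then show ?thesis
    by (subst measurable_cong[of _ _ "\<lambda>E. SUP k. kernel k v (\<xi> E)"])
       (simp_all add: potential_SUP[OF selector_ray v])
qed

abbreviation "good_ends \<equiv> summable_ends G F \<beta> v0 \<xi>"

lemma summable_iff: "E \<in> good_ends \<longleftrightarrow> E \<in> ends G \<and> potential v0 (\<xi> E) < \<top>"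
  using selector_ray by (auto simp: summable_ends_def summable_rays_def)

lemma summable_sets: "good_ends \<in> sets end_borel"
proof -
  note potential_selector_measurable[OF v0, measurable]
  have "good_ends = {E \<in> space end_borel. potential v0 (\<xi> E) < \<top>}"
    using summable_iff by (auto simp: space_end_borel)
  also have "\<dots> \<in> sets end_borel" by measurable
  finally show ?thesis .
qed

text \<open>The Martin kernel of an end, normalized at \<open>v0\<close>.\<close>

definition ratio :: "'a \<Rightarrow> (nat \<Rightarrow> 'b) set \<Rightarrow> ennreal" where
  "ratio v E = potential v (\<xi> E) / potential v0 (\<xi> E)"

lemma ratio_measurable: "v \<in> verts G \<Longrightarrow> ratio v \<in> borel_measurable end_borel"
  unfolding ratio_def[abs_def] using potential_selector_measurable v0
  by (intro borel_measurable_divide_ennreal) auto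

lemma ratio_potential:
  assumes "E \<in> good_ends"
  shows "potential v0 (\<xi> E) * ratio v E = potential v (\<xi> E)"
proof -
  have r: "\<xi> E \<in> rays G" using assms selector_ray by (simp add: summable_iff)
  have "potential v0 (\<xi> E) \<noteq> 0" "potential v0 (\<xi> E) \<noteq> \<top>"
    using assms potential_pos[OF r] by (auto simp: summable_iff)
  from ennreal_inverse_mult_self[OF this] show ?thesis
    unfolding ratio_def divide_ennreal_def by (metis mult.assoc mult.commute mult.right_neutral)
qed

text \<open>
  A path from \<open>v0\<close> to \<open>v\<close> bounds the kernel at \<open>v\<close> by the one
  at \<open>v0\<close>, uniformly over all ends.
\<close>

lemma ratio_bounded:
  assumes "v \<in> verts G"
  shows "\<exists>c<\<top>. \<forall>E\<in>good_ends. ratio v E \<le> c"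
proof -
  obtain \<mu> where \<mu>: "awalk v0 \<mu> v" using reachable[OF assms] by blast
  have "ratio v E \<le> inverse (weight \<mu>)" if E: "E \<in> good_ends" for E
  proof -
    let ?p = "potential v0 (\<xi> E)"
    have r: "\<xi> E \<in> rays G" using E selector_ray by (simp add: summable_iff)
    have p: "?p \<noteq> 0" "?p \<noteq> \<top>" using E potential_pos[OF r] by (auto simp: summable_iff)
    have "potential v (\<xi> E) = inverse (weight \<mu>) * (weight \<mu> * potential v (\<xi> E))"
      using ennreal_inverse_mult_self[of "weight \<mu>"] by (simp add: mult.assoc[symmetric])
    also have "\<dots> \<le> inverse (weight \<mu>) * ?p"
      by (intro mult_left_mono potential_factor_le[OF r \<mu>]) simp
    finally have "ratio v E \<le> inverse (weight \<mu>) * ?p * inverse ?p"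
      unfolding ratio_def divide_ennreal_def by (rule mult_right_mono) simp
    also have "\<dots> = inverse (weight \<mu>)"
      using ennreal_inverse_mult_self[OF p] by (simp add: mult.assoc mult.commute[of ?p])
    finally show ?thesis .
  qed
  moreover have "inverse (weight \<mu>) \<noteq> \<top>" by simp
  then have "inverse (weight \<mu>) < \<top>" using less_top by blast
  ultimately show ?thesis by blast
qed

subsection \<open>The field of rays given by the selector\<close>

text \<open>
  Off the wandering paths, a constant sequence whose vertices belong to the digraph keeps the
  function globally measurable.
\<close>

definition end_ray :: "(nat \<Rightarrow> 'b) \<Rightarrow> (nat \<Rightarrow> 'b)" where
  "end_ray x = (if x \<in> wandering G then \<xi> (end_class G x) else (\<lambda>_. SOME a. a \<in> arcs G))"

lemma end_ray_basin: "x \<in> wandering G \<Longrightarrow> x \<in> ray_basin G (end_ray x)"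
  by (simp add: end_ray_def selector_basin end_class_in_ends self_mem_end_class)

text \<open>The end of \<open>x\<close> is a \<open>ray_basin\<close>, and those are shift invariant.\<close>

lemma end_class_shift:
  assumes x: "x \<in> wandering G"
  shows "end_class G (shift x) = end_class G x"
proof -
  let ?E = "end_class G x"
  have E: "?E \<in> ends G" by (rule end_class_in_ends[OF x])
  have "x \<in> ray_basin G (\<xi> ?E)" using selector_basin[OF E] self_mem_end_class[OF x] by simp
  then have "shift x \<in> ray_basin G (\<xi> ?E)"
    using ray_basin_shift[OF selector_ray[OF E] wandering_inf_path[OF x], of 1] by simp
  then have "shift x \<in> ?E" using selector_basin[OF E] by simp
  then show ?thesis by (rule ends_mem(2)[OF E])
qed

lemma end_class_measurable': "end_class G \<in> restrict_space (path_borel G) (wandering G) \<rightarrow>\<^sub>M end_borel"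
  using v0 by (intro end_class_measurable) auto

lemma wandering_Collect_sets: "{x \<in> inf_paths G. x \<in> wandering G} \<in> sets (path_borel G)"
proof -
  have "{x \<in> inf_paths G. x \<in> wandering G} = wandering G" using wandering_inf_path by auto
  then show ?thesis using wandering_sets by simp
qed

lemma end_ray_field: "ray_field (wandering G) end_ray"
  unfolding ray_field_def
proof (intro conjI ballI allI)
  show "wandering G \<in> sets (path_borel G)" by (rule wandering_sets)
  show "shift x \<in> wandering G \<longleftrightarrow> x \<in> wandering G" if "x \<in> inf_paths G" for x
    by (rule shift_wandering[OF that])
  show "end_ray x \<in> rays G" if "x \<in> wandering G" for x
    using that selector_ray end_class_in_ends by (simp add: end_ray_def)
  show "end_ray (shift x) = end_ray x" if "x \<in> inf_paths G" for x
    using shift_wandering[OF that] end_class_shift by (simp add: end_ray_def)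
  show "tail G (end_ray x j) \<in> verts G" if x: "x \<in> inf_paths G" for x j
  proof (cases "x \<in> wandering G")
    case True
    then show ?thesis
      using inf_paths_tail[OF rays_inf_path[OF selector_ray[OF end_class_in_ends[OF True]]]]
      by (simp add: end_ray_def)
  next
    case False
    have "(SOME a. a \<in> arcs G) \<in> arcs G" by (rule someI[where P="\<lambda>a. a \<in> arcs G", OF inf_paths_arc[OF x, of 0]])
    with False show ?thesis by (simp add: end_ray_def)
  qed
  show "(\<lambda>x. tail G (end_ray x j)) \<in> path_borel G \<rightarrow>\<^sub>M count_space UNIV" for j
  proof -
    have "(\<lambda>x. tail G (\<xi> (end_class G x) j)) \<in> restrict_space (path_borel G) (wandering G) \<rightarrow>\<^sub>M count_space UNIV"
      by (rule measurable_compose[OF end_class_measurable' selector_tail_measurable])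
    then have "(\<lambda>x. if x \<in> wandering G then tail G (\<xi> (end_class G x) j) else tail G (SOME a. a \<in> arcs G))
        \<in> path_borel G \<rightarrow>\<^sub>M count_space UNIV"
      using wandering_Collect_sets
      by (subst measurable_If_restrict_space_iff) auto
    moreover have "(\<lambda>x. tail G (end_ray x j)) = (\<lambda>x. if x \<in> wandering G then tail G (\<xi> (end_class G x) j)
        else tail G (SOME a. a \<in> arcs G))"
      by (auto simp: end_ray_def)
    ultimately show ?thesis by simp
  qed
qed

definition lift_end :: "((nat \<Rightarrow> 'b) set \<Rightarrow> ennreal) \<Rightarrow> (nat \<Rightarrow> 'b) \<Rightarrow> ennreal" where
  "lift_end \<phi> x = (if x \<in> wandering G then \<phi> (end_class G x) else 0)"

lemma lift_end_measurable:
  assumes "\<phi> \<in> borel_measurable end_borel"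
  shows "lift_end \<phi> \<in> borel_measurable (path_borel G)"
proof -
  have "(\<lambda>x. \<phi> (end_class G x)) \<in> borel_measurable (restrict_space (path_borel G) (wandering G))"
    by (rule measurable_compose[OF end_class_measurable' assms])
  then show ?thesis
    unfolding lift_end_def[abs_def] using wandering_Collect_sets
    by (subst measurable_If_restrict_space_iff) auto
qed

lemma lift_end_invariant:
  assumes "\<phi> \<in> borel_measurable end_borel"
  shows "invariant (lift_end \<phi>)"
  unfolding invariant_def
proof (intro conjI ballI)
  show "lift_end \<phi> \<in> borel_measurable (path_borel G)" by (rule lift_end_measurable[OF assms])
  show "lift_end \<phi> (shift x) = lift_end \<phi> x" if "x \<in> inf_paths G" for x
    using shift_wandering[OF that] end_class_shift by (simp add: lift_end_def)
qed

abbreviation followers :: "(nat \<Rightarrow> 'b) set" where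
  "followers \<equiv> exit_follow (wandering G) end_ray 0"

lemma followers_wandering: "x \<in> followers \<Longrightarrow> x \<in> wandering G"
  by (simp add: exit_follow_def[OF end_ray_field])

text \<open>
  The formula \<open>ray_field_formula\<close> for the selected rays: a wandering path belongs to
  the basin of the ray selected for its own end.
\<close>

lemma end_formula:
  assumes m: "conformal m" and v: "v \<in> verts G" and \<phi>: "\<phi> \<in> borel_measurable end_borel"
  shows "(\<integral>\<^sup>+x. of_bool (tail G (x 0) = v) * lift_end \<phi> x \<partial>m)
    = (\<integral>\<^sup>+x. of_bool (x \<in> followers) * lift_end (\<lambda>E. potential v (\<xi> E) * \<phi> E) x \<partial>m)"
proof -
  have "(\<integral>\<^sup>+x. of_bool (tail G (x 0) = v) * lift_end \<phi> x \<partial>m)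
      = (\<integral>\<^sup>+x. of_bool (tail G (x 0) = v \<and> x \<in> wandering G \<and> x \<in> ray_basin G (end_ray x)) * lift_end \<phi> x \<partial>m)"
    using end_ray_basin by (intro nn_integral_cong) (simp add: lift_end_def)
  also have "\<dots> = (\<integral>\<^sup>+x. of_bool (x \<in> followers) * (potential v (end_ray x) * lift_end \<phi> x) \<partial>m)"
    by (rule ray_field_formula[OF end_ray_field m v lift_end_invariant[OF \<phi>]])
  also have "\<dots> = (\<integral>\<^sup>+x. of_bool (x \<in> followers) * lift_end (\<lambda>E. potential v (\<xi> E) * \<phi> E) x \<partial>m)"
    using followers_wandering by (intro nn_integral_cong) (simp add: lift_end_def end_ray_def)
  finally show ?thesis .
qed

definition summable_paths :: "(nat \<Rightarrow> 'b) set" where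
  "summable_paths = {x \<in> wandering G. end_class G x \<in> good_ends}"

text \<open>
  Otherwise the kernel would be infinite on a set of positive measure of followers, and the paths
  from \<open>v0\<close> would have infinite measure.
\<close>

lemma AE_summable:
  assumes m: "m \<in> normalized_conformal_measures G F \<beta> v0"
  shows "AE x in m. x \<in> summable_paths"
proof -
  note cm = normalizedD[OF m]
  note conformal_sets[OF cm(1), measurable_cong]
  let ?\<phi> = "\<lambda>E. of_bool (E \<notin> good_ends) :: ennreal"
  have \<phi>: "?\<phi> \<in> borel_measurable end_borel"
  proof -
    have [measurable]: "good_ends \<in> sets end_borel" by (rule summable_sets)
    show ?thesis by measurable
  qed
  have meas: "(\<lambda>x. of_bool (x \<in> followers) * lift_end (\<lambda>E. potential v (\<xi> E) * ?\<phi> E) x) \<in> borel_measurable (path_borel G)"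
    if v: "v \<in> verts G" for v
  proof -
    note exit_follow_sets[OF end_ray_field, measurable]
    have "(\<lambda>E. potential v (\<xi> E) * ?\<phi> E) \<in> borel_measurable end_borel"
      by (intro borel_measurable_times_ennreal potential_selector_measurable v \<phi>)
    note lift_end_measurable[OF this, measurable]
    show ?thesis by measurable
  qed
  let ?f = "\<lambda>x. of_bool (x \<in> followers) * lift_end (\<lambda>E. potential v0 (\<xi> E) * ?\<phi> E) x"
  have "integral\<^sup>N m ?f = (\<integral>\<^sup>+x. of_bool (tail G (x 0) = v0) * lift_end ?\<phi> x \<partial>m)"
    by (rule end_formula[OF cm(1) v0 \<phi>, symmetric])
  also have "\<dots> \<le> (\<integral>\<^sup>+x. indicator (cyl_vert G v0) x \<partial>m)"
    by (intro nn_integral_mono) (auto simp: lift_end_def cyl_vert_def wandering_inf_path)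
  also have "\<dots> = 1" using cm(2) conformal_sets[OF cm(1)] by simp
  finally have le: "integral\<^sup>N m ?f \<le> 1" .
  have "integral\<^sup>N m ?f \<noteq> \<infinity>"
  proof
    assume "integral\<^sup>N m ?f = \<infinity>"
    with le show False by (simp add: top_unique)
  qed
  then have "AE x in m. ?f x \<noteq> \<infinity>"
    using meas[OF v0] by (intro nn_integral_noteq_infinite) (auto simp: measurable_cong_sets[OF conformal_sets[OF cm(1)] refl])
  then have AE_f: "AE x in m. x \<notin> followers \<or> end_class G x \<in> good_ends"
  proof eventually_elim
    case (elim x)
    show ?case
    proof (rule ccontr)
      assume c: "\<not> (x \<notin> followers \<or> end_class G x \<in> good_ends)"
      then have x: "x \<in> wandering G" using followers_wandering by blast
      then have "potential v0 (\<xi> (end_class G x)) = \<top>"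
        using c end_class_in_ends[OF x] less_top unfolding summable_iff by blast
      with elim c x show False by (simp add: lift_end_def)
    qed
  qed
  have "AE x in m. tail G (x 0) = v \<longrightarrow> x \<in> wandering G \<longrightarrow> end_class G x \<in> good_ends" if v: "v \<in> verts G" for v
  proof -
    let ?g = "\<lambda>x. of_bool (tail G (x 0) = v) * lift_end ?\<phi> x"
    have "integral\<^sup>N m ?g = (\<integral>\<^sup>+x. of_bool (x \<in> followers) * lift_end (\<lambda>E. potential v (\<xi> E) * ?\<phi> E) x \<partial>m)"
      by (rule end_formula[OF cm(1) v \<phi>])
    also have "\<dots> = (\<integral>\<^sup>+x. 0 \<partial>m)"
      by (rule nn_integral_cong_AE) (use AE_f in eventually_elim, auto simp: lift_end_def)
    finally have "integral\<^sup>N m ?g = 0" by simp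
    moreover have "?g \<in> borel_measurable m"
      using lift_end_measurable[OF \<phi>] by measurable
    ultimately have "AE x in m. ?g x = 0" by (simp add: nn_integral_0_iff_AE)
    then show ?thesis by eventually_elim (auto simp: lift_end_def)
  qed
  then have "AE x in m. \<forall>v\<in>verts G. tail G (x 0) = v \<longrightarrow> x \<in> wandering G \<longrightarrow> end_class G x \<in> good_ends"
    unfolding AE_ball_countable[OF countable_verts] by blast
  with AE_wandering[OF cm(1)] show ?thesis
  proof eventually_elim
    case (elim x)
    then show ?case
      using inf_paths_tail[OF wandering_inf_path, of x 0] by (auto simp: summable_paths_def)
  qed
qed

subsection \<open>The correspondence\<close>

abbreviation "good_end_borel \<equiv> summable_end_borel G F \<beta> v0 \<xi>"

lemma space_N: "space good_end_borel = good_ends"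
  using topspace_end_topology v0 summable_iff by (auto simp: summable_end_borel_def)

lemma measurable_on_N: "f \<in> end_borel \<rightarrow>\<^sub>M K \<Longrightarrow> f \<in> good_end_borel \<rightarrow>\<^sub>M K"
  using measurable_compose[OF measurable_id_subtopology] by (simp add: summable_end_borel_def)

lemma summable_paths_sets: "summable_paths \<in> sets (path_borel G)"
proof -
  have "end_class G -` good_ends \<inter> space (restrict_space (path_borel G) (wandering G))
      \<in> sets (restrict_space (path_borel G) (wandering G))"
    by (rule measurable_sets[OF end_class_measurable' summable_sets])
  moreover have "end_class G -` good_ends \<inter> space (restrict_space (path_borel G) (wandering G)) = summable_paths"
    using wandering_inf_path by (auto simp: summable_paths_def space_restrict_space)
  ultimately show ?thesis
    using wandering_sets by (auto simp: sets_restrict_space)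
qed

abbreviation start_paths :: "(nat \<Rightarrow> 'b) set" where
  "start_paths \<equiv> summable_paths \<inter> cyl_vert G v0"

lemma end_class_N_measurable: "end_class G \<in> restrict_space (path_borel G) start_paths \<rightarrow>\<^sub>M good_end_borel"
  unfolding summable_end_borel_def
proof (rule measurable_borel_of_subtopology)
  show "end_class G \<in> restrict_space (path_borel G) start_paths \<rightarrow>\<^sub>M end_borel"
    by (rule measurable_restrict_mono[OF end_class_measurable']) (auto simp: summable_paths_def)
  show "end_class G ` space (restrict_space (path_borel G) start_paths) \<subseteq> good_ends"
    by (auto simp: space_restrict_space summable_paths_def)
qed

text \<open>The distribution of the end of a path from \<open>v0\<close>.\<close>

definition end_distribution :: "(nat \<Rightarrow> 'b) measure \<Rightarrow> (nat \<Rightarrow> 'b) set measure" where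
  "end_distribution m = distr (restrict_space m start_paths) good_end_borel (end_class G)"

lemma sets_end_distribution [simp]: "sets (end_distribution m) = sets good_end_borel"
  by (simp add: end_distribution_def)

context
  fixes m :: "(nat \<Rightarrow> 'b) measure"
  assumes m_sets: "sets m = sets (path_borel G)"
begin

lemma m_space: "space m = inf_paths G"
  using sets_eq_imp_space_eq[OF m_sets] by simp

lemma end_class_m: "end_class G \<in> restrict_space m start_paths \<rightarrow>\<^sub>M good_end_borel"
  using end_class_N_measurable
  by (simp add: measurable_cong_sets[OF sets_restrict_space_cong[OF m_sets] refl])

lemma start_paths_sets: "start_paths \<inter> space m \<in> sets m"
  using summable_paths_sets by (simp add: m_sets m_space[symmetric] sets.Int)

lemma start_vimage_sets:
  assumes "C \<in> sets good_end_borel"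
  shows "{x \<in> start_paths. end_class G x \<in> C} \<in> sets (path_borel G)"
proof -
  have "end_class G -` C \<inter> space (restrict_space (path_borel G) start_paths)
      \<in> sets (restrict_space (path_borel G) start_paths)"
    by (rule measurable_sets[OF end_class_N_measurable assms])
  moreover have "end_class G -` C \<inter> space (restrict_space (path_borel G) start_paths) = {x \<in> start_paths. end_class G x \<in> C}"
    by (auto simp: space_restrict_space cyl_vert_def)
  moreover have "start_paths \<in> sets (path_borel G)" using summable_paths_sets by auto
  ultimately show ?thesis by (auto simp: sets_restrict_space)
qed

lemma emeasure_end_distribution:
  assumes C: "C \<in> sets good_end_borel"
  shows "emeasure (end_distribution m) C = emeasure m {x \<in> start_paths. end_class G x \<in> C}"
proof -
  have eq: "end_class G -` C \<inter> space (restrict_space m start_paths) = {x \<in> start_paths. end_class G x \<in> C}"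
    by (auto simp: space_restrict_space cyl_vert_def m_space)
  have "emeasure (end_distribution m) C = emeasure (restrict_space m start_paths) {x \<in> start_paths. end_class G x \<in> C}"
    unfolding end_distribution_def by (subst emeasure_distr[OF end_class_m C]) (simp only: eq)
  also have "\<dots> = emeasure m {x \<in> start_paths. end_class G x \<in> C}"
    by (rule emeasure_restrict_space[OF start_paths_sets]) auto
  finally show ?thesis .
qed

lemma nn_integral_end_distribution:
  assumes f: "f \<in> borel_measurable good_end_borel"
  shows "(\<integral>\<^sup>+E. f E \<partial>end_distribution m) = (\<integral>\<^sup>+x. f (end_class G x) * indicator start_paths x \<partial>m)"
proof -
  have "f \<in> borel_measurable (distr (restrict_space m start_paths) good_end_borel (end_class G))"
    using f by simp
  from nn_integral_distr[OF end_class_m this] show ?thesis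
    unfolding end_distribution_def nn_integral_restrict_space[OF start_paths_sets] .
qed

end

lemma emeasure_start_paths:
  assumes m: "m \<in> normalized_conformal_measures G F \<beta> v0"
  shows "emeasure m start_paths = 1"
proof -
  note cm = normalizedD[OF m]
  have "emeasure m start_paths = emeasure m (cyl_vert G v0)"
    by (rule emeasure_eq_AE)
       (use AE_summable[OF m] in eventually_elim, simp_all add: conformal_sets[OF cm(1)] summable_paths_sets sets.Int)
  then show ?thesis using cm(2) by simp
qed

lemma end_distribution_prob:
  assumes m: "m \<in> normalized_conformal_measures G F \<beta> v0"
  shows "end_distribution m \<in> prob_measures_on good_end_borel"
proof -
  note cm = normalizedD[OF m]
  have "space (end_distribution m) = space good_end_borel" by (rule sets_eq_imp_space_eq) simp
  then have "emeasure (end_distribution m) (space (end_distribution m))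
      = emeasure m {x \<in> start_paths. end_class G x \<in> space good_end_borel}"
    using emeasure_end_distribution[OF conformal_sets[OF cm(1)] sets.top[of good_end_borel]] by simp
  also have "{x \<in> start_paths. end_class G x \<in> space good_end_borel} = start_paths"
    unfolding space_N by (auto simp: summable_paths_def)
  also have "emeasure m start_paths = 1" by (rule emeasure_start_paths[OF m])
  finally have "prob_space (end_distribution m)" by (rule prob_spaceI)
  then show ?thesis by (simp add: prob_measures_on_def)
qed

abbreviation em :: "(nat \<Rightarrow> 'b) set \<Rightarrow> (nat \<Rightarrow> 'b) measure" where
  "em \<equiv> end_measure G F \<beta> v0 \<xi>"

lemma em_props:
  assumes E: "E \<in> good_ends"
  shows "em E \<in> normalized_conformal_measures G F \<beta> v0" "concentrated_on (em E) E"
    "v \<in> verts G \<Longrightarrow> emeasure (em E) (cyl_vert G v) = ratio v E"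
proof -
  have e: "E \<in> ends G" and f: "potential v0 (\<xi> E) < \<top>" using E by (simp_all add: summable_iff)
  note p = ray_measure_props[OF selector_ray[OF e] f]
  show "em E \<in> normalized_conformal_measures G F \<beta> v0" using p(1) by (simp add: end_measure_def)
  show "concentrated_on (em E) E" using p(2) by (simp add: end_measure_def selector_basin[OF e])
  show "emeasure (em E) (cyl_vert G v) = ratio v E" if "v \<in> verts G"
    using p(3)[OF that] by (simp add: end_measure_def ratio_def)
qed

lemma em_conformal: "E \<in> good_ends \<Longrightarrow> conformal (em E)"
  by (rule normalizedD(1)[OF em_props(1)])

lemma em_sets: "E \<in> good_ends \<Longrightarrow> sets (em E) = sets (path_borel G)"
  by (rule conformal_sets[OF em_conformal])

lemma em_cyl:
  "E \<in> good_ends \<Longrightarrow> awalk u \<nu> v \<Longrightarrow> \<nu> \<noteq> [] \<Longrightarrow> emeasure (em E) (cyl \<nu>) = weight \<nu> * ratio v E"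
  using conformal_cyl[OF em_conformal] em_props(3) awalk_last_in_verts by simp

text \<open>On cylinders the measures are weights of paths times kernels.\<close>

lemma em_measurable:
  assumes B: "B \<in> sets (path_borel G)"
  shows "(\<lambda>E. emeasure (em E) B) \<in> borel_measurable good_end_borel"
proof (rule measurable_path_kernel[OF _ _ _ B])
  show "sets (em E) = sets (path_borel G)" if "E \<in> space good_end_borel" for E
    using that em_sets by (simp add: space_N)
  show "emeasure (em E) (cyl [a]) < \<top>" if "E \<in> space good_end_borel" and a: "a \<in> arcs G" for E a
  proof -
    have E: "E \<in> good_ends" using that by (simp add: space_N)
    have "emeasure (em E) (cyl [a]) \<le> emeasure (em E) (cyl_vert G (tail G a))"
      by (intro emeasure_mono) (auto simp: cyl_def cyl_vert_def, simp add: em_sets[OF E] cyl_vert_def[symmetric])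
    also have "\<dots> < \<top>" using a by (intro conformal_finite[OF em_conformal[OF E]]) simp
    finally show ?thesis .
  qed
  show "(\<lambda>E. emeasure (em E) (cyl \<nu>)) \<in> borel_measurable good_end_borel" if \<nu>: "awalk u \<nu> v" "\<nu> \<noteq> []" for u \<nu> v
  proof -
    have "(\<lambda>E. weight \<nu> * ratio v E) \<in> borel_measurable good_end_borel"
      using ratio_measurable[OF awalk_last_in_verts[OF \<nu>(1)]]
      by (intro borel_measurable_times_ennreal measurable_on_N) simp_all
    then show ?thesis
      by (subst measurable_cong[of _ _ "\<lambda>E. weight \<nu> * ratio v E"]) (simp_all add: space_N em_cyl[OF _ \<nu>])
  qed
qed

text \<open>
  Use \<open>end_formula\<close> twice: from \<open>v\<close> to the paths following their ray, and
  from there back to \<open>v0\<close> with \<open>ratio v\<close> as additional factor.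
\<close>

lemma cyl_vert_decomposition:
  assumes m: "m \<in> normalized_conformal_measures G F \<beta> v0" and v: "v \<in> verts G"
  shows "emeasure m (cyl_vert G v) = (\<integral>\<^sup>+E. ratio v E \<partial>end_distribution m)"
proof -
  note cm = normalizedD[OF m]
  let ?s = "\<lambda>E. of_bool (E \<in> good_ends) :: ennreal"
  have s: "?s \<in> borel_measurable end_borel"
  proof -
    have [measurable]: "good_ends \<in> sets end_borel" by (rule summable_sets)
    show ?thesis by measurable
  qed
  have rs: "(\<lambda>E. ratio v E * ?s E) \<in> borel_measurable end_borel"
    by (intro borel_measurable_times_ennreal ratio_measurable v s)
  have "emeasure m (cyl_vert G v) = (\<integral>\<^sup>+x. indicator (cyl_vert G v) x \<partial>m)"
    by (simp add: conformal_sets[OF cm(1)])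
  also have "\<dots> = (\<integral>\<^sup>+x. of_bool (tail G (x 0) = v) * lift_end ?s x \<partial>m)"
    by (rule nn_integral_cong_AE)
       (use AE_summable[OF m] in eventually_elim, auto simp: lift_end_def summable_paths_def cyl_vert_def wandering_inf_path split: split_indicator)
  also have "\<dots> = (\<integral>\<^sup>+x. of_bool (x \<in> followers) * lift_end (\<lambda>E. potential v (\<xi> E) * ?s E) x \<partial>m)"
    by (rule end_formula[OF cm(1) v s])
  also have "\<dots> = (\<integral>\<^sup>+x. of_bool (x \<in> followers) * lift_end (\<lambda>E. potential v0 (\<xi> E) * (ratio v E * ?s E)) x \<partial>m)"
  proof -
    have "potential v (\<xi> E) * ?s E = potential v0 (\<xi> E) * (ratio v E * ?s E)" for E
      using ratio_potential[of E v] by (cases "E \<in> good_ends") simp_all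
    then show ?thesis by simp
  qed
  also have "\<dots> = (\<integral>\<^sup>+x. of_bool (tail G (x 0) = v0) * lift_end (\<lambda>E. ratio v E * ?s E) x \<partial>m)"
    by (rule end_formula[OF cm(1) v0 rs, symmetric])
  also have "\<dots> = (\<integral>\<^sup>+x. ratio v (end_class G x) * indicator start_paths x \<partial>m)"
    by (intro nn_integral_cong)
       (auto simp: lift_end_def summable_paths_def cyl_vert_def wandering_inf_path split: split_indicator)
  also have "\<dots> = (\<integral>\<^sup>+E. ratio v E \<partial>end_distribution m)"
    by (rule nn_integral_end_distribution[OF conformal_sets[OF cm(1)] measurable_on_N[OF ratio_measurable[OF v]], symmetric])
  finally show ?thesis .
qed

definition end_mixture :: "(nat \<Rightarrow> 'b) set measure \<Rightarrow> (nat \<Rightarrow> 'b) measure" where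
  "end_mixture \<nu> = mixture \<nu> em (path_borel G)"

lemma sets_end_mixture [simp]: "sets (end_mixture \<nu>) = sets (path_borel G)"
  by (simp add: end_mixture_def)

lemma emeasure_end_mixture:
  assumes \<nu>: "sets \<nu> = sets good_end_borel" and B: "B \<in> sets (path_borel G)"
  shows "emeasure (end_mixture \<nu>) B = (\<integral>\<^sup>+E. emeasure (em E) B \<partial>\<nu>)"
  unfolding end_mixture_def
proof (rule emeasure_mixture[OF _ _ B])
  show "sets (em E) = sets (path_borel G)" if "E \<in> space \<nu>" for E
    using that em_sets sets_eq_imp_space_eq[OF \<nu>] by (simp add: space_N)
  show "(\<lambda>E. emeasure (em E) B) \<in> borel_measurable \<nu>" if "B \<in> sets (path_borel G)" for B
    using em_measurable[OF that] by (simp add: measurable_cong_sets[OF \<nu> refl])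
qed

text \<open>
  Both measures give a cylinder the weight of its path times \<open>cyl_vert_decomposition\<close>
  at its end point.
\<close>

lemma mixture_of_distribution:
  assumes m: "m \<in> normalized_conformal_measures G F \<beta> v0"
  shows "end_mixture (end_distribution m) = m"
proof -
  note cm = normalizedD[OF m]
  have "m = end_mixture (end_distribution m)"
  proof (rule path_measure_eqI[OF conformal_sets[OF cm(1)] sets_end_mixture])
    show "emeasure m (cyl [a]) \<noteq> \<infinity>" if a: "a \<in> arcs G" for a
    proof -
      have aw: "awalk (tail G a) [a] (head G a)" using a by (rule arc_implies_awalk)
      show ?thesis
        using conformal_finite[OF cm(1) awalk_last_in_verts[OF aw]]
        by (simp add: conformal_cyl[OF cm(1) aw] ennreal_mult_eq_top_iff)
    qed
    fix u \<nu> v assume \<nu>: "awalk u \<nu> v" "\<nu> \<noteq> []"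
    then have v: "v \<in> verts G" by (intro awalk_last_in_verts)
    have r: "ratio v \<in> borel_measurable (end_distribution m)"
      using measurable_on_N[OF ratio_measurable[OF v]]
      by (simp add: measurable_cong_sets[OF sets_end_distribution refl])
    have sp: "space (end_distribution m) = good_ends"
      using sets_eq_imp_space_eq[OF sets_end_distribution[of m]] by (simp add: space_N)
    have "emeasure m (cyl \<nu>) = weight \<nu> * (\<integral>\<^sup>+E. ratio v E \<partial>end_distribution m)"
      by (simp add: conformal_cyl[OF cm(1) \<nu>] cyl_vert_decomposition[OF m v])
    also have "\<dots> = (\<integral>\<^sup>+E. weight \<nu> * ratio v E \<partial>end_distribution m)"
      by (rule nn_integral_cmult[OF r, symmetric])
    also have "\<dots> = (\<integral>\<^sup>+E. emeasure (em E) (cyl \<nu>) \<partial>end_distribution m)"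
      by (intro nn_integral_cong) (simp add: sp em_cyl[OF _ \<nu>])
    also have "\<dots> = emeasure (end_mixture (end_distribution m)) (cyl \<nu>)"
      by (rule emeasure_end_mixture[symmetric]) simp_all
    finally show "emeasure m (cyl \<nu>) = emeasure (end_mixture (end_distribution m)) (cyl \<nu>)" .
  qed
  then show ?thesis ..
qed

text \<open>
  All conditions are linear in the measure.  Only finiteness needs the uniform bound
  \<open>ratio_bounded\<close>.
\<close>

lemma end_mixture_normalized:
  assumes \<nu>: "\<nu> \<in> prob_measures_on good_end_borel"
  shows "end_mixture \<nu> \<in> normalized_conformal_measures G F \<beta> v0"
proof -
  have sets: "sets \<nu> = sets good_end_borel" and p: "emeasure \<nu> (space \<nu>) = 1"
    using \<nu> prob_space.emeasure_space_1 by (auto simp: prob_measures_on_def)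
  have sp: "space \<nu> = good_ends" using sets_eq_imp_space_eq[OF sets] by (simp add: space_N)
  note em = emeasure_end_mixture[OF sets]
  have vert: "emeasure (end_mixture \<nu>) (cyl_vert G v) = (\<integral>\<^sup>+E. ratio v E \<partial>\<nu>)" if v: "v \<in> verts G" for v
    unfolding em[OF cyl_vert_sets] by (intro nn_integral_cong) (simp add: sp em_props(3) v)
  have finite: "emeasure (end_mixture \<nu>) (cyl_vert G v) < \<infinity>" if v: "v \<in> verts G" for v
  proof -
    obtain c where c: "c < \<top>" "\<And>E. E \<in> good_ends \<Longrightarrow> ratio v E \<le> c" using ratio_bounded[OF v] by blast
    have "(\<integral>\<^sup>+E. ratio v E \<partial>\<nu>) \<le> (\<integral>\<^sup>+E. c \<partial>\<nu>)"
      using c(2) by (intro nn_integral_mono) (simp add: sp)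
    also have "\<dots> = c" using p by simp
    finally show ?thesis using c(1) unfolding vert[OF v] by simp
  qed
  have one: "emeasure (end_mixture \<nu>) (cyl_vert G v0) = 1"
  proof -
    have "emeasure (end_mixture \<nu>) (cyl_vert G v0) = (\<integral>\<^sup>+E. 1 \<partial>\<nu>)"
      unfolding em[OF cyl_vert_sets]
      by (intro nn_integral_cong) (simp add: sp normalizedD(2)[OF em_props(1)])
    then show ?thesis using p by simp
  qed
  have nonzero: "emeasure (end_mixture \<nu>) (space (end_mixture \<nu>)) \<noteq> 0"
    using emeasure_space[of "end_mixture \<nu>" "cyl_vert G v0"] one by auto
  have shift: "emeasure (end_mixture \<nu>) (shift ` (B \<inter> cyl_arc G a))
      = ennreal (exp (\<beta> * F a)) * emeasure (end_mixture \<nu>) (B \<inter> cyl_arc G a)"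
    if a: "a \<in> arcs G" and B: "B \<in> sets (path_borel G)" for a B
  proof -
    have Ba: "B \<inter> cyl_arc G a \<in> sets (path_borel G)" using B by (rule sets.Int) (rule cyl_arc_sets)
    have "emeasure (end_mixture \<nu>) (shift ` (B \<inter> cyl_arc G a))
        = (\<integral>\<^sup>+E. ennreal (exp (\<beta> * F a)) * emeasure (em E) (B \<inter> cyl_arc G a) \<partial>\<nu>)"
      unfolding em[OF shift_image_sets[OF a B]]
    proof (rule nn_integral_cong)
      fix E assume "E \<in> space \<nu>"
      then have "conformal (em E)" using em_conformal by (simp add: sp)
      then show "emeasure (em E) (shift ` (B \<inter> cyl_arc G a)) = ennreal (exp (\<beta> * F a)) * emeasure (em E) (B \<inter> cyl_arc G a)"
        using a B unfolding conformal_measure_def by blast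
    qed
    also have "\<dots> = ennreal (exp (\<beta> * F a)) * (\<integral>\<^sup>+E. emeasure (em E) (B \<inter> cyl_arc G a) \<partial>\<nu>)"
      using em_measurable[OF Ba] by (intro nn_integral_cmult) (simp add: measurable_cong_sets[OF sets refl])
    finally show ?thesis unfolding em[OF Ba] .
  qed
  show ?thesis
    unfolding normalized_conformal_measures_def conformal_measure_def regular_borel_measure_def
    using finite one nonzero shift by simp
qed

text \<open>
  Under \<open>em E\<close> almost every path has end \<open>E\<close>, and paths from
  \<open>v0\<close> have mass 1.
\<close>

lemma distribution_of_mixture:
  assumes \<nu>: "\<nu> \<in> prob_measures_on good_end_borel"
  shows "end_distribution (end_mixture \<nu>) = \<nu>"
proof (rule measure_eqI)
  have sets: "sets \<nu> = sets good_end_borel" using \<nu> by (simp add: prob_measures_on_def)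
  have sp: "space \<nu> = good_ends" using sets_eq_imp_space_eq[OF sets] by (simp add: space_N)
  show "sets (end_distribution (end_mixture \<nu>)) = sets \<nu>" by (simp add: sets)
  fix C assume "C \<in> sets (end_distribution (end_mixture \<nu>))"
  then have C: "C \<in> sets good_end_borel" by simp
  let ?P = "{x \<in> start_paths. end_class G x \<in> C}"
  have P: "?P \<in> sets (path_borel G)" by (rule start_vimage_sets[OF refl C])
  have "emeasure (end_distribution (end_mixture \<nu>)) C = (\<integral>\<^sup>+E. emeasure (em E) ?P \<partial>\<nu>)"
    by (simp only: emeasure_end_distribution[OF sets_end_mixture C] emeasure_end_mixture[OF sets P])
  also have "\<dots> = (\<integral>\<^sup>+E. indicator C E \<partial>\<nu>)"
  proof (rule nn_integral_cong)
    fix E assume "E \<in> space \<nu>"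
    then have E: "E \<in> good_ends" by (simp add: sp)
    then have e: "E \<in> ends G" by (simp add: summable_iff)
    have Es: "E \<in> sets (em E)" and null: "emeasure (em E) (space (em E) - E) = 0"
      using em_props(2)[OF E] by (auto simp: concentrated_on_def)
    have AE: "AE x in em E. x \<in> E"
      using null Es by (intro AE_I[of _ _ "space (em E) - E"]) auto
    have "emeasure (em E) ?P = emeasure (em E) (if E \<in> C then cyl_vert G v0 else {})"
    proof (rule emeasure_eq_AE)
      show "AE x in em E. x \<in> ?P \<longleftrightarrow> x \<in> (if E \<in> C then cyl_vert G v0 else {})"
        using AE
      proof eventually_elim
        case (elim x)
        then show ?case using ends_mem[OF e, of x] E by (simp add: summable_paths_def)
      qed
    qed (use P in \<open>simp_all add: em_sets[OF E]\<close>)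
    also have "\<dots> = indicator C E"
      using normalizedD(2)[OF em_props(1)[OF E]] by simp
    finally show "emeasure (em E) ?P = indicator C E" .
  qed
  also have "\<dots> = emeasure \<nu> C" using C by (simp add: sets)
  finally show "emeasure (end_distribution (end_mixture \<nu>)) C = emeasure \<nu> C" .
qed

end

lemma sets_convex_comb_measure [simp]: "sets (convex_comb_measure t M K) = sets M"
  by (simp add: convex_comb_measure_def)

lemma emeasure_convex_comb_measure:
  assumes sets: "sets K = sets M" and B: "B \<in> sets M"
  shows "emeasure (convex_comb_measure t M K) B = ennreal t * emeasure M B + ennreal (1 - t) * emeasure K B"
proof (rule emeasure_measure_of[OF convex_comb_measure_def])
  show "countably_additive (sets (convex_comb_measure t M K))
      (\<lambda>B. ennreal t * emeasure M B + ennreal (1 - t) * emeasure K B)"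
  proof (rule countably_additiveI)
    fix A :: "nat \<Rightarrow> 'a set"
    assume A: "range A \<subseteq> sets (convex_comb_measure t M K)" "disjoint_family A"
    then show "(\<Sum>n. ennreal t * emeasure M (A n) + ennreal (1 - t) * emeasure K (A n))
        = ennreal t * emeasure M (\<Union> (range A)) + ennreal (1 - t) * emeasure K (\<Union> (range A))"
      using sets by (simp add: suminf_add[symmetric] suminf_emeasure)
  qed
qed (use B sets.space_closed in \<open>auto simp: positive_def\<close>)

context end_selected_digraph
begin

lemma end_distribution_affine:
  "affine_map_on (normalized_conformal_measures G F \<beta> v0) end_distribution"
  unfolding affine_map_on_def
proof (intro ballI)
  fix m m' t
  assume m: "m \<in> normalized_conformal_measures G F \<beta> v0" and m': "m' \<in> normalized_conformal_measures G F \<beta> v0"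
  note s = conformal_sets[OF normalizedD(1)[OF m]] and s' = conformal_sets[OF normalizedD(1)[OF m']]
  let ?c = "convex_comb_measure t m m'"
  have sc: "sets ?c = sets (path_borel G)" by (simp add: s)
  show "end_distribution ?c = convex_comb_measure t (end_distribution m) (end_distribution m')"
  proof (rule measure_eqI)
    fix C assume "C \<in> sets (end_distribution ?c)"
    then have C: "C \<in> sets good_end_borel" by simp
    note P = start_vimage_sets[OF refl C]
    show "emeasure (end_distribution ?c) C
        = emeasure (convex_comb_measure t (end_distribution m) (end_distribution m')) C"
      using C P
      by (simp add: emeasure_end_distribution[OF sc C] emeasure_end_distribution[OF s C]
          emeasure_end_distribution[OF s' C] emeasure_convex_comb_measure s s')
  qed simp
qed

lemma end_distribution_bij:
  "bij_betw end_distribution (normalized_conformal_measures G F \<beta> v0) (prob_measures_on good_end_borel)"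
proof (rule bij_betw_byWitness[where f'=end_mixture])
  show "end_distribution ` normalized_conformal_measures G F \<beta> v0 \<subseteq> prob_measures_on good_end_borel"
    using end_distribution_prob by blast
  show "end_mixture ` prob_measures_on good_end_borel \<subseteq> normalized_conformal_measures G F \<beta> v0"
    using end_mixture_normalized by blast
qed (simp_all add: mixture_of_distribution distribution_of_mixture)

lemma emeasure_decomposition:
  assumes m: "m \<in> normalized_conformal_measures G F \<beta> v0" and B: "B \<in> sets (path_borel G)"
  shows "emeasure m B = (\<integral>\<^sup>+E. emeasure (em E) B \<partial>end_distribution m)"
  using emeasure_end_mixture[OF sets_end_distribution B, of m] by (simp add: mixture_of_distribution[OF m])

end

theorem theorem7p17:
  fixes G :: "('a, 'b) pre_digraph"
    and F :: "'b \<Rightarrow> real" and \<beta> :: real and v0 :: 'a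
    and \<xi> :: "(nat \<Rightarrow> 'b) set \<Rightarrow> (nat \<Rightarrow> 'b)"
  assumes "countable_digraph G"
    and "meager G"
    and "finite {v \<in> verts G. infinite (out_arcs G v)}"
    and "v0 \<in> verts G"
    and "\<forall>v\<in>verts G. 0 < A_green G F \<beta> v0 v \<and> A_green G F \<beta> v0 v < \<infinity>"
    and "end_selector G \<xi>"
  shows "\<exists>\<Phi>.
    bij_betw \<Phi> (normalized_conformal_measures G F \<beta> v0)
      (prob_measures_on (summable_end_borel G F \<beta> v0 \<xi>)) \<and>
    affine_map_on (normalized_conformal_measures G F \<beta> v0) \<Phi> \<and>
    (\<forall>B\<in>sets (path_borel G).
      (\<lambda>E. emeasure (end_measure G F \<beta> v0 \<xi> E) B)
        \<in> borel_measurable (summable_end_borel G F \<beta> v0 \<xi>) \<and>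
      (\<forall>m\<in>normalized_conformal_measures G F \<beta> v0.
        emeasure m B = (\<integral>\<^sup>+ E. emeasure (end_measure G F \<beta> v0 \<xi> E) B \<partial>\<Phi> m)))"
proof -
  interpret countable_digraph G by fact
  interpret end_selected_digraph G F \<beta> v0 \<xi>
    using assms by unfold_locales auto
  show ?thesis
    using end_distribution_bij end_distribution_affine em_measurable emeasure_decomposition by blast
qed

end
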